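(* Let $p$ be a prime with $p\ne 2,5$. Then $T_{p}$ maps $M$ into $M$ and $M(\mathrm{odd})$ into $M(\mathrm{odd})$. In fact, for each $m\ge 0$, $T_{p}$ stabilizes the $\mathbb{Z}/2$-span of the $r^{i}$, $0\le i\le 2m$, as well as the $\mathbb{Z}/2$-span of the $r^{2i}(r^{2}+r)$, $0\le i\le m-1$.
   Context: For even $k\ge 0$, $M_{k}$ is the set of $f\in\mathbb{Z}/2[[x]]$ for which there is a modular form of weight $k$ for $\Gamma_{0}(5)$ whose expansion at infinity (in $x=e^{2\pi i z}$) lies in $\mathbb{Z}[[x]]$ and reduces mod $2$ to $f$; $M=\bigcup_{m}M_{4m}$ and $M(\mathrm{odd})=M\cap x\,\mathbb{Z}/2[[x^{2}]]$. Let $r=\sum_{n>0}(x^{n^{2}}+x^{2n^{2}}+x^{5n^{2}}+x^{10n^{2}})\in\mathbb{Z}/2[[x]]$. For an odd prime $p$, $T_{p}:\mathbb{Z}/2[[x]]\to\mathbb{Z}/2[[x]]$ is $T_{p}(\sum c_{n}x^{n})=\sum c_{pn}x^{n}+\sum c_{n}x^{pn}$. *)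

theory Defs
  imports "HOL-Complex_Analysis.Complex_Analysis" "HOL-Library.Z2"
    "HOL-Computational_Algebra.Formal_Power_Series"
begin

definition upper_half :: "complex set" where
  "upper_half = {z. Im z > 0}"

text \<open>Modular forms of weight k for Gamma0(5): holomorphic on the upper half plane,
  transformation law for Gamma0(5), and holomorphic at all cusps, i.e. for every
  element of SL2(Z) the slashed function is bounded on Im z >= 1.\<close>
definition modform_G05 :: "nat \<Rightarrow> (complex \<Rightarrow> complex) \<Rightarrow> bool" where
  "modform_G05 k f \<longleftrightarrow>
     f holomorphic_on upper_half \<and>
     (\<forall>a b c d :: int. a*d - b*c = 1 \<and> 5 dvd c \<longrightarrow>
        (\<forall>z\<in>upper_half. f ((of_int a * z + of_int b) / (of_int c * z + of_int d))
                          = (of_int c * z + of_int d) ^ k * f z)) \<and>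
     (\<forall>a b c d :: int. a*d - b*c = 1 \<longrightarrow>
        (\<exists>B. \<forall>z. Im z \<ge> 1 \<longrightarrow>
           norm (f ((of_int a * z + of_int b) / (of_int c * z + of_int d)))
             \<le> B * norm (of_int c * z + of_int d) ^ k))"

definition Mk :: "nat \<Rightarrow> bit fps set" where
  "Mk k = {Abs_fps (\<lambda>n. of_int (a n)) | a :: nat \<Rightarrow> int.
             \<exists>f. modform_G05 k f \<and>
               (\<forall>z\<in>upper_half. (\<lambda>n. of_int (a n) * exp (2 * pi * \<i> * of_nat n * z)) sums f z)}"

definition M :: "bit fps set" where
  "M = (\<Union>m. Mk (4*m))"

definition M_odd :: "bit fps set" where
  "M_odd = M \<inter> {f. \<forall>n. even n \<longrightarrow> fps_nth f n = 0}"

definition r :: "bit fps" where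
  "r = Abs_fps (\<lambda>k. of_nat (card {(n, t). (n::nat) > 0 \<and> (t::nat) \<in> {1, 2, 5, 10} \<and> t * n^2 = k}))"

definition Tp :: "nat \<Rightarrow> bit fps \<Rightarrow> bit fps" where
  "Tp p f = Abs_fps (\<lambda>n. fps_nth f (p * n) + (if p dvd n then fps_nth f (n div p) else 0))"

definition span_r :: "nat \<Rightarrow> bit fps set" where
  "span_r m = {\<Sum>i\<le>2*m. fps_const (c i) * r ^ i | c :: nat \<Rightarrow> bit. True}"

definition span_r_odd :: "nat \<Rightarrow> bit fps set" where
  "span_r_odd m = {\<Sum>i<m. fps_const (c i) * (r ^ (2*i) * (r^2 + r)) | c :: nat \<Rightarrow> bit. True}"

end

theory Submission
  imports Defs "HOL-Number_Theory.Cong"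
begin

text \<open>
  For a form F of weight k the function
  sum_(j<p) F((z+j)/p) + p^k F(pz) is again a form of weight k for Gamma0(5), because right
  multiplication by an element of Gamma0(5) permutes the p+1 lines of F_p^2 that index the summands;
  its coefficients p a(pn) + p^k a(n/p) are integral and reduce to T_p, also in weight 0.
  So T_p preserves each Mk, and the theorem follows once Mk(4m) is identified with the span of
  1, r, ..., r^(2m).

  For that, put P = 1 - 24 S with S = sum sigma(n) x^n. The quasi-modularity of P makes
  G = (5 P(5z) - P(z))/4 a form of weight 2 and E4 = P^2 - 12 x dP/dx a form of weight 4. Modulo 2,
  (E4(z) - E4(5z))/48 is S + S(x^5) = r and (G^2 - E4)/12 is r^2 + r, so products of these forms with
  E4 give integral forms of weight 4m reducing to r^j and, after a correction, starting with an
  odd multiple of x^j, for all j \<le> 2m. They account for all of Mk(4m) because a form of weight 4m that is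
  O(x^(2m+1)) vanishes: its norm to level 1 has weight 24m, and divided by Delta^(2m) it is a
  holomorphic SL2(Z)-invariant function tending to 0 at infinity, hence 0 by the maximum principle.
\<close>

section \<open>Partial fractions of the cotangent\<close>

text \<open>The second span is governed by the parity of exponents. Over Z/2 squaring doubles
  exponents, so even powers of r are series in x^2; the coefficients of r at n and 2n agree, so r^2
  + r has only odd exponents. Writing r^(2i+1) = r^(2i) (r^2 + r) - r^(2i+2) then shows that the
  r^(2i) (r^2 + r) span exactly the odd part of the first span, and T_p respects parity because p is
  odd. The Eisenstein series with constant term 1 all reduce to 1, so r appears only after
  differences of forms are divided by 48 and 12 with integral quotients. An integral form is in
  general only a rational combination of the integral basis. As the leading coefficients are odd,
  some odd multiple of it is an integral combination, and an odd factor is invisible modulo 2. The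
  count is tight: the leading exponents 0, ..., 2m are exactly those of the coefficients that the
  vanishing bound controls.\<close>

lemma complex_not_Int: "Im w \<noteq> 0 \<Longrightarrow> w \<notin> \<int>"
  by (auto elim!: Ints_cases)

lemma sin_pi_nonzero:
  assumes "Im w \<noteq> 0"
  shows "sin (of_real pi * w) \<noteq> (0::complex)"
proof
  assume "sin (of_real pi * w) = 0"
  then obtain n :: int where "of_real pi * w = of_real (of_int n * pi)"
    by (auto simp: Complex_Transcendental.sin_eq_0)
  then have "Im (of_real pi * w) = 0" by (metis Im_complex_of_real)
  with assms show False by simp
qed

text \<open>Logarithmic derivative of the reflection formula Gamma(z) Gamma(1 - z) = pi / sin(pi
  z).\<close>

lemma Digamma_reflection:
  assumes "Im w \<noteq> 0"
  shows "Digamma (1 - w) - Digamma w = of_real pi * cot (of_real pi * w)"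
proof -
  have nz: "sin (of_real pi * w) \<noteq> 0" using sin_pi_nonzero assms by auto
  have i: "w \<notin> \<int>\<^sub>\<le>\<^sub>0" "1 - w \<notin> \<int>\<^sub>\<le>\<^sub>0"
    using assms complex_not_Int[of w] complex_not_Int[of "1-w"] nonpos_Ints_Int by auto
  have "((\<lambda>z. Gamma z * Gamma (1 - z)) has_field_derivative
     Gamma w * Gamma (1 - w) * (Digamma w - Digamma (1 - w))) (at w)"
    using i by (auto intro!: derivative_eq_intros simp: algebra_simps)
  moreover have "((\<lambda>z. of_real pi / sin (of_real pi * z)) has_field_derivative
     - (of_real pi / sin (of_real pi * w)) * (of_real pi * cot (of_real pi * w))) (at w)"
    using nz by (auto intro!: derivative_eq_intros simp: cot_def power2_eq_square)
  ultimately have "Gamma w * Gamma (1 - w) * (Digamma w - Digamma (1 - w)) =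
      - (of_real pi / sin (of_real pi * w)) * (of_real pi * cot (of_real pi * w))"
    unfolding Gamma_reflection_complex by (rule DERIV_unique)
  then have "(of_real pi / sin (of_real pi * w)) * (Digamma w - Digamma (1 - w)) =
      (of_real pi / sin (of_real pi * w)) * (- (of_real pi * cot (of_real pi * w)))"
    unfolding Gamma_reflection_complex by simp
  then have "Digamma w - Digamma (1 - w) = - (of_real pi * cot (of_real pi * w))"
    using nz by (subst (asm) mult_cancel_left) auto
  then show ?thesis by (simp add: algebra_simps)
qed

definition csc2 :: "complex \<Rightarrow> complex" where
  "csc2 w = (of_real pi / sin (of_real pi * w))^2"

lemma csc2_minus: "csc2 (- w) = csc2 w"
  by (simp add: csc2_def power_divide)

text \<open>Differentiating the Digamma reflection turns the series of the trigamma function into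
  the partial fractions of \<open>csc2\<close>.\<close>

lemma Polygamma_1_reflection:
  assumes "Im w \<noteq> 0"
  shows "Polygamma 1 w + Polygamma 1 (1 - w) = csc2 w"
proof -
  have nz: "sin (of_real pi * w) \<noteq> 0" using sin_pi_nonzero assms by auto
  have i: "w \<notin> \<int>\<^sub>\<le>\<^sub>0" "1 - w \<notin> \<int>\<^sub>\<le>\<^sub>0"
    using assms complex_not_Int[of w] complex_not_Int[of "1-w"] nonpos_Ints_Int by auto
  have o: "open {z. Im z \<noteq> 0}"
    by (intro open_Collect_neq continuous_intros)
  have "((\<lambda>z. Digamma (1 - z) - Digamma z) has_field_derivative
     - (Polygamma 1 w + Polygamma 1 (1 - w))) (at w)"
    using i by (auto intro!: derivative_eq_intros simp: algebra_simps)
  moreover have "((\<lambda>z. of_real pi * cot (of_real pi * z)) has_field_derivative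
     - csc2 w) (at w)"
    using nz by (auto intro!: derivative_eq_intros DERIV_chain'[OF _ DERIV_cot]
       simp: csc2_def power2_eq_square field_simps)
  then have "((\<lambda>z. Digamma (1 - z) - Digamma z) has_field_derivative - csc2 w) (at w)"
    by (rule has_field_derivative_transform_within_open[OF _ o])
       (use assms Digamma_reflection in auto)
  ultimately have "- (Polygamma 1 w + Polygamma 1 (1 - w)) = - csc2 w" by (rule DERIV_unique)
  then show ?thesis by (simp only: neg_equal_iff_equal)
qed

lemma sums_Polygamma_1:
  assumes "Im w \<noteq> 0"
  shows "(\<lambda>n. 1 / (w + of_nat n)^2) sums Polygamma 1 w"
proof -
  have "w \<noteq> 0" using assms by auto
  from Polygamma_LIMSEQ[OF this, of 1] show ?thesis
    by (simp add: inverse_eq_divide power2_eq_square)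
qed

text \<open>Pairing n with -(n + 1) meets every integer once; \<open>csc2_sums'\<close> pairs n + 1
  with -(n + 1) and so leaves out 0. The first fits a row of the double series below, the second a
  column, from which c = 0 is excluded.\<close>

lemma csc2_sums:
  assumes "Im w \<noteq> 0"
  shows "(\<lambda>n. 1 / (w + of_nat n)^2 + 1 / (w - of_nat (Suc n))^2) sums csc2 w"
proof -
  have "(\<lambda>n. 1 / (w + of_nat n)^2 + 1 / ((1 - w) + of_nat n)^2) sums csc2 w"
    using sums_add[OF sums_Polygamma_1[of w] sums_Polygamma_1[of "1-w"]] assms
    by (simp add: Polygamma_1_reflection del: One_nat_def)
  moreover have "((1 - w) + of_nat n)^2 = (w - of_nat (Suc n))^2" for n
    by (simp add: power2_eq_square algebra_simps)
  ultimately show ?thesis by simp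
qed

lemma csc2_sums':
  assumes "Im w \<noteq> 0"
  shows "(\<lambda>n. 1 / (w + of_nat (Suc n))^2 + 1 / (w - of_nat (Suc n))^2) sums (csc2 w - 1 / w^2)"
proof -
  have "(\<lambda>n. 1 / (w + of_nat (Suc n))^2) sums (Polygamma 1 w - 1 / w^2)"
    using sums_Polygamma_1[OF assms] by (subst sums_Suc_iff) simp
  moreover have "(\<lambda>n. 1 / ((1 - w) + of_nat n)^2) sums Polygamma 1 (1 - w)"
    using assms by (intro sums_Polygamma_1) auto
  moreover have "((1 - w) + of_nat n)^2 = (w - of_nat (Suc n))^2" for n
    by (simp add: power2_eq_square algebra_simps)
  ultimately have "(\<lambda>n. 1 / (w + of_nat (Suc n))^2 + 1 / (w - of_nat (Suc n))^2)
      sums ((Polygamma 1 w - 1 / w^2) + Polygamma 1 (1 - w))"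
    by (intro sums_add) simp_all
  then show ?thesis
    by (simp add: Polygamma_1_reflection[OF assms, symmetric] algebra_simps del: One_nat_def)
qed

lemma tendsto_inverse_shift: "(\<lambda>n. 1 / (w + of_nat n :: complex)) \<longlonglongrightarrow> 0"
proof -
  have "filterlim (\<lambda>n. w + of_nat n :: complex) at_infinity sequentially"
    by (intro tendsto_add_filterlim_at_infinity[OF tendsto_const] tendsto_of_nat)
  from filterlim_compose[OF tendsto_inverse_0 this] show ?thesis
    by (simp add: inverse_eq_divide)
qed

lemma cot_sums:
  assumes "Im w \<noteq> 0"
  shows "(\<lambda>n. 1 / (w + of_nat (Suc n)) + 1 / (w - of_nat (Suc n)))
           sums (of_real pi * cot (of_real pi * w) - 1 / w)"
proof -
  have i: "w \<noteq> 0" "1 - w \<noteq> 0" using assms by auto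
  have S: "(\<lambda>k. inverse (of_nat (Suc k)) - inverse (u + of_nat k))
             sums (Digamma u + euler_mascheroni)" if "u \<noteq> 0" for u :: complex
    using summable_Digamma[OF that] by (simp add: Digamma_def summable_sums)
  have "(\<lambda>k. inverse (w + of_nat k) - inverse (1 - w + of_nat k))
           sums (Digamma (1 - w) - Digamma w)"
    using sums_diff[OF S[OF i(2)] S[OF i(1)]] by simp
  then have 1: "(\<lambda>k. 1 / (w + of_nat k) - 1 / (1 - w + of_nat k))
           sums (of_real pi * cot (of_real pi * w))"
    by (simp add: Digamma_reflection assms inverse_eq_divide)
  \<comment> \<open>Adding this telescoping series changes the pairing of k with -(k + 1) into that
    of k + 1 with -(k + 1).\<close>
  have 2: "(\<lambda>k. 1 / (w + of_nat (Suc k)) - 1 / (w + of_nat k)) sums (0 - 1 / (w + of_nat 0))"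
    by (rule telescope_sums[OF tendsto_inverse_shift])
  have 3: "1 / (w - of_nat (Suc n)) = - (1 / (1 - w + of_nat n))" for n
    by (simp add: minus_divide_right)
  show ?thesis using sums_add[OF 1 2] unfolding 3 by (simp add: algebra_simps)
qed

text \<open>An unconditional sum is the limit along any exhausting sequence of finite sets, here the
  intervals from -N to N without 0. This links \<open>has_sum\<close>, for which rows and columns
  may be exchanged, with the ordered series above.\<close>

lemma has_sum_int_symmetric:
  fixes f :: "int \<Rightarrow> 'a::real_normed_vector"
  assumes "(f has_sum X) (- {0})"
  shows "(\<lambda>n. f (int (Suc n)) + f (- int (Suc n))) sums X"
proof -
  have "filterlim (\<lambda>N. {- int N..int N} - {0}) (finite_subsets_at_top (- {0})) sequentially"
    unfolding filterlim_finite_subsets_at_top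
  proof safe
    fix Y :: "int set" assume Y: "finite Y" "Y \<subseteq> - {0}"
    define b where "b = Max (insert 0 (abs ` Y))"
    have b: "\<bar>y\<bar> \<le> b" if "y \<in> Y" for y
      unfolding b_def using Y(1) that by (intro Max_ge) auto
    have "eventually (\<lambda>N. nat b \<le> N) sequentially" by (rule eventually_ge_at_top)
    then show "\<forall>\<^sub>F x in sequentially. finite ({- int x..int x} - {0}) \<and>
                Y \<subseteq> {- int x..int x} - {0} \<and> {- int x..int x} - {0} \<subseteq> - {0}"
    proof eventually_elim
      case (elim x)
      have "- int x \<le> y \<and> y \<le> int x" if "y \<in> Y" for y
        using b[OF that] elim by linarith
      then show ?case using Y by auto
    qed
  qed
  with assms have "(\<lambda>N. sum f ({- int N..int N} - {0})) \<longlonglongrightarrow> X"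
    unfolding has_sum_def by (rule filterlim_compose)
  moreover have "sum f ({- int N..int N} - {0}) = (\<Sum>n<N. f (int (Suc n)) + f (- int (Suc n)))" for N
  proof (induction N)
    case (Suc N)
    have "{- int (Suc N)..int (Suc N)} - {0} =
       insert (int (Suc N)) (insert (- int (Suc N)) ({- int N..int N} - {0}))" by auto
    then show ?case using Suc by (simp add: algebra_simps)
  qed auto
  ultimately show ?thesis by (simp add: sums_def)
qed

lemma has_sum_int_intervals:
  fixes f :: "int \<Rightarrow> 'a::real_normed_vector"
  assumes "(f has_sum X) UNIV"
  shows "(\<lambda>n. f (int n) + f (- int (Suc n))) sums X"
proof -
  have "filterlim (\<lambda>N. {- int N..<int N}) (finite_subsets_at_top UNIV) sequentially"
    unfolding filterlim_finite_subsets_at_top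
  proof safe
    fix Y :: "int set" assume Y: "finite Y"
    define b where "b = Max (insert 0 (abs ` Y))"
    have b: "\<bar>y\<bar> \<le> b" if "y \<in> Y" for y
      unfolding b_def using Y(1) that by (intro Max_ge) auto
    have "eventually (\<lambda>N. nat b + 1 \<le> N) sequentially" by (rule eventually_ge_at_top)
    then show "\<forall>\<^sub>F x in sequentially. finite {- int x..<int x} \<and>
                Y \<subseteq> {- int x..<int x} \<and> {- int x..<int x} \<subseteq> UNIV"
    proof eventually_elim
      case (elim x)
      have "- int x \<le> y \<and> y < int x" if "y \<in> Y" for y
        using b[OF that] elim by linarith
      then show ?case using Y by auto
    qed
  qed
  with assms have "(\<lambda>N. sum f {- int N..<int N}) \<longlonglongrightarrow> X"
    unfolding has_sum_def by (rule filterlim_compose)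
  moreover have "sum f {- int N..<int N} = (\<Sum>n<N. f (int n) + f (- int (Suc n)))" for N
  proof (induction N)
    case (Suc N)
    have "{- int (Suc N)..<int (Suc N)} =
       insert (int N) (insert (- int (Suc N)) {- int N..<int N})" by auto
    then show ?case using Suc by (simp add: algebra_simps)
  qed auto
  ultimately show ?thesis by (simp add: sums_def)
qed

section \<open>Lambert series of the divisor sums\<close>

definition nome :: "complex \<Rightarrow> complex" where
  "nome z = exp (2 * of_real pi * \<i> * z)"

lemma nome_nonzero [simp]: "nome z \<noteq> 0"
  by (simp add: nome_def)

lemma norm_nome: "norm (nome z) = exp (- 2 * pi * Im z)"
  by (simp add: nome_def norm_exp_eq_Re)

lemma norm_nome_less_1: "Im z > 0 \<Longrightarrow> norm (nome z) < 1"
  by (simp add: norm_nome)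

lemma nome_add: "nome (z + w) = nome z * nome w"
  by (simp add: nome_def distrib_left exp_add)

lemma nome_of_nat_mult: "nome (of_nat n * z) = nome z ^ n"
  by (simp add: nome_def exp_of_nat_mult[symmetric] mult_ac)

lemma nome_of_nat [simp]: "nome (of_nat n) = 1"
  using exp_of_nat2_mult[of "2 * pi * \<i>"] exp_of_nat_mult[of n "2 * of_real pi * \<i>"]
  by (simp add: nome_def mult_ac)

lemma csc2_nome:
  assumes "Im w > 0"
  shows "csc2 w = - 4 * of_real pi ^ 2 * (nome w / (1 - nome w)^2)"
proof -
  define e where "e = exp (\<i> * (of_real pi * w))"
  have [simp]: "e \<noteq> 0" by (simp add: e_def)
  have q: "nome w = e^2"
    by (simp add: e_def nome_def power2_eq_square exp_add[symmetric] algebra_simps)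
  have e1: "e^2 \<noteq> 1" using norm_nome_less_1[OF assms] q by auto
  have s: "sin (of_real pi * w) = (e - 1 / e) / (2 * \<i>)"
    by (simp add: sin_exp_eq e_def exp_minus inverse_eq_divide)
  have "csc2 w = of_real pi ^ 2 * (2 * \<i>)^2 / (e - 1 / e)^2"
    by (simp add: csc2_def s power_divide power_mult_distrib)
  also have "(e - 1 / e)^2 = (1 - e^2)^2 / e^2"
    by (simp add: power2_eq_square field_simps)
  finally show ?thesis
    using e1 by (simp add: q power_mult_distrib)
qed

definition cfps :: "int fps \<Rightarrow> complex fps" where
  "cfps A = Abs_fps (\<lambda>n. of_int (fps_nth A n))"

lemma cfps_nth [simp]: "fps_nth (cfps A) n = of_int (fps_nth A n)"
  by (simp add: cfps_def)

text \<open>The constant coefficient is 0, being a sum over the infinite set of divisors of 0.\<close>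
definition sigma_fps :: "int fps" where
  "sigma_fps = Abs_fps (\<lambda>n. int (\<Sum>d | d dvd n. d))"

lemma has_sum_divisor_power:
  fixes x :: "'a::{banach,real_normed_field}"
  assumes "norm x < 1"
  shows "((\<lambda>n. of_nat n * x ^ n) has_sum (x / (1 - x)^2)) {1..}"
proof -
  have "norm (norm x) < 1" using assms by simp
  from sums_mult[OF geometric_deriv_sums[OF assms], of x]
       sums_summable[OF sums_mult[OF geometric_deriv_sums[OF this], of "norm x"]]
  have "(\<lambda>n. of_nat (Suc n) * x ^ Suc n) sums (x / (1 - x)^2)"
    "summable (\<lambda>n. norm (of_nat (Suc n) * x ^ Suc n))"
    by (simp_all add: mult_ac norm_mult norm_power del: of_nat_Suc)
  then have "((\<lambda>n. of_nat (Suc n) * x ^ Suc n) has_sum (x / (1 - x)^2)) UNIV"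
    by (intro norm_summable_imp_has_sum)
  also have "?this \<longleftrightarrow> ?thesis"
    by (intro has_sum_reindex_bij_witness[of _ "\<lambda>n. n-1" "\<lambda>n. n+1"]) auto
  finally show ?thesis .
qed

lemma sums_of_has_sum_from_1:
  fixes f :: "nat \<Rightarrow> 'a::real_normed_vector"
  assumes "(f has_sum S) {1..}"
  shows "(\<lambda>n. f (Suc n)) sums S"
proof -
  have "((\<lambda>n. f (Suc n)) has_sum S) UNIV \<longleftrightarrow> (f has_sum S) {1..}"
    by (intro has_sum_reindex_bij_witness[of _ "\<lambda>n. n-1" "\<lambda>n. n+1"]) auto
  with assms show ?thesis by (simp add: has_sum_imp_sums)
qed

text \<open>Summing over n first leaves x^c / (1 - x^c)^2, which a geometric series dominates
  because 1 - x^c \<ge> 1 - x.\<close>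

lemma lambert_abs_summable:
  fixes q :: complex
  assumes "norm q < 1"
  shows "(\<lambda>(c,n). norm (of_nat n * q ^ (c * n))) summable_on {1::nat..} \<times> {1..}"
proof (rule summable_on_SigmaI)
  define x where "x = norm q"
  have x: "0 \<le> x" "x < 1" using assms by (auto simp: x_def)
  show "((\<lambda>n. case (c, n) of (c, n) \<Rightarrow> norm (of_nat n * q ^ (c * n)))
     has_sum (x ^ c / (1 - x ^ c)^2)) {1..}" if "c \<in> {1..}" for c
    using has_sum_divisor_power[of "x ^ c"] x that
    by (simp add: norm_mult norm_power x_def power_mult power_Suc_less_one power_less_one_iff)
  have g: "(\<lambda>c. x ^ c / (1 - x)^2) summable_on {1..}"
    using has_sum_divide_const[OF has_sum_geometric_from_1[of x], of "(1-x)^2"] x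
    by (auto simp: summable_on_def)
  show "(\<lambda>c. x ^ c / (1 - x ^ c)^2) summable_on {1..}"
  proof (rule summable_on_comparison_test[OF g])
    fix c :: nat assume c: "c \<in> {1..}"
    have "x ^ c \<le> x ^ 1" using c x by (intro power_decreasing) auto
    then have "(1 - x)^2 \<le> (1 - x ^ c)^2" using x by (intro power_mono) auto
    then show "x ^ c / (1 - x ^ c)^2 \<le> x ^ c / (1 - x)^2"
      using x c by (intro divide_left_mono mult_pos_pos zero_less_power) (auto simp: power_less_one_iff)
    show "0 \<le> x ^ c / (1 - x ^ c)^2" using x by auto
  qed
qed auto

lemma lambert_sigma:
  fixes q :: complex
  assumes q: "norm q < 1"
  shows "(\<lambda>n. of_int (fps_nth sigma_fps (Suc n)) * q ^ Suc n) sums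
            (\<Sum>c. q ^ Suc c / (1 - q ^ Suc c)^2)"
    and "summable (\<lambda>c. q ^ Suc c / (1 - q ^ Suc c)^2)"
proof -
  define f where "f = (\<lambda>(c,n). of_nat n * q ^ (c * n) :: complex)"
  have "f summable_on {1..} \<times> {1..}"
    using lambert_abs_summable[OF q]
    by - (rule abs_summable_summable, simp add: f_def case_prod_unfold)
  then obtain S where S: "(f has_sum S) ({1..} \<times> {1..})"
    by (auto simp: summable_on_def)
  have "((\<lambda>c. q ^ c / (1 - q ^ c)^2) has_sum S) {1..}"
  proof (rule has_sum_SigmaD[OF S])
    fix c :: nat assume "c \<in> {1..}"
    then show "((\<lambda>n. f (c, n)) has_sum (q ^ c / (1 - q ^ c)^2)) {1..}"
      using has_sum_divisor_power[of "q ^ c"] q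
      by (simp add: f_def norm_power power_less_one_iff power_mult)
  qed
  from sums_of_has_sum_from_1[OF this]
  have 1: "(\<lambda>c. q ^ Suc c / (1 - q ^ Suc c)^2) sums S" .
  \<comment> \<open>Grouping the pairs (c, n) by m = cn, with d = n running through the divisors of
    m, turns the Lambert series into divisor sums.\<close>
  have "((\<lambda>(m,d). of_nat d * q ^ m) has_sum S) (SIGMA m:{1..}. {d. d dvd m}) \<longleftrightarrow>
        (f has_sum S) ({1..} \<times> {1..})"
    by (rule has_sum_reindex_bij_witness[of _ "\<lambda>(c,n). (c * n, n)" "\<lambda>(m,d). (m div d, d)"])
       (auto simp: f_def mult.commute elim!: dvdE intro!: Suc_leI)
  with S have S': "((\<lambda>(m,d). of_nat d * q ^ m) has_sum S) (SIGMA m:{1..}. {d. d dvd m})"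
    by simp
  have "((\<lambda>m. of_int (fps_nth sigma_fps m) * q ^ m) has_sum S) {1..}"
  proof (rule has_sum_SigmaD[OF S'])
    fix m :: nat assume "m \<in> {1..}"
    then have "finite {d. d dvd m}" by auto
    then show "((\<lambda>d. case (m, d) of (m, d) \<Rightarrow> of_nat d * q ^ m)
        has_sum (of_int (fps_nth sigma_fps m) * q ^ m)) {d. d dvd m}"
      by (intro has_sum_finiteI) (auto simp: sigma_fps_def sum_distrib_right)
  qed
  from sums_of_has_sum_from_1[OF this] 1
  show "(\<lambda>n. of_int (fps_nth sigma_fps (Suc n)) * q ^ Suc n) sums
            (\<Sum>c. q ^ Suc c / (1 - q ^ Suc c)^2)"
    and "summable (\<lambda>c. q ^ Suc c / (1 - q ^ Suc c)^2)"
    by (simp_all add: sums_iff)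
qed

lemma sigma_fps_0 [simp]: "fps_nth sigma_fps 0 = 0"
  by (simp add: sigma_fps_def)

lemma fps_conv_radius_ge_1:
  fixes A :: "complex fps"
  assumes "\<And>q. norm q < 1 \<Longrightarrow> q \<noteq> 0 \<Longrightarrow> summable (\<lambda>n. fps_nth A n * q ^ n)"
  shows "fps_conv_radius A \<ge> 1"
  unfolding fps_conv_radius_def
proof (rule conv_radius_geI_ex)
  fix r :: real assume r: "0 < r" "ereal r < 1"
  then show "\<exists>z. norm z = r \<and> summable (\<lambda>n. fps_nth A n * z ^ n)"
    using assms[of "of_real r"] by (intro exI[of _ "of_real r"]) auto
qed

lemma sigma_fps_conv_radius: "fps_conv_radius (cfps sigma_fps) \<ge> 1"
proof (rule fps_conv_radius_ge_1)
  fix q :: complex assume "norm q < 1"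
  from sums_summable[OF lambert_sigma(1)[OF this]]
  show "summable (\<lambda>n. fps_nth (cfps sigma_fps) n * q ^ n)"
    by (subst (asm) summable_Suc_iff) simp
qed

definition sigma_series :: "complex \<Rightarrow> complex" where
  "sigma_series z = eval_fps (cfps sigma_fps) (nome z)"

lemma csc2_sums_sigma_series:
  assumes "Im z > 0"
  shows "(\<lambda>c. csc2 (of_nat (Suc c) * z)) sums (- 4 * of_real pi ^ 2 * sigma_series z)"
proof -
  note q = norm_nome_less_1[OF assms]
  have "(\<lambda>n. fps_nth (cfps sigma_fps) n * nome z ^ n) sums sigma_series z"
    unfolding sigma_series_def using q sigma_fps_conv_radius
    by (intro sums_eval_fps) (metis ereal_less(3) less_le_trans one_ereal_def)
  then have "(\<lambda>n. fps_nth (cfps sigma_fps) (Suc n) * nome z ^ Suc n) sums sigma_series z"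
    by (subst sums_Suc_iff) simp
  with lambert_sigma[OF q] have "(\<lambda>c. nome z ^ Suc c / (1 - nome z ^ Suc c)^2) sums sigma_series z"
    by (auto simp: sums_iff)
  from sums_mult[OF this, of "- 4 * of_real pi ^ 2"] show ?thesis
    using assms by (simp add: csc2_nome nome_of_nat_mult del: of_nat_Suc power_Suc)
qed

section \<open>Quasi-modularity of the weight 2 Eisenstein series\<close>

lemma summable_on_int_abs:
  fixes f :: "nat \<Rightarrow> real"
  assumes "summable f" "\<And>n. f n \<ge> 0"
  shows "(\<lambda>d::int. f (nat \<bar>d\<bar>)) summable_on UNIV"
proof -
  have s: "f summable_on UNIV"
    using assms by (intro norm_summable_imp_summable_on) auto
  have 1: "(\<lambda>d::int. f (nat \<bar>d\<bar>)) summable_on {0..}"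
    using s by (subst summable_on_reindex_bij_witness[of _ int nat UNIV f]) auto
  have 2: "(\<lambda>d::int. f (nat \<bar>d\<bar>)) summable_on {..<0}"
    using summable_on_subset[OF s, of "{1..}"]
    by (subst summable_on_reindex_bij_witness[of _ "\<lambda>n. - int n" "\<lambda>d. nat (- d)" "{1..}" f]) auto
  have "{0..} \<union> {..<0} = (UNIV :: int set)" "{0..} \<inter> {..<0} = ({} :: int set)" by auto
  with summable_on_Un_disjoint[OF 1 2] show ?thesis by auto
qed

lemma summable_three_halves: "summable (\<lambda>n. 1 / sqrt (1 + real n) ^ 3)"
proof -
  have "summable (\<lambda>n. real (n + 1) powr (- (3/2)))"
    by (subst summable_iff_shift[where f = "\<lambda>n. real n powr (- (3/2))"]) (simp add: summable_real_powr_iff)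
  moreover have "real (n + 1) powr (- (3/2)) = 1 / sqrt (1 + real n) ^ 3" for n
    by (simp add: powr_minus_divide powr_half_sqrt[symmetric] powr_power add_ac)
  ultimately show ?thesis by simp
qed

text \<open>
  The series over 1/(cz+d)^2 converges only conditionally. Each term differs from the following one, of order
  |cz+d|^(-3), by 1/(cz+d) - 1/(cz+d+1), which telescopes to 0 along rows (c fixed) but not
  along columns: this is the source of the correction term in the inversion formula.
\<close>
definition eisen_term :: "complex \<Rightarrow> int \<Rightarrow> int \<Rightarrow> complex" where
  "eisen_term z c d = 1 / ((of_int c * z + of_int d)^2 * (of_int c * z + of_int d + 1))"

text \<open>The imaginary part of cz + d controls |c|, and the triangle inequality then controls
  |d|. Since |c| \<ge> 1, the bound on |c| also absorbs the summands 1.\<close>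

lemma linear_form_bounds:
  assumes "Im z > 0" "c \<noteq> 0"
  defines "K \<equiv> 1 + (norm z + 1) / Im z"
  shows "1 + \<bar>of_int c\<bar> \<le> 2 * K * norm (of_int c * z + of_int d)"
    and "1 + \<bar>of_int d\<bar> \<le> K * norm (of_int c * z + of_int d)"
proof -
  define w where "w = of_int c * z + of_int d"
  have "\<bar>of_int c\<bar> * Im z = \<bar>Im w\<bar>"
    using assms by (simp add: w_def abs_mult)
  also have "\<dots> \<le> norm w" by (rule abs_Im_le_cmod)
  finally have c: "\<bar>of_int c\<bar> \<le> norm w / Im z" using assms by (simp add: field_simps)
  have c1: "1 \<le> \<bar>of_int c :: real\<bar>" using assms by linarith
  have "norm (of_int d :: complex) = norm (w - of_int c * z)" by (simp add: w_def)
  also have "\<dots> \<le> norm w + \<bar>of_int c\<bar> * norm z"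
    using norm_triangle_ineq4[of w "of_int c * z"] by (simp add: norm_mult)
  also have "\<dots> \<le> norm w + norm w / Im z * norm z"
    using c by (intro add_left_mono mult_right_mono) auto
  finally have d: "\<bar>of_int d\<bar> \<le> norm w + norm w / Im z * norm z" by simp
  have K: "K * norm w = norm w + norm w * norm z / Im z + norm w / Im z"
    unfolding K_def by (simp add: distrib_right distrib_left add_divide_distrib mult_ac)
  have "0 \<le> norm w * norm z / Im z" using assms by auto
  then have "norm w / Im z \<le> K * norm w" unfolding K by simp
  then show "1 + \<bar>of_int c\<bar> \<le> 2 * K * norm (of_int c * z + of_int d)"
    using c c1 unfolding w_def[symmetric] by linarith
  show "1 + \<bar>of_int d\<bar> \<le> K * norm (of_int c * z + of_int d)"
    using c c1 d K unfolding w_def[symmetric] by simp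
qed

text \<open>Both 1 + |c| and 1 + |d| are at most a multiple of |cz + d|, hence so is their geometric
  mean. The cube of the latter splits into powers 3/2 of each, which bounds the double series by a
  product of two convergent series.\<close>

lemma norm_eisen_term:
  assumes "Im z > 0" "c \<noteq> 0"
  defines "K \<equiv> 1 + (norm z + 1) / Im z"
  shows "norm (eisen_term z c d) \<le>
     (2 * K) ^ 3 * (1 / sqrt (1 + \<bar>of_int c\<bar>) ^ 3 * (1 / sqrt (1 + \<bar>of_int d\<bar>) ^ 3))"
proof -
  define w where "w = of_int c * z + of_int d"
  define p where "p = (1 + \<bar>of_int c\<bar>) * (1 + \<bar>of_int d\<bar> :: real)"
  have K: "K > 0" using assms by (auto simp: K_def intro!: add_pos_nonneg)
  note b = linear_form_bounds[OF assms(1,2), folded K_def]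
  have "p \<le> (2 * K * norm w) * (2 * K * norm w)"
    unfolding p_def using b[of d] K
    by (intro mult_mono) (auto simp: w_def intro: order_trans)
  then have 1: "sqrt p \<le> 2 * K * norm w"
    using K by (intro real_le_lsqrt) (auto simp: p_def power2_eq_square)
  have gen: "1 + x \<le> 2 * (1 + a)" if "x \<le> a + 1" "0 \<le> a" for x a :: real
    using that by simp
  have d1: "\<bar>of_int d\<bar> \<le> \<bar>of_int d + 1\<bar> + (1 :: real)"
    using abs_triangle_ineq[of "of_int d + 1" "- 1 :: real"] by simp
  \<comment> \<open>The third factor of the denominator belongs to d + 1; passing from d to d + 1
    costs a factor 2.\<close>
  have "1 + \<bar>of_int d\<bar> \<le> 2 * (1 + \<bar>of_int (d + 1) :: real\<bar>)"
    using gen[OF d1 abs_ge_zero] by simp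
  also have "\<dots> \<le> 2 * (K * norm (w + 1))"
    using b(2)[of "d + 1"] by (simp add: w_def add_ac)
  finally have "p \<le> (2 * K * norm (w + 1)) * (2 * K * norm (w + 1))"
    unfolding p_def using b(1)[of "d + 1"] K
    by (intro mult_mono) (auto simp: w_def add_ac)
  then have 2: "sqrt p \<le> 2 * K * norm (w + 1)"
    using K by (intro real_le_lsqrt) (auto simp: p_def power2_eq_square)
  have p: "p > 0" by (simp add: p_def)
  have "sqrt p ^ 3 \<le> (2 * K * norm w) * (2 * K * norm w) * (2 * K * norm (w + 1))"
    unfolding power3_eq_cube using 1 2 p K by (intro mult_mono) auto
  then have 3: "sqrt p ^ 3 \<le> (2 * K) ^ 3 * norm (w^2 * (w + 1))"
    by (simp add: power3_eq_cube power2_eq_square norm_mult mult_ac)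
  moreover have "sqrt p ^ 3 > 0" using p by simp
  ultimately have "0 < (2 * K) ^ 3 * norm (w^2 * (w + 1))" by linarith
  then have "norm (w^2 * (w + 1)) > 0" using K by (simp only: zero_less_mult_iff zero_less_power) auto
  then have "norm (eisen_term z c d) \<le> (2 * K) ^ 3 * (1 / sqrt p ^ 3)"
    using 3 p unfolding eisen_term_def w_def[symmetric]
    by (simp add: norm_divide field_simps)
  then show ?thesis by (simp add: p_def real_sqrt_mult power_mult_distrib)
qed

lemma eisen_term_summable:
  assumes "Im z > 0"
  shows "(\<lambda>(c,d). eisen_term z c d) summable_on (- {0}) \<times> UNIV"
proof (rule abs_summable_summable)
  define K where "K = 1 + (norm z + 1) / Im z"
  define g :: "int \<Rightarrow> real" where "g c = 1 / sqrt (1 + \<bar>of_int c\<bar>) ^ 3" for c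
  have g: "g summable_on X" for X
    using summable_on_subset[OF summable_on_int_abs[OF summable_three_halves], of X]
    by (simp add: g_def[abs_def])
  have "(\<lambda>(c,d). g c * g d) summable_on (- {0}) \<times> UNIV"
  proof (rule summable_on_SigmaI)
    show "((\<lambda>d. case (c, d) of (c, d) \<Rightarrow> g c * g d) has_sum (g c * infsum g UNIV)) UNIV" for c
      using has_sum_cmult_right[OF has_sum_infsum[OF g]] by simp
    show "(\<lambda>c. g c * infsum g UNIV) summable_on - {0}"
      by (rule summable_on_cmult_left[OF g])
  qed (simp add: g_def)
  then have "(\<lambda>(c,d). (2 * K) ^ 3 * (g c * g d)) summable_on (- {0}) \<times> UNIV"
    using summable_on_cmult_right[of "\<lambda>(c,d). g c * g d" _ "(2 * K) ^ 3"]
    by (simp add: case_prod_unfold)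
  then show "(\<lambda>x. norm (case x of (c,d) \<Rightarrow> eisen_term z c d)) summable_on (- {0}) \<times> UNIV"
  proof (rule summable_on_comparison_test)
    fix x :: "int \<times> int" assume "x \<in> (- {0}) \<times> UNIV"
    then show "norm (case x of (c,d) \<Rightarrow> eisen_term z c d) \<le>
        (case x of (c,d) \<Rightarrow> (2 * K) ^ 3 * (g c * g d))"
      using norm_eisen_term[OF assms] by (auto simp: g_def K_def simp del: times_divide_eq_right)
  qed auto
qed

lemma partial_fraction:
  fixes w :: complex
  assumes "w \<noteq> 0" "w + 1 \<noteq> 0"
  shows "1 / (w^2 * (w + 1)) = 1 / w^2 - (1 / w - 1 / (w + 1))"
  using assms by (simp add: divide_simps power2_eq_square)

lemma linear_form_nonzero:
  assumes "Im z > 0" "c \<noteq> 0"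
  shows "of_int c * z + of_int d \<noteq> 0" "of_int c * z + of_int d + 1 \<noteq> 0"
  using assms by (auto simp: complex_eq_iff)

lemma eisen_term_eq:
  assumes "Im z > 0" "c \<noteq> 0"
  shows "eisen_term z c d = 1 / (of_int c * z + of_int d)^2
     - (1 / (of_int c * z + of_int d) - 1 / (of_int c * z + of_int (d + 1)))"
  unfolding eisen_term_def
  using partial_fraction[OF linear_form_nonzero[OF assms]] by (simp add: add_ac)

lemma tendsto_inverse_shift': "(\<lambda>n. 1 / (w - of_nat n :: complex)) \<longlonglongrightarrow> 0"
proof -
  have "1 / (w - of_nat n) = - (1 / (- w + of_nat n))" for n
    by (simp add: minus_divide_right)
  with tendsto_minus[OF tendsto_inverse_shift[of "-w"]] show ?thesis by simp
qed

lemma eisen_row: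
  assumes z: "Im z > 0" and c: "c \<noteq> 0"
  shows "((\<lambda>d. eisen_term z c d) has_sum csc2 (of_int c * z)) UNIV"
proof -
  define w where "w = of_int c * z"
  have w: "Im w \<noteq> 0" using assms by (simp add: w_def)
  have "(\<lambda>d. eisen_term z c d) summable_on UNIV"
    using summable_on_SigmaD1[OF eisen_term_summable[OF z]] c by auto
  then obtain R where R: "((\<lambda>d. eisen_term z c d) has_sum R) UNIV"
    by (auto simp: summable_on_def)
  \<comment> \<open>\<open>u n - u (Suc n)\<close> collects the telescoping parts of the terms with
    indices n and -(n + 1). As \<open>u 0 = 0\<close> and u tends to 0, they contribute nothing to
    the row.\<close>
  define u where "u n = 1 / (w + of_nat n) - 1 / (w - of_nat n)" for n
  have "u \<longlonglongrightarrow> 0 - 0" unfolding u_def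
    by (intro tendsto_diff tendsto_inverse_shift tendsto_inverse_shift')
  from sums_diff[OF csc2_sums[OF w] telescope_sums'[OF this]]
  have "(\<lambda>n. 1 / (w + of_nat n)^2 + 1 / (w - of_nat (Suc n))^2 - (u n - u (Suc n))) sums csc2 w"
    by (simp add: u_def)
  moreover have "1 / (w + of_nat n)^2 + 1 / (w - of_nat (Suc n))^2 - (u n - u (Suc n)) =
      eisen_term z c (int n) + eisen_term z c (- int (Suc n))" for n
    by (simp add: eisen_term_eq[OF assms] u_def w_def algebra_simps)
  ultimately have "(\<lambda>n. eisen_term z c (int n) + eisen_term z c (- int (Suc n))) sums csc2 w" by simp
  with has_sum_int_intervals[OF R] have "R = csc2 w" by (rule sums_unique2)
  with R show ?thesis by (simp add: w_def)
qed

text \<open>Closed forms of the sums over c \<noteq> 0 of 1/(cz + d) and, in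
  \<open>square_sum\<close>, of 1/(cz + d)^2, taken in pairs c, -c. At d = 0 the first cancels in
  pairs and the second is 2 zeta(2) / z^2.\<close>

definition cot_sum :: "complex \<Rightarrow> int \<Rightarrow> complex" where
  "cot_sum z d = (if d = 0 then 0
     else of_real pi * cot (of_real pi * (of_int d / z)) / z - 1 / of_int d)"

definition square_sum :: "complex \<Rightarrow> int \<Rightarrow> complex" where
  "square_sum z d = (if d = 0 then of_real pi ^ 2 / (3 * z^2)
     else csc2 (of_int d / z) / z^2 - 1 / of_int d ^ 2)"

lemma Im_int_divide_nonzero: "Im z > 0 \<Longrightarrow> d \<noteq> 0 \<Longrightarrow> Im (of_int d / z) \<noteq> 0"
  by (auto simp: Im_divide complex_eq_iff sum_power2_eq_zero_iff)

lemma cot_sum_sums: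
  assumes z: "Im z > 0"
  shows "(\<lambda>n. 1 / (of_nat (Suc n) * z + of_int d) + 1 / (- of_nat (Suc n) * z + of_int d))
            sums cot_sum z d"
proof (cases "d = 0")
  case True
  then show ?thesis by (simp add: cot_sum_def del: of_nat_Suc)
next
  case False
  have [simp]: "z \<noteq> 0" using z by auto
  have "1 / (of_int d / z + of_nat (Suc n)) + 1 / (of_int d / z - of_nat (Suc n)) =
     z * (1 / (of_nat (Suc n) * z + of_int d) + 1 / (- of_nat (Suc n) * z + of_int d))" for n
  proof -
    have "of_int d / z + of_nat (Suc n) = (of_nat (Suc n) * z + of_int d) / z"
      "of_int d / z - of_nat (Suc n) = (- of_nat (Suc n) * z + of_int d) / z"
      by (simp_all add: field_simps)
    then show ?thesis by (simp add: distrib_left del: of_nat_Suc)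
  qed
  with cot_sums[OF Im_int_divide_nonzero[OF z False]]
  have "(\<lambda>n. z * (1 / (of_nat (Suc n) * z + of_int d) + 1 / (- of_nat (Suc n) * z + of_int d)))
    sums (of_real pi * cot (of_real pi * (of_int d / z)) - 1 / (of_int d / z))"
    by (simp del: of_nat_Suc)
  from sums_divide[OF this, of z] show ?thesis
    using False by (simp add: cot_sum_def diff_divide_distrib del: of_nat_Suc)
qed

lemma square_sum_sums:
  assumes z: "Im z > 0"
  shows "(\<lambda>n. 1 / (of_nat (Suc n) * z + of_int d)^2 + 1 / (- of_nat (Suc n) * z + of_int d)^2)
            sums square_sum z d"
proof (cases "d = 0")
  case True
  have "(\<lambda>n. of_real (1 / real (Suc n)^2) :: complex) sums of_real (pi^2 / 6)"
    using inverse_squares_sums by (intro sums_of_real) simp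
  from sums_divide[OF sums_mult[OF this, of 2], of "z^2"] show ?thesis
    using True by (simp add: square_sum_def power_mult_distrib mult.commute del: of_nat_Suc)
next
  case False
  have [simp]: "z \<noteq> 0" using z by auto
  have "1 / (of_int d / z + of_nat (Suc n))^2 + 1 / (of_int d / z - of_nat (Suc n))^2 =
     z^2 * (1 / (of_nat (Suc n) * z + of_int d)^2 + 1 / (- of_nat (Suc n) * z + of_int d)^2)" for n
  proof -
    have "of_int d / z + of_nat (Suc n) = (of_nat (Suc n) * z + of_int d) / z"
      "of_int d / z - of_nat (Suc n) = (- of_nat (Suc n) * z + of_int d) / z"
      by (simp_all add: field_simps)
    then show ?thesis by (simp add: distrib_left power_divide del: of_nat_Suc)
  qed
  with csc2_sums'[OF Im_int_divide_nonzero[OF z False]]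
  have "(\<lambda>n. z^2 * (1 / (of_nat (Suc n) * z + of_int d)^2 + 1 / (- of_nat (Suc n) * z + of_int d)^2))
    sums (csc2 (of_int d / z) - 1 / (of_int d / z)^2)"
    by (simp del: of_nat_Suc)
  from sums_divide[OF this, of "z^2"] show ?thesis
    using False by (simp add: square_sum_def diff_divide_distrib power_divide del: of_nat_Suc)
qed

lemma eisen_column:
  assumes z: "Im z > 0"
  shows "((\<lambda>c. eisen_term z c d) has_sum (square_sum z d - (cot_sum z d - cot_sum z (d + 1)))) (- {0})"
proof -
  have "(\<lambda>(d,c). eisen_term z c d) summable_on UNIV \<times> (- {0})"
    using summable_on_swap[of "\<lambda>(c,d). eisen_term z c d" "- {0}" UNIV] eisen_term_summable[OF z]
    by simp
  from summable_on_SigmaD1[OF this, of d]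
  obtain R where R: "((\<lambda>c. eisen_term z c d) has_sum R) (- {0})"
    by (auto simp: summable_on_def)
  define f g where "f d n = 1 / (of_nat (Suc n) * z + of_int d)^2 + 1 / (- of_nat (Suc n) * z + of_int d)^2"
    and "g d n = 1 / (of_nat (Suc n) * z + of_int d) + 1 / (- of_nat (Suc n) * z + of_int d)" for d :: int and n
  have "(\<lambda>n. f d n - (g d n - g (d + 1) n)) sums (square_sum z d - (cot_sum z d - cot_sum z (d + 1)))"
    unfolding f_def g_def by (intro sums_diff cot_sum_sums square_sum_sums z)
  moreover have "f d n - (g d n - g (d + 1) n) =
      eisen_term z (int (Suc n)) d + eisen_term z (- int (Suc n)) d" for n
    using z by (simp add: eisen_term_eq f_def g_def del: of_nat_Suc of_int_add)
  ultimately have "(\<lambda>n. eisen_term z (int (Suc n)) d + eisen_term z (- int (Suc n)) d)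
     sums (square_sum z d - (cot_sum z d - cot_sum z (d + 1)))" by simp
  with has_sum_int_symmetric[OF R] have "R = square_sum z d - (cot_sum z d - cot_sum z (d + 1))"
    by (rule sums_unique2)
  with R show ?thesis by simp
qed

lemma cot_lower_half:
  assumes "Im x < 0"
  shows "cot x = \<i> * (1 + exp (- 2 * \<i> * x)) / (1 - exp (- 2 * \<i> * x))"
proof -
  define e where "e = exp (\<i> * x)"
  have [simp]: "e \<noteq> 0" by (simp add: e_def)
  have e: "exp (- 2 * \<i> * x) = 1 / e^2"
    by (simp add: e_def power2_eq_square exp_add[symmetric] exp_minus[symmetric] inverse_eq_divide[symmetric] mult.assoc)
  have "norm (exp (- 2 * \<i> * x)) < 1" using assms by (simp add: norm_exp_eq_Re)
  then have "e^2 \<noteq> 1" using e by (metis div_by_1 less_irrefl norm_one)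
  have "cot x = ((e + 1 / e) / 2) / ((e - 1 / e) / (2 * \<i>))"
    by (simp add: cot_def sin_exp_eq cos_exp_eq e_def[symmetric] exp_minus inverse_eq_divide)
  moreover have "(a / 2) / (b / (2 * \<i>)) = \<i> * a / b" for a b :: complex
    by (cases "b = 0") (simp_all add: field_simps)
  ultimately have "cot x = \<i> * (e + 1 / e) / (e - 1 / e)" by (simp only:)
  also have "\<dots> = \<i> * ((e + 1 / e) / e) / ((e - 1 / e) / e)" by simp
  also have "(e + 1 / e) / e = 1 + 1 / e^2" by (simp add: power2_eq_square field_simps)
  also have "(e - 1 / e) / e = 1 - 1 / e^2" by (simp add: power2_eq_square field_simps)
  finally show ?thesis by (simp only: e)
qed

text \<open>For d > 0 the point pi d / z runs to infinity in the lower half plane, where the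
  cotangent tends to i. This nonzero limit is what the telescoping along the columns leaves
  behind.\<close>

lemma cot_sum_tendsto:
  assumes z: "Im z > 0"
  shows "(\<lambda>n. cot_sum z (int n)) \<longlonglongrightarrow> of_real pi * \<i> / z"
proof -
  define Q where "Q = exp (- 2 * \<i> * (of_real pi / z))"
  have z0: "z \<noteq> 0" using z by auto
  have Im: "Im (1 / z) < 0" using z z0
    by (simp add: Im_divide divide_neg_pos sum_power2_gt_zero_iff complex_eq_iff)
  have "norm Q = exp (2 * pi * Im (1 / z))"
    by (simp add: Q_def norm_exp_eq_Re Im_divide Re_divide)
  then have Q: "norm Q < 1" using Im by (simp add: mult_pos_neg)
  have "(\<lambda>n. of_real pi * (\<i> * (1 + Q ^ n) / (1 - Q ^ n)) / z - 1 / (0 + of_nat n))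
     \<longlonglongrightarrow> of_real pi * (\<i> * (1 + 0) / (1 - 0)) / z - 0"
    by (intro tendsto_intros LIMSEQ_power_zero Q tendsto_inverse_shift) (auto simp: z0)
  then have "(\<lambda>n. of_real pi * (\<i> * (1 + Q ^ n) / (1 - Q ^ n)) / z - 1 / of_nat n)
     \<longlonglongrightarrow> of_real pi * \<i> / z" by simp
  moreover have "eventually (\<lambda>n. of_real pi * (\<i> * (1 + Q ^ n) / (1 - Q ^ n)) / z - 1 / of_nat n =
     cot_sum z (int n)) sequentially"
    using eventually_gt_at_top[of 0]
  proof eventually_elim
    case (elim n)
    have "Im (of_real pi * (of_nat n / z)) < 0"
    proof -
      have "of_real pi * (of_nat n / z) = of_real (pi * real n) * (1 / z)" by simp
      then have "Im (of_real pi * (of_nat n / z)) = pi * real n * Im (1 / z)"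
        by (simp only: Im_complex_of_real Re_complex_of_real times_complex.sel)
      then show ?thesis using Im elim by (simp only: mult_pos_neg mult_pos_pos pi_gt_zero of_nat_0_less_iff)
    qed
    from cot_lower_half[OF this]
    have "cot (of_real pi * (of_nat n / z)) = \<i> * (1 + Q ^ n) / (1 - Q ^ n)"
      by (simp add: Q_def exp_of_nat_mult[symmetric] mult_ac)
    then show ?case using elim by (simp add: cot_sum_def)
  qed
  ultimately show ?thesis by (rule Lim_transform_eventually)
qed

lemma cot_sum_minus: "cot_sum z (- d) = - cot_sum z d"
  by (simp add: cot_sum_def)

lemma square_sum_minus: "square_sum z (- d) = square_sum z d"
  by (simp add: square_sum_def csc2_minus)

lemma Im_neg_inverse: "Im z > 0 \<Longrightarrow> Im (- 1 / z) > 0"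
  by (auto simp: Im_divide sum_power2_gt_zero_iff complex_eq_iff)

text \<open>As \<open>csc2\<close> is even, its value at d / z is that at d (-1 / z), a multiple of
  a point of the upper half plane; this brings in the series at -1 / z.\<close>

lemma square_sum_Suc_sums:
  assumes z: "Im z > 0"
  shows "(\<lambda>n. square_sum z (int (Suc n))) sums
     (- 4 * of_real pi ^ 2 * sigma_series (- 1 / z) / z^2 - of_real pi ^ 2 / 6)"
proof -
  have "(\<lambda>n. of_real (1 / real (Suc n)^2) :: complex) sums of_real (pi^2 / 6)"
    using inverse_squares_sums by (intro sums_of_real) simp
  then have 1: "(\<lambda>n. 1 / of_int (int (Suc n)) ^ 2 :: complex) sums (of_real pi ^ 2 / 6)"
    by (simp del: of_nat_Suc)
  have "csc2 (of_int (int (Suc n)) / z) = csc2 (of_nat (Suc n) * (- 1 / z))" for n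
    using csc2_minus[of "of_nat (Suc n) / z"] by simp
  with csc2_sums_sigma_series[OF Im_neg_inverse[OF z]]
  have 2: "(\<lambda>n. csc2 (of_int (int (Suc n)) / z)) sums (- 4 * of_real pi ^ 2 * sigma_series (- 1 / z))"
    by (simp del: of_nat_Suc)
  from sums_diff[OF sums_divide[OF 2, of "z^2"] 1] show ?thesis
    by (simp add: square_sum_def del: of_nat_Suc)
qed

definition E2 :: "complex \<Rightarrow> complex" where
  "E2 z = 1 - 24 * sigma_series z"

text \<open>One absolutely convergent double series is evaluated twice. By rows it is a multiple of
  \<open>sigma_series z\<close>; by columns it involves \<open>sigma_series (- 1 / z)\<close>,
  values of zeta(2) and the limit of \<open>cot_sum\<close>.\<close>

theorem E2_inversion:
  assumes z: "Im z > 0"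
  shows "E2 (- 1 / z) = z^2 * E2 z - 6 * \<i> * z / of_real pi"
proof -
  have z0: "z \<noteq> 0" using z by auto
  obtain T where T: "((\<lambda>(c,d). eisen_term z c d) has_sum T) ((- {0}) \<times> UNIV)"
    using eisen_term_summable[OF z] by (auto simp: summable_on_def)
  have "((\<lambda>c. csc2 (of_int c * z)) has_sum T) (- {0})"
    by (rule has_sum_SigmaD[OF T]) (use eisen_row[OF z] in auto)
  from has_sum_int_symmetric[OF this]
  have "(\<lambda>n. csc2 (of_int (int (Suc n)) * z) + csc2 (of_int (- int (Suc n)) * z)) sums T" .
  moreover have "csc2 (of_int (- int (Suc n)) * z) = csc2 (of_nat (Suc n) * z)" for n
    using csc2_minus[of "of_nat (Suc n) * z"] by (simp del: of_nat_Suc)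
  ultimately have "(\<lambda>n. csc2 (of_nat (Suc n) * z) + csc2 (of_nat (Suc n) * z)) sums T"
    by (simp del: of_nat_Suc)
  with sums_add[OF csc2_sums_sigma_series[OF z] csc2_sums_sigma_series[OF z]]
  have T1: "T = - 8 * of_real pi ^ 2 * sigma_series z"
    by (auto dest: sums_unique2)
  \<comment> \<open>The sum of \<open>square_sum z d\<close> over d > 0; by symmetry it occurs
    twice.\<close>
  define X where "X = - 4 * of_real pi ^ 2 * sigma_series (- 1 / z) / z^2 - of_real pi ^ 2 / 6"
  from T have "((\<lambda>(d,c). eisen_term z c d) has_sum T) (UNIV \<times> (- {0}))"
    by (subst (asm) has_sum_swap) simp
  then have "((\<lambda>d. square_sum z d - (cot_sum z d - cot_sum z (d + 1))) has_sum T) UNIV"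
    by (rule has_sum_SigmaD) (use eisen_column[OF z] in auto)
  from has_sum_int_intervals[OF this]
  \<comment> \<open>Since \<open>cot_sum\<close> is odd in d, the differences at n and at -(n + 1)
    are equal; this is the factor 2.\<close>
  have "(\<lambda>n. square_sum z (int n) + square_sum z (int (Suc n)) +
          2 * (cot_sum z (int (Suc n)) - cot_sum z (int n))) sums T"
    unfolding cot_sum_minus square_sum_minus
    using cot_sum_minus[of z] by (simp add: algebra_simps)
  moreover have X0: "(\<lambda>n. square_sum z (int n)) sums (X + square_sum z (int 0))"
    using square_sum_Suc_sums[OF z] unfolding X_def[symmetric]
    by (subst (asm) sums_Suc_iff)
  have "(\<lambda>n. square_sum z (int n) + square_sum z (int (Suc n)) +
          2 * (cot_sum z (int (Suc n)) - cot_sum z (int n)))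
       sums ((X + square_sum z (int 0)) + X + 2 * (of_real pi * \<i> / z - cot_sum z (int 0)))"
    using X0 square_sum_Suc_sums[OF z] unfolding X_def[symmetric]
    by (intro sums_add sums_mult telescope_sums cot_sum_tendsto[OF z])
  ultimately have "T = (X + square_sum z (int 0)) + X + 2 * (of_real pi * \<i> / z - cot_sum z (int 0))"
    by (rule sums_unique2)
  then have "- 8 * of_real pi ^ 2 * sigma_series z = 2 * X + of_real pi ^ 2 / (3 * z^2) + 2 * of_real pi * \<i> / z"
    by (simp add: T1 square_sum_def cot_sum_def)
  then have "3 * z^2 * (- 8 * of_real pi ^ 2 * sigma_series z) =
     3 * z^2 * (2 * X + of_real pi ^ 2 / (3 * z^2) + 2 * of_real pi * \<i> / z)" by simp
  also have "\<dots> = of_real pi ^ 2 * (E2 (- 1 / z) - z^2 + 6 * \<i> * z / of_real pi)"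
    using z0 by (simp add: X_def E2_def field_simps power2_eq_square)
  finally have "of_real pi ^ 2 * (- 24 * z^2 * sigma_series z) =
     of_real pi ^ 2 * (E2 (- 1 / z) - z^2 + 6 * \<i> * z / of_real pi)"
    by (simp add: algebra_simps)
  then have "- 24 * z^2 * sigma_series z = E2 (- 1 / z) - z^2 + 6 * \<i> * z / of_real pi"
    by (subst (asm) mult_cancel_left) auto
  then show ?thesis by (simp add: E2_def algebra_simps)
qed

section \<open>Forms for Gamma0(5)\<close>

lemma upper_half_iff [simp]: "z \<in> upper_half \<longleftrightarrow> Im z > 0"
  by (simp add: upper_half_def)

lemma open_upper_half: "open upper_half"
  unfolding upper_half_def by (rule open_halfspace_Im_gt)

lemma connected_upper_half: "connected upper_half"
  unfolding upper_half_def by (intro convex_connected convex_halfspace_Im_gt)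

lemma Im_moebius:
  assumes "a * d - b * c = (N::int)"
  shows "Im ((of_int a * z + of_int b) / (of_int c * z + of_int d)) =
    of_int N * Im z / norm (of_int c * z + of_int d) ^ 2"
proof -
  have "Im ((of_int a * z + of_int b) / (of_int c * z + of_int d)) =
     (of_int a * of_int d - of_int b * of_int c) * Im z / norm (of_int c * z + of_int d) ^ 2"
    by (simp add: Im_divide cmod_power2 algebra_simps)
  also have "of_int a * of_int d - of_int b * of_int c = (of_int N :: real)"
    using assms by (metis of_int_diff of_int_mult)
  finally show ?thesis .
qed

lemma moebius_denominator_nonzero:
  assumes "a * d - b * c = (N::int)" "N > 0" "Im z > 0"
  shows "of_int c * z + of_int d \<noteq> 0"
proof
  assume "of_int c * z + of_int d = 0"
  then have "c = 0" "d = 0" using assms(3) by (auto simp: complex_eq_iff)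
  with assms show False by simp
qed

lemma Im_moebius_pos:
  assumes "a * d - b * c = (N::int)" "N > 0" "Im z > 0"
  shows "Im ((of_int a * z + of_int b) / (of_int c * z + of_int d)) > 0"
  using moebius_denominator_nonzero[OF assms] assms(2,3)
  by (simp add: Im_moebius[OF assms(1)])

text \<open>The transformation law and the growth condition are separated from holomorphy so that
  they can be established for combinations of the non-holomorphic \<open>E2_star\<close>.\<close>

definition gamma0_invariant :: "nat \<Rightarrow> (complex \<Rightarrow> complex) \<Rightarrow> bool" where
  "gamma0_invariant k f \<longleftrightarrow> (\<forall>a b c d :: int. a*d - b*c = 1 \<and> 5 dvd c \<longrightarrow>
        (\<forall>z\<in>upper_half. f ((of_int a * z + of_int b) / (of_int c * z + of_int d))
                          = (of_int c * z + of_int d) ^ k * f z))"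

definition bounded_at_cusps :: "nat \<Rightarrow> (complex \<Rightarrow> complex) \<Rightarrow> bool" where
  "bounded_at_cusps k f \<longleftrightarrow> (\<forall>a b c d :: int. a*d - b*c = 1 \<longrightarrow>
        (\<exists>B. \<forall>z. Im z \<ge> 1 \<longrightarrow>
           norm (f ((of_int a * z + of_int b) / (of_int c * z + of_int d)))
             \<le> B * norm (of_int c * z + of_int d) ^ k))"

lemma modform_G05_iff: "modform_G05 k f \<longleftrightarrow> f holomorphic_on upper_half \<and> gamma0_invariant k f \<and> bounded_at_cusps k f"
  by (simp add: modform_G05_def gamma0_invariant_def bounded_at_cusps_def)

lemma gamma0_invariantD:
  assumes "gamma0_invariant k f" "a*d - b*c = 1" "5 dvd c" "Im z > 0"
  shows "f ((of_int a * z + of_int b) / (of_int c * z + of_int d)) = (of_int c * z + of_int d) ^ k * f z"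
  using assms by (auto simp: gamma0_invariant_def)

lemma gamma0_invariant_cong:
  assumes "gamma0_invariant k f" "\<And>z. Im z > 0 \<Longrightarrow> f z = g z"
  shows "gamma0_invariant k g"
  unfolding gamma0_invariant_def
proof safe
  fix a b c d :: int and z assume 1: "a*d - b*c = 1" "5 dvd c" "z \<in> upper_half"
  then show "g ((of_int a * z + of_int b) / (of_int c * z + of_int d)) = (of_int c * z + of_int d) ^ k * g z"
    using gamma0_invariantD[OF assms(1) 1(1,2), of z] assms(2) Im_moebius_pos[OF 1(1), of z] by auto
qed

lemma bounded_at_cusps_cong:
  assumes "bounded_at_cusps k f" "\<And>z. Im z > 0 \<Longrightarrow> f z = g z"
  shows "bounded_at_cusps k g"
  unfolding bounded_at_cusps_def
proof safe
  fix a b c d :: int assume 1: "a*d - b*c = 1"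
  then obtain B where B: "\<And>z. Im z \<ge> 1 \<Longrightarrow>
      norm (f ((of_int a * z + of_int b) / (of_int c * z + of_int d))) \<le> B * norm (of_int c * z + of_int d) ^ k"
    using assms(1) unfolding bounded_at_cusps_def by blast
  show "\<exists>B. \<forall>z. Im z \<ge> 1 \<longrightarrow>
      norm (g ((of_int a * z + of_int b) / (of_int c * z + of_int d))) \<le> B * norm (of_int c * z + of_int d) ^ k"
  proof (intro exI allI impI)
    fix z :: complex assume z: "Im z \<ge> 1"
    then have "Im ((of_int a * z + of_int b) / (of_int c * z + of_int d)) > 0"
      by (intro Im_moebius_pos[OF 1]) auto
    then show "norm (g ((of_int a * z + of_int b) / (of_int c * z + of_int d))) \<le> B * norm (of_int c * z + of_int d) ^ k"
      using B[OF z] assms(2) by auto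
  qed
qed

lemma modform_G05_cong:
  assumes "modform_G05 k f" "\<And>z. Im z > 0 \<Longrightarrow> f z = g z"
  shows "modform_G05 k g"
  using assms gamma0_invariant_cong[of k f g] bounded_at_cusps_cong[of k f g] holomorphic_transform[of f upper_half g]
  by (auto simp: modform_G05_iff)

lemma gamma0_invariant_lincomb:
  assumes "gamma0_invariant k f" "gamma0_invariant k g"
  shows "gamma0_invariant k (\<lambda>z. x * f z + y * g z)"
  unfolding gamma0_invariant_def using gamma0_invariantD[OF assms(1)] gamma0_invariantD[OF assms(2)]
  by (auto simp: algebra_simps)

lemma bounded_at_cusps_lincomb:
  assumes "bounded_at_cusps k f" "bounded_at_cusps k g"
  shows "bounded_at_cusps k (\<lambda>z. x * f z + y * g z)"
  unfolding bounded_at_cusps_def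
proof (intro allI impI)
  fix a b c d :: int assume 1: "a*d - b*c = 1"
  define w n where "w z = (of_int a * z + of_int b) / (of_int c * z + of_int d)"
    and "n z = norm (of_int c * z + of_int d) ^ k" for z :: complex
  obtain B1 where B1: "\<And>z. Im z \<ge> 1 \<Longrightarrow> norm (f (w z)) \<le> B1 * n z"
    using assms(1) 1 unfolding bounded_at_cusps_def w_def n_def by blast
  obtain B2 where B2: "\<And>z. Im z \<ge> 1 \<Longrightarrow> norm (g (w z)) \<le> B2 * n z"
    using assms(2) 1 unfolding bounded_at_cusps_def w_def n_def by blast
  have "norm (x * f (w z) + y * g (w z)) \<le> (norm x * B1 + norm y * B2) * n z" if "Im z \<ge> 1" for z
  proof -
    have "norm (x * f (w z) + y * g (w z)) \<le> norm x * norm (f (w z)) + norm y * norm (g (w z))"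
      by (metis norm_mult norm_triangle_ineq)
    also have "\<dots> \<le> norm x * (B1 * n z) + norm y * (B2 * n z)"
      using B1[OF that] B2[OF that] by (intro add_mono mult_left_mono) auto
    finally show ?thesis by (simp add: algebra_simps)
  qed
  then show "\<exists>B. \<forall>z. 1 \<le> Im z \<longrightarrow>
     norm (x * f ((of_int a * z + of_int b) / (of_int c * z + of_int d)) +
           y * g ((of_int a * z + of_int b) / (of_int c * z + of_int d)))
       \<le> B * norm (of_int c * z + of_int d) ^ k"
    unfolding w_def n_def by blast
qed

lemma modform_G05_lincomb:
  assumes "modform_G05 k f" "modform_G05 k g"
  shows "modform_G05 k (\<lambda>z. x * f z + y * g z)"
  using assms gamma0_invariant_lincomb bounded_at_cusps_lincomb
  by (auto simp: modform_G05_iff intro!: holomorphic_intros)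

lemma modform_G05_mult:
  assumes "modform_G05 k f" "modform_G05 l g"
  shows "modform_G05 (k + l) (\<lambda>z. f z * g z)"
  unfolding modform_G05_iff
proof (intro conjI)
  show "(\<lambda>z. f z * g z) holomorphic_on upper_half"
    using assms by (auto simp: modform_G05_iff intro!: holomorphic_intros)
  have "gamma0_invariant k f" "gamma0_invariant l g" using assms by (auto simp: modform_G05_iff)
  then show "gamma0_invariant (k + l) (\<lambda>z. f z * g z)"
    unfolding gamma0_invariant_def by (auto simp: power_add)
  show "bounded_at_cusps (k + l) (\<lambda>z. f z * g z)"
    unfolding bounded_at_cusps_def
  proof (intro allI impI)
    fix a b c d :: int assume 1: "a*d - b*c = 1"
    define w n where "w z = (of_int a * z + of_int b) / (of_int c * z + of_int d)"
      and "n z = norm (of_int c * z + of_int d)" for z :: complex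
    obtain B1 where B1: "\<And>z. Im z \<ge> 1 \<Longrightarrow> norm (f (w z)) \<le> B1 * n z ^ k"
      using assms(1) 1 unfolding modform_G05_iff bounded_at_cusps_def w_def n_def by blast
    obtain B2 where B2: "\<And>z. Im z \<ge> 1 \<Longrightarrow> norm (g (w z)) \<le> B2 * n z ^ l"
      using assms(2) 1 unfolding modform_G05_iff bounded_at_cusps_def w_def n_def by blast
    have "norm (f (w z) * g (w z)) \<le> (B1 * B2) * n z ^ (k + l)" if "Im z \<ge> 1" for z
    proof -
      have "norm (f (w z) * g (w z)) \<le> (B1 * n z ^ k) * (B2 * n z ^ l)"
        unfolding norm_mult using B1[OF that] B2[OF that]
        by (intro mult_mono) (auto intro: order_trans[OF norm_ge_zero])
      then show ?thesis by (simp add: power_add mult_ac)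
    qed
    then show "\<exists>B. \<forall>z. 1 \<le> Im z \<longrightarrow>
       norm (f ((of_int a * z + of_int b) / (of_int c * z + of_int d)) *
             g ((of_int a * z + of_int b) / (of_int c * z + of_int d)))
         \<le> B * norm (of_int c * z + of_int d) ^ (k + l)"
      unfolding w_def n_def by blast
  qed
qed

section \<open>Level one functions and integer matrices\<close>

lemma integer_matrix_decompose:
  fixes p q r s N :: int
  assumes "p * s - q * r = N" "N > 0"
  obtains a b c d A B D where "a * d - b * c = 1" "p = a * A" "r = c * A"
    "q = a * B + b * D" "s = c * B + d * D" "A > 0" "D > 0" "A * D = N"
proof -
  define A where "A = gcd p r"
  have "p \<noteq> 0 \<or> r \<noteq> 0" using assms by auto
  then have A: "A > 0" by (simp add: A_def)
  obtain x y where xy: "x * p + y * r = A" unfolding A_def using bezout_int by blast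
  obtain a c where ac: "p = a * A" "r = c * A"
    unfolding A_def by (metis dvd_def gcd_dvd1 gcd_dvd2 mult.commute)
  have "A * (x * a + y * c) = A * 1" using xy ac by (simp add: algebra_simps)
  \<comment> \<open>Bezout completes (a, c), the first column divided by its gcd, to a matrix of
    SL2(Z) with second column (-y, x). Multiplication by its inverse makes the given matrix upper
    triangular.\<close>
  then have 1: "a * x - (- y) * c = 1" using A by (simp add: mult.commute)
  define B D where "B = x * q + y * s" and "D = a * s - c * q"
  have q: "q = (a * x - (- y) * c) * q" and s: "s = (a * x - (- y) * c) * s"
    using 1 by simp_all
  have "A * D = N" using assms ac by (simp add: D_def algebra_simps)
  moreover from this have "D > 0" using A assms(2) zero_less_mult_pos by metis
  moreover have "q = a * B + (- y) * D"
    by (subst q) (simp add: B_def D_def algebra_simps)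
  moreover have "s = c * B + x * D"
    by (subst s) (simp add: B_def D_def algebra_simps)
  ultimately show thesis using that[of a x "-y" c A B D] 1 ac A by auto
qed

text \<open>The law is asked for the generators of SL2(Z) and extended to the group by
  \<open>level1_SL2\<close>. An even weight makes the automorphy factor independent of the sign of
  the matrix.\<close>

definition level1 :: "nat \<Rightarrow> (complex \<Rightarrow> complex) \<Rightarrow> bool" where
  "level1 k f \<longleftrightarrow> even k \<and> (\<forall>z. Im z > 0 \<longrightarrow> f (z + 1) = f z \<and> f (- 1 / z) = z ^ k * f z)"

definition bounded_near_infinity :: "(complex \<Rightarrow> complex) \<Rightarrow> bool" where
  "bounded_near_infinity f \<longleftrightarrow> (\<forall>e>0. \<exists>B. \<forall>z. Im z \<ge> e \<longrightarrow> norm (f z) \<le> B)"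

lemma periodic_of_nat:
  assumes "\<And>z. Im z > 0 \<Longrightarrow> f (z + p) = f z" "Im p = 0" "Im z > 0"
  shows "f (z + of_nat n * p) = f z"
proof (induction n)
  case (Suc n)
  have "f (z + of_nat (Suc n) * p) = f ((z + of_nat n * p) + p)" by (simp add: algebra_simps)
  also have "\<dots> = f (z + of_nat n * p)" using assms by (intro assms(1)) simp
  finally show ?case using Suc by simp
qed auto

lemma periodic_of_int:
  assumes "\<And>z. Im z > 0 \<Longrightarrow> f (z + p) = f z" "Im p = 0" "Im z > 0"
  shows "f (z + of_int n * p) = f z"
proof (cases "n \<ge> 0")
  case True
  then show ?thesis using periodic_of_nat[where f = f, OF assms, of "nat n"] by simp
next
  case False
  have "f (z + of_int n * p) = f ((z + of_int n * p) + of_nat (nat (- n)) * p)"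
    using assms by (intro periodic_of_nat[where f = f, symmetric]) auto
  also have "(z + of_int n * p) + of_nat (nat (- n)) * p = z" using False by simp
  finally show ?thesis .
qed

text \<open>Euclidean algorithm on the bottom row, by induction on |c|: for c = 0 the matrix is a
  translation up to sign.\<close>

lemma level1_SL2:
  assumes "level1 k f" "a * d - b * c = (1::int)" "Im z > 0"
  shows "f ((of_int a * z + of_int b) / (of_int c * z + of_int d)) = (of_int c * z + of_int d) ^ k * f z"
  using assms(2,3)
proof (induction "nat \<bar>c\<bar>" arbitrary: a b c d z rule: less_induct)
  case less
  have k: "even k" and T: "f (w + 1) = f w" and S: "f (- 1 / w) = w ^ k * f w" if "Im w > 0" for w
    using assms(1) that by (auto simp: level1_def)
  have k: "even k" using assms(1) by (auto simp: level1_def)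
  have Tn: "f (w + of_int n) = f w" if "Im w > 0" for w n
    using periodic_of_int[of f 1 w n] T that by auto
  show ?case
  proof (cases "c = 0")
    case True
    then have "a * d = 1" using less.prems by simp
    then have "a = 1 \<and> d = 1 \<or> a = -1 \<and> d = -1" using pos_zmult_eq_1_iff_lemma zmult_eq_1_iff by auto
    then show ?thesis
    proof
      assume "a = 1 \<and> d = 1"
      then show ?thesis using True Tn[of z b] less.prems by simp
    next
      assume "a = -1 \<and> d = -1"
      moreover have "(- z + of_int b) / (- 1) = z + of_int (- b)" by simp
      ultimately show ?thesis using True Tn[of z "- b"] less.prems k by simp
    qed
  next
    case False
    \<comment> \<open>The translation by n replaces d by its remainder modulo c, and the inversion
      makes this remainder the new lower left entry.\<close>
    define n d' b' z' w where "n = - (d div c)" and "d' = d mod c" and "b' = a * n + b"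
      and "z' = z - of_int n" and "w = - 1 / z'"
    have d': "d' = c * n + d" by (simp add: n_def d'_def minus_mult_div_eq_mod[symmetric])
    have z': "Im z' > 0" "z' \<noteq> 0" using less.prems by (auto simp: z'_def)
    have w: "Im w > 0" using Im_neg_inverse[OF z'(1)] by (simp add: w_def)
    have lt: "nat \<bar>d'\<bar> < nat \<bar>c\<bar>" using False by (simp add: d'_def abs_mod_less)
    have det: "b' * (- c) - (- a) * d' = 1"
      using less.prems(1) by (simp add: b'_def d' algebra_simps)
    have zz: "of_int a * z' + of_int b' = of_int a * z + of_int b"
      "of_int c * z' + of_int d' = of_int c * z + of_int d"
      by (simp_all add: z'_def b'_def d' algebra_simps)
    have nz: "of_int c * z + of_int d \<noteq> 0"
      using moebius_denominator_nonzero[OF less.prems(1) _ less.prems(2)] by simp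
    have w1: "of_int b' * w + of_int (- a) = - (of_int a * z + of_int b) / z'"
      "of_int d' * w + of_int (- c) = - (of_int c * z + of_int d) / z'"
      using z'(2) unfolding zz[symmetric] by (simp_all add: w_def field_simps)
    have "f ((of_int a * z + of_int b) / (of_int c * z + of_int d)) =
          f ((of_int b' * w + of_int (- a)) / (of_int d' * w + of_int (- c)))"
    proof -
      have "(- X / z') / (- Y / z') = X / Y" for X Y using z'(2) by simp
      then show ?thesis unfolding w1 by (simp only:)
    qed
    also have "\<dots> = (of_int d' * w + of_int (- c)) ^ k * f w"
      by (rule less.hyps[OF lt det w])
    also have "f w = z' ^ k * f z'" unfolding w_def by (rule S[OF z'(1)])
    also have "f z' = f z" using Tn[OF less.prems(2), of "- n"] by (simp add: z'_def)
    also have "(of_int d' * w + of_int (- c)) ^ k * (z' ^ k * f z) =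
        (of_int c * z + of_int d) ^ k * f z"
    proof -
      have "(- Y / z') ^ k * (z' ^ k * X) = Y ^ k * X" for X Y
        using z'(2) k by (simp add: power_divide)
      then show ?thesis unfolding w1 by (simp only:)
    qed
    finally show ?thesis .
  qed
qed

text \<open>Conjugation by diag(t, 1) turns (a, b; c, d) into (a, tb; c/t, d), which is integral
  since t divides 5 and 5 divides c.\<close>

lemma level1_gamma0_invariant:
  assumes "level1 k f" "t dvd 5" "t > 0"
  shows "gamma0_invariant k (\<lambda>z. f (of_nat t * z))"
  unfolding gamma0_invariant_def
proof safe
  fix a b c d :: int and z assume 1: "a*d - b*c = 1" "5 dvd c" "z \<in> upper_half"
  have "int t dvd 5" using assms(2) by (metis of_nat_dvd_iff of_nat_numeral)
  then obtain e where e: "c = int t * e" using 1 by (metis dvd_def dvd_trans)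
  have "f (of_nat t * ((of_int a * z + of_int b) / (of_int c * z + of_int d))) =
    f ((of_int a * (of_nat t * z) + of_int (int t * b)) / (of_int e * (of_nat t * z) + of_int d))"
    by (simp add: e algebra_simps)
  also have "\<dots> = (of_int e * (of_nat t * z) + of_int d) ^ k * f (of_nat t * z)"
    using 1 assms by (intro level1_SL2) (auto simp: e algebra_simps)
  finally show "f (of_nat t * ((of_int a * z + of_int b) / (of_int c * z + of_int d))) =
      (of_int c * z + of_int d) ^ k * f (of_nat t * z)"
    by (simp add: e algebra_simps)
qed

lemma decomposed_moebius:
  fixes z :: complex and a b c d p q r s A B D :: int
  assumes d: "p = a * A" "r = c * A" "q = a * B + b * D" "s = c * B + d * D" "D > 0"
  shows "(of_int p * z + of_int q) / (of_int r * z + of_int s) =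
      (of_int a * ((of_int A * z + of_int B) / of_int D) + of_int b) /
      (of_int c * ((of_int A * z + of_int B) / of_int D) + of_int d)"
    and "of_int r * z + of_int s =
      of_int D * (of_int c * ((of_int A * z + of_int B) / of_int D) + of_int d)"
proof -
  define w where "w = (of_int A * z + of_int B) / of_int D"
  have D: "(of_int D :: complex) \<noteq> 0" using d by auto
  have 1: "of_int p * z + of_int q = of_int D * (of_int a * w + of_int b)"
    and 2: "of_int r * z + of_int s = of_int D * (of_int c * w + of_int d)"
    using D by (simp_all add: d w_def field_simps)
  show "(of_int p * z + of_int q) / (of_int r * z + of_int s) =
      (of_int a * ((of_int A * z + of_int B) / of_int D) + of_int b) /
      (of_int c * ((of_int A * z + of_int B) / of_int D) + of_int d)"
    unfolding w_def[symmetric] 1 2 using D by simp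
  show "of_int r * z + of_int s =
      of_int D * (of_int c * ((of_int A * z + of_int B) / of_int D) + of_int d)"
    using 2 by (simp add: w_def)
qed

text \<open>In the decomposition of the matrix, the upper triangular factor maps Im z \<ge> 1 into
  Im w \<ge> 1/D, so the hypothesis for e = 1/D applies to the SL2(Z) factor.\<close>

lemma bounded_at_integer_matrix:
  fixes p q r s N :: int
  assumes f: "\<And>a b c d e. a * d - b * c = (1::int) \<Longrightarrow> e > 0 \<Longrightarrow>
      \<exists>B. \<forall>z. Im z \<ge> e \<longrightarrow> norm (f ((of_int a * z + of_int b) / (of_int c * z + of_int d)))
          \<le> B * norm (of_int c * z + of_int d) ^ k"
    and m: "p * s - q * r = N" "N > 0"
  shows "\<exists>B. \<forall>z. Im z \<ge> 1 \<longrightarrow> norm (f ((of_int p * z + of_int q) / (of_int r * z + of_int s)))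
          \<le> B * norm (of_int r * z + of_int s) ^ k"
proof -
  from integer_matrix_decompose[OF m] obtain a b c d A B D where
    1: "a * d - b * c = 1" and
    2: "p = a * A" "r = c * A" "q = a * B + b * D" "s = c * B + d * D" "A > 0" "D > 0" "A * D = N"
    by metis
  have "1 / of_int D > (0::real)" using 2 by simp
  from f[OF 1 this] obtain B0 where
    B0: "\<And>z. Im z \<ge> 1 / of_int D \<Longrightarrow>
      norm (f ((of_int a * z + of_int b) / (of_int c * z + of_int d))) \<le> B0 * norm (of_int c * z + of_int d) ^ k"
    by blast
  show ?thesis
  proof (intro exI allI impI)
    fix z :: complex assume z: "Im z \<ge> 1"
    define w where "w = (of_int A * z + of_int B) / of_int D"
    note dm = decomposed_moebius[OF 2(1-4,6), of z, folded w_def]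
    have "1 * 1 \<le> of_int A * Im z" using z 2 by (intro mult_mono) auto
    then have w: "Im w \<ge> 1 / of_int D"
      using 2 by (simp add: w_def divide_right_mono Im_divide power2_eq_square)
    have n: "norm (of_int r * z + of_int s) = of_int D * norm (of_int c * w + of_int d)"
      unfolding dm(2) using 2 by (simp add: norm_mult)
    have "norm (f ((of_int p * z + of_int q) / (of_int r * z + of_int s))) \<le>
       B0 * norm (of_int c * w + of_int d) ^ k"
      unfolding dm(1) by (rule B0[OF w])
    also have "\<dots> = B0 / of_int D ^ k * norm (of_int r * z + of_int s) ^ k"
      unfolding n using 2 by (simp add: power_mult_distrib)
    finally show "norm (f ((of_int p * z + of_int q) / (of_int r * z + of_int s)))
       \<le> B0 / of_int D ^ k * norm (of_int r * z + of_int s) ^ k" .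
  qed
qed

lemma level1_bounded_at_cusps:
  assumes "level1 k f" "bounded_near_infinity f" "t > 0"
  shows "bounded_at_cusps k (\<lambda>z. f (of_nat t * z))"
  unfolding bounded_at_cusps_def
proof (intro allI impI)
  fix a b c d :: int assume 1: "a * d - b * c = 1"
  have "\<exists>B. \<forall>z. Im z \<ge> 1 \<longrightarrow> norm (f ((of_int (t * a) * z + of_int (t * b)) / (of_int c * z + of_int d)))
          \<le> B * norm (of_int c * z + of_int d) ^ k"
  proof (rule bounded_at_integer_matrix)
    have "(t * a) * d - (t * b) * c = t * (a * d - b * c)" by (simp add: algebra_simps)
    then show "(t * a) * d - (t * b) * c = int t" using 1 by simp
    show "int t > 0" using assms by simp
    fix a b c d :: int and e :: real assume 2: "a * d - b * c = 1" "e > 0"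
    from assms(2) 2 obtain B where B: "\<And>z. Im z \<ge> e \<Longrightarrow> norm (f z) \<le> B"
      unfolding bounded_near_infinity_def by blast
    show "\<exists>B. \<forall>z. Im z \<ge> e \<longrightarrow> norm (f ((of_int a * z + of_int b) / (of_int c * z + of_int d)))
          \<le> B * norm (of_int c * z + of_int d) ^ k"
    proof (intro exI allI impI)
      fix z :: complex assume z: "Im z \<ge> e"
      then show "norm (f ((of_int a * z + of_int b) / (of_int c * z + of_int d)))
          \<le> B * norm (of_int c * z + of_int d) ^ k"
        using level1_SL2[OF assms(1) 2(1), of z] B[OF z] 2
        by (simp add: norm_mult norm_power mult.commute mult_right_mono)
    qed
  qed
  then show "\<exists>B. \<forall>z. 1 \<le> Im z \<longrightarrow>
     norm (f (of_nat t * ((of_int a * z + of_int b) / (of_int c * z + of_int d))))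
       \<le> B * norm (of_int c * z + of_int d) ^ k"
    by (simp add: algebra_simps)
qed

text \<open>The cusp condition bounds the slashed function only for Im z \<ge> 1. In the strip
  below, its period 5 reduces the question to a compact rectangle.\<close>

lemma modform_bounded_ge:
  assumes f: "modform_G05 k f" and m: "a * d - b * c = (1::int)" and e: "e > 0"
  shows "\<exists>B. \<forall>z. Im z \<ge> e \<longrightarrow> norm (f ((of_int a * z + of_int b) / (of_int c * z + of_int d)))
          \<le> B * norm (of_int c * z + of_int d) ^ k"
proof -
  define M where "M z = (of_int a * z + of_int b) / (of_int c * z + of_int d)" for z :: complex
  define J where "J z = of_int c * z + of_int d" for z :: complex
  define g where "g z = f (M z) / J z ^ k" for z
  have J: "J z \<noteq> 0" if "Im z > 0" for z
    using moebius_denominator_nonzero[OF m _ that] by (simp add: J_def)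
  have Mpos: "Im (M z) > 0" if "Im z > 0" for z
    using Im_moebius_pos[OF m _ that] by (simp add: M_def)
  have per: "g (z + 5) = g z" if z: "Im z > 0" for z
  proof -
    \<comment> \<open>The matrix is the conjugate of the translation by 5 under (a, b; c, d); it
      lies in Gamma0(5) for every choice of a and c.\<close>
    have tr: "f ((of_int (1 - 5*a*c) * M z + of_int (5*a*a)) / (of_int (- 5*c*c) * M z + of_int (1 + 5*a*c))) =
       (of_int (- 5*c*c) * M z + of_int (1 + 5*a*c)) ^ k * f (M z)"
      using f Mpos[OF z] by (intro gamma0_invariantD) (auto simp: modform_G05_iff algebra_simps)
    have mC: "of_int a * of_int d - of_int b * of_int c = (1::complex)"
      using m by (metis of_int_1 of_int_diff of_int_mult)
    have J1: "of_int (- 5*c*c) * M z + of_int (1 + 5*a*c) = J (z + 5) / J z"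
    proof -
      have "(of_int (- 5*c*c) * M z + of_int (1 + 5*a*c)) * J z =
         of_int (- 5*c*c) * (M z * J z) + of_int (1 + 5*a*c) * J z" by (simp add: algebra_simps)
      also have "M z * J z = of_int a * z + of_int b" using J[OF z] by (simp add: M_def J_def)
      also have "of_int (- 5*c*c) * (of_int a * z + of_int b) + of_int (1 + 5*a*c) * J z =
          J z + 5 * of_int c * (of_int a * of_int d - of_int b * of_int c)"
        by (simp add: J_def algebra_simps)
      also have "\<dots> = J (z + 5)" unfolding mC by (simp add: J_def algebra_simps)
      finally show ?thesis using J[OF z] by (simp add: field_simps)
    qed
    have J2: "of_int (1 - 5*a*c) * M z + of_int (5*a*a) = (of_int a * (z + 5) + of_int b) / J z"
    proof -
      have "(of_int (1 - 5*a*c) * M z + of_int (5*a*a)) * J z =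
         of_int (1 - 5*a*c) * (M z * J z) + of_int (5*a*a) * J z" by (simp add: algebra_simps)
      also have "M z * J z = of_int a * z + of_int b" using J[OF z] by (simp add: M_def J_def)
      also have "of_int (1 - 5*a*c) * (of_int a * z + of_int b) + of_int (5*a*a) * J z =
          of_int a * z + of_int b + 5 * of_int a * (of_int a * of_int d - of_int b * of_int c)"
        by (simp add: J_def algebra_simps)
      also have "\<dots> = of_int a * (z + 5) + of_int b" unfolding mC by (simp add: algebra_simps)
      finally show ?thesis using J[OF z] by (simp add: field_simps)
    qed
    have "f (M (z + 5)) = (J (z + 5) / J z) ^ k * f (M z)"
      using tr unfolding J1 J2 using J[OF z] by (simp add: M_def J_def)
    moreover have "J (z + 5) \<noteq> 0" using J[of "z + 5"] z by simp
    ultimately show ?thesis using J[OF z] by (simp add: g_def power_divide)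
  qed
  have hol: "f holomorphic_on upper_half" using f by (simp add: modform_G05_iff)
  have cont: "continuous_on {z. Im z > 0} g"
    unfolding g_def
    by (intro continuous_intros continuous_on_compose2[OF holomorphic_on_imp_continuous_on[OF hol], of _ M])
       (use J Mpos in \<open>auto simp: M_def J_def intro!: continuous_intros\<close>)
  have "compact (g ` cbox (Complex 0 e) (Complex 5 1))"
    using e by (intro compact_continuous_image continuous_on_subset[OF cont]) (auto simp: in_cbox_complex_iff)
  then obtain B1 where B1: "\<And>z. z \<in> cbox (Complex 0 e) (Complex 5 1) \<Longrightarrow> norm (g z) \<le> B1"
    by (meson compact_imp_bounded bounded_iff imageI)
  obtain B2 where B2: "\<And>z. Im z \<ge> 1 \<Longrightarrow> norm (f (M z)) \<le> B2 * norm (J z) ^ k"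
    using f m unfolding modform_G05_iff bounded_at_cusps_def M_def J_def by blast
  have bd: "norm (g z) \<le> max B1 B2" if z: "Im z \<ge> e" for z
  proof (cases "Im z \<ge> 1")
    case True
    then have "J z \<noteq> 0" by (intro J) simp
    then have "norm (g z) \<le> B2"
      using B2[OF True] by (simp add: g_def norm_divide norm_power divide_le_eq)
    then show ?thesis by simp
  next
    case False
    define n where "n = - \<lfloor>Re z / 5\<rfloor>"
    have zz: "Im z > 0" using e z by simp
    have "g (z + of_int n * 5) = g z"
      by (rule periodic_of_int) (use per zz in auto)
    moreover have "z + of_int n * 5 \<in> cbox (Complex 0 e) (Complex 5 1)"
      using False z floor_divide_lower[of 5 "Re z"] floor_divide_upper[of 5 "Re z"]
      by (simp add: in_cbox_complex_iff n_def)
    ultimately show ?thesis using B1 by fastforce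
  qed
  have "norm (f (M z)) \<le> max B1 B2 * norm (J z) ^ k" if z: "Im z \<ge> e" for z
  proof -
    have "J z \<noteq> 0" using z e by (intro J) simp
    then have "norm (f (M z)) = norm (g z) * norm (J z) ^ k"
      by (simp add: g_def norm_divide norm_power)
    then show ?thesis using bd[OF z] by (simp add: mult_right_mono)
  qed
  then show ?thesis unfolding M_def J_def by blast
qed

section \<open>Integral q-expansions\<close>

definition converges :: "int fps \<Rightarrow> bool" where
  "converges A \<longleftrightarrow> fps_conv_radius (cfps A) \<ge> 1"

definition qeval :: "int fps \<Rightarrow> complex \<Rightarrow> complex" where
  "qeval A z = eval_fps (cfps A) (nome z)"

lemma cfps_add: "cfps (A + B) = cfps A + cfps B"
  and cfps_diff: "cfps (A - B) = cfps A - cfps B"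
  and cfps_mult: "cfps (A * B) = cfps A * cfps B"
  and cfps_const: "cfps (fps_const c) = fps_const (of_int c)"
  and cfps_0: "cfps 0 = 0"
  and cfps_1: "cfps 1 = 1"
  and cfps_numeral: "cfps (numeral n) = numeral n"
  by (simp_all add: fps_eq_iff fps_mult_nth fps_numeral_nth)

lemma convergesI: 
  assumes "\<And>z. Im z > 0 \<Longrightarrow> summable (\<lambda>n. of_int (fps_nth A n) * nome z ^ n)"
  shows "converges A"
  unfolding converges_def
proof (rule fps_conv_radius_ge_1)
  fix q :: complex assume q: "norm q < 1" "q \<noteq> 0"
  define z where "z = Ln q / (2 * of_real pi * \<i>)"
  have "nome z = q" using q by (simp add: nome_def z_def)
  moreover have "Im z > 0"
  proof -
    have "exp (- 2 * pi * Im z) < exp 0" using norm_nome[of z] q \<open>nome z = q\<close> by simp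
    then have "- 2 * pi * Im z < 0" by (subst (asm) exp_less_cancel_iff)
    then show ?thesis by (simp add: zero_less_mult_iff)
  qed
  ultimately show "summable (\<lambda>n. fps_nth (cfps A) n * q ^ n)"
    using assms[of z] by simp
qed

lemma nome_in_conv_radius: "converges A \<Longrightarrow> Im z > 0 \<Longrightarrow> ereal (norm (nome z)) < fps_conv_radius (cfps A)"
  unfolding converges_def using norm_nome_less_1[of z] by (metis ereal_less(3) less_le_trans one_ereal_def)

lemma qeval_sums: "converges A \<Longrightarrow> Im z > 0 \<Longrightarrow> (\<lambda>n. of_int (fps_nth A n) * nome z ^ n) sums qeval A z"
  using sums_eval_fps[OF nome_in_conv_radius, of A z] by (simp add: qeval_def)

lemma converges_add: "converges A \<Longrightarrow> converges B \<Longrightarrow> converges (A + B)"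
  and converges_diff: "converges A \<Longrightarrow> converges B \<Longrightarrow> converges (A - B)"
  and converges_mult: "converges A \<Longrightarrow> converges B \<Longrightarrow> converges (A * B)"
  unfolding converges_def cfps_add cfps_diff cfps_mult
  by (meson fps_conv_radius_add fps_conv_radius_diff fps_conv_radius_mult min.boundedI order_trans)+

lemma converges_const: "converges (fps_const c)" and converges_0: "converges 0" and converges_1: "converges 1" and converges_numeral: "converges (numeral n)"
  by (simp_all add: converges_def cfps_const cfps_0 cfps_1 cfps_numeral)

lemma qeval_add: "converges A \<Longrightarrow> converges B \<Longrightarrow> Im z > 0 \<Longrightarrow> qeval (A + B) z = qeval A z + qeval B z"
  and qeval_diff: "converges A \<Longrightarrow> converges B \<Longrightarrow> Im z > 0 \<Longrightarrow> qeval (A - B) z = qeval A z - qeval B z"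
  and qeval_mult: "converges A \<Longrightarrow> converges B \<Longrightarrow> Im z > 0 \<Longrightarrow> qeval (A * B) z = qeval A z * qeval B z"
  by (simp_all add: qeval_def cfps_add cfps_diff cfps_mult nome_in_conv_radius
      eval_fps_add eval_fps_diff eval_fps_mult)

lemma qeval_const: "qeval (fps_const c) z = of_int c" and qeval_0: "qeval 0 z = 0" and qeval_1: "qeval 1 z = 1"
  and qeval_numeral: "qeval (numeral n) z = numeral n"
  by (simp_all add: qeval_def cfps_const cfps_0 cfps_1 cfps_numeral)

lemma nome_has_field_derivative:
  "(nome has_field_derivative 2 * of_real pi * \<i> * nome z) (at z within X)"
  unfolding nome_def[abs_def] by (auto intro!: derivative_eq_intros)

definition euler_op :: "int fps \<Rightarrow> int fps" where
  "euler_op A = Abs_fps (\<lambda>n. int n * fps_nth A n)"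

lemma cfps_euler_op: "cfps (euler_op A) = fps_X * fps_deriv (cfps A)"
proof (rule fps_ext)
  fix n show "fps_nth (cfps (euler_op A)) n = fps_nth (fps_X * fps_deriv (cfps A)) n"
    by (cases n) (simp_all add: euler_op_def)
qed

lemma converges_euler_op: "converges A \<Longrightarrow> converges (euler_op A)"
  unfolding converges_def cfps_euler_op
  using fps_conv_radius_mult[of fps_X "fps_deriv (cfps A)"] fps_conv_radius_deriv[of "cfps A"]
  by (simp add: min_def split: if_splits)

lemma qeval_has_field_derivative:
  assumes "converges A" "Im z > 0"
  shows "(qeval A has_field_derivative 2 * of_real pi * \<i> * qeval (euler_op A) z) (at z within X)"
proof -
  note q = nome_in_conv_radius[OF assms]
  have d: "ereal (norm (nome z)) < fps_conv_radius (fps_deriv (cfps A))"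
    using q fps_conv_radius_deriv[of "cfps A"] by (rule less_le_trans)
  have "((\<lambda>z. eval_fps (cfps A) (nome z)) has_field_derivative
     eval_fps (fps_deriv (cfps A)) (nome z) * (2 * of_real pi * \<i> * nome z)) (at z within X)"
    by (rule DERIV_chain2[OF has_field_derivative_eval_fps[OF q] nome_has_field_derivative])
  also have "eval_fps (fps_deriv (cfps A)) (nome z) * (2 * of_real pi * \<i> * nome z) =
     2 * of_real pi * \<i> * qeval (euler_op A) z"
    using d by (simp add: qeval_def cfps_euler_op eval_fps_mult)
  finally show ?thesis by (simp add: qeval_def[abs_def])
qed

lemma qeval_holomorphic: "converges A \<Longrightarrow> qeval A holomorphic_on upper_half"
  unfolding holomorphic_on_def field_differentiable_def
  by (intro ballI exI) (rule qeval_has_field_derivative, auto)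

lemma qeval_periodic: "qeval A (z + 1) = qeval A z"
  using nome_of_nat[of 1] by (simp add: qeval_def nome_add)

lemma qeval_bounded_near_infinity:
  assumes "converges A" shows "bounded_near_infinity (qeval A)"
  unfolding bounded_near_infinity_def
proof (intro allI impI)
  fix e :: real assume e: "e > 0"
  define \<rho> where "\<rho> = exp (- 2 * pi * e)"
  have \<rho>: "\<rho> < 1" using e by (simp add: \<rho>_def)
  have sub: "cball (0::complex) \<rho> \<subseteq> eball 0 (fps_conv_radius (cfps A))"
  proof
    fix q :: complex assume "q \<in> cball 0 \<rho>"
    then have "norm q < 1" using \<rho> by simp
    then have "ereal (norm q) < 1" by simp
    also have "1 \<le> fps_conv_radius (cfps A)" using assms by (simp add: converges_def)
    finally show "q \<in> eball 0 (fps_conv_radius (cfps A))" by simp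
  qed
  have "compact (eval_fps (cfps A) ` cball 0 \<rho>)"
    by (intro compact_continuous_image continuous_on_subset[OF continuous_on_eval_fps sub]) auto
  then obtain B where B: "\<And>q. q \<in> cball 0 \<rho> \<Longrightarrow> norm (eval_fps (cfps A) q) \<le> B"
    by (meson compact_imp_bounded bounded_iff imageI)
  have "norm (qeval A z) \<le> B" if "Im z \<ge> e" for z
    unfolding qeval_def using that by (intro B) (simp add: norm_nome \<rho>_def)
  then show "\<exists>B. \<forall>z. Im z \<ge> e \<longrightarrow> norm (qeval A z) \<le> B" by blast
qed

definition dilate :: "nat \<Rightarrow> int fps \<Rightarrow> int fps" where
  "dilate t A = Abs_fps (\<lambda>n. if t dvd n then fps_nth A (n div t) else 0)"

lemma dilate_sums:
  assumes "converges A" "t > 0" "Im z > 0"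
  shows "(\<lambda>n. of_int (fps_nth (dilate t A) n) * nome z ^ n) sums qeval A (of_nat t * z)"
proof -
  have "(\<lambda>n. of_int (fps_nth A n) * nome (of_nat t * z) ^ n) sums qeval A (of_nat t * z)"
    using assms by (intro qeval_sums) auto
  also have "(\<lambda>n. of_int (fps_nth A n) * nome (of_nat t * z) ^ n) =
     (\<lambda>n. of_int (fps_nth (dilate t A) (t * n)) * nome z ^ (t * n))"
    using assms by (simp add: dilate_def nome_of_nat_mult power_mult)
  also have "\<dots> sums qeval A (of_nat t * z) \<longleftrightarrow>
     (\<lambda>n. of_int (fps_nth (dilate t A) n) * nome z ^ n) sums qeval A (of_nat t * z)"
  proof (rule sums_mono_reindex)
    show "strict_mono (\<lambda>n. t * n)" using assms by (intro strict_monoI) simp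
    show "of_int (fps_nth (dilate t A) n) * nome z ^ n = 0" if "n \<notin> range (\<lambda>n. t * n)" for n
      using that by (auto simp: dilate_def elim!: dvdE)
  qed
  finally show ?thesis .
qed

lemma converges_dilate: "converges A \<Longrightarrow> t > 0 \<Longrightarrow> converges (dilate t A)"
  using dilate_sums by (intro convergesI) (auto simp: sums_iff)

lemma qeval_dilate: "converges A \<Longrightarrow> t > 0 \<Longrightarrow> Im z > 0 \<Longrightarrow> qeval (dilate t A) z = qeval A (of_nat t * z)"
  using dilate_sums[of A t z] qeval_sums[OF converges_dilate, of A t z] by (auto dest: sums_unique2)

text \<open>Every q with 0 < |q| < 1 is a value of \<open>nome\<close>. The point q = 0 is reached
  by continuity, and then the uniqueness of power series applies.\<close>

lemma qeval_eq_0_imp: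
  assumes "converges A" "\<And>z. Im z > 0 \<Longrightarrow> qeval A z = 0"
  shows "A = 0"
proof -
  have ev0: "eval_fps (cfps A) q = 0" if q: "norm q < 1" "q \<noteq> 0" for q
  proof -
    define z where "z = Ln q / (2 * of_real pi * \<i>)"
    have z: "nome z = q" using q by (simp add: nome_def z_def)
    have "exp (- 2 * pi * Im z) < exp 0" using norm_nome[of z] q z by simp
    then have "- 2 * pi * Im z < 0" by (subst (asm) exp_less_cancel_iff)
    then have "Im z > 0" by (simp add: zero_less_mult_iff)
    from assms(2)[OF this] show ?thesis by (simp add: qeval_def z)
  qed
  have r: "fps_conv_radius (cfps A) > 0"
    using assms(1) unfolding converges_def by (metis ereal_less(2) less_le_trans one_ereal_def zero_less_one)
  have c: "isCont (eval_fps (cfps A)) 0"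
    using continuous_on_eval_fps[of "cfps A"] r
    by (subst (asm) continuous_on_eq_continuous_at) (auto simp: zero_ereal_def)
  have lim: "(eval_fps (cfps A) \<longlongrightarrow> eval_fps (cfps A) 0) (at 0)"
    using c by (simp add: isCont_def)
  have e1: "eventually (\<lambda>q::complex. norm q < 1) (nhds 0)"
    using eventually_nhds_in_open[of "ball (0::complex) 1" 0] by (simp add: dist_norm)
  then have "eventually (\<lambda>q. eval_fps (cfps A) q = 0) (at 0)"
    unfolding eventually_at_filter by eventually_elim (use ev0 in auto)
  then have "(eval_fps (cfps A) \<longlongrightarrow> 0) (at 0)" by (rule tendsto_eventually)
  with lim have 0: "eval_fps (cfps A) 0 = 0"
    by (metis LIM_unique)
  have "eventually (\<lambda>q. eval_fps (cfps A) q = eval_fps 0 q) (nhds 0)"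
    using e1 by eventually_elim (use ev0 0 in force)
  from eval_fps_eqD[OF r _ this] have "cfps A = 0" by simp
  then show "A = 0" by (simp add: fps_eq_iff)
qed

definition int_modforms :: "nat \<Rightarrow> int fps set" where
  "int_modforms k = {A. converges A \<and> modform_G05 k (qeval A)}"

definition mod2 :: "int fps \<Rightarrow> bit fps" where
  "mod2 A = Abs_fps (\<lambda>n. of_int (fps_nth A n))"

lemma Mk_eq: "Mk k = mod2 ` int_modforms k"
proof (intro equalityI subsetI)
  fix F assume "F \<in> Mk k"
  then obtain a f where F: "F = Abs_fps (\<lambda>n. of_int (a n))" and f: "modform_G05 k f"
    and s: "\<And>z. Im z > 0 \<Longrightarrow> (\<lambda>n. of_int (a n) * exp (2 * pi * \<i> * of_nat n * z)) sums f z"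
    unfolding Mk_def by auto
  define A where "A = Abs_fps a"
  have s': "(\<lambda>n. of_int (fps_nth A n) * nome z ^ n) sums f z" if "Im z > 0" for z
    using s[OF that] by (simp add: A_def nome_def exp_of_nat_mult[symmetric] mult_ac)
  have converges: "converges A" using s' by (intro convergesI) (auto simp: sums_iff)
  have "f z = qeval A z" if "Im z > 0" for z
    using s'[OF that] qeval_sums[OF converges that] by (rule sums_unique2)
  with f have "modform_G05 k (qeval A)" by (rule modform_G05_cong)
  with converges have "A \<in> int_modforms k" by (simp add: int_modforms_def)
  moreover have "F = mod2 A" by (simp add: F A_def mod2_def)
  ultimately show "F \<in> mod2 ` int_modforms k" by simp
next
  fix F assume "F \<in> mod2 ` int_modforms k"
  then obtain A where A: "F = mod2 A" "converges A" "modform_G05 k (qeval A)" by (auto simp: int_modforms_def)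
  have "(\<lambda>n. of_int (fps_nth A n) * exp (2 * pi * \<i> * of_nat n * z)) sums qeval A z" if "Im z > 0" for z
    using qeval_sums[OF A(2) that] by (simp add: nome_def exp_of_nat_mult[symmetric] mult_ac)
  with A show "F \<in> Mk k"
    unfolding Mk_def mod2_def mem_Collect_eq
    by (intro exI[of _ "fps_nth A"] conjI exI[of _ "qeval A"]) auto
qed

lemma int_modforms_add: "A \<in> int_modforms k \<Longrightarrow> B \<in> int_modforms k \<Longrightarrow> A + B \<in> int_modforms k"
  unfolding int_modforms_def using modform_G05_lincomb[of k "qeval A" "qeval B" 1 1]
  by (auto simp: converges_add qeval_add intro: modform_G05_cong)

lemma int_modforms_mult: "A \<in> int_modforms k \<Longrightarrow> B \<in> int_modforms l \<Longrightarrow> A * B \<in> int_modforms (k + l)"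
  unfolding int_modforms_def using modform_G05_mult[of k "qeval A" l "qeval B"]
  by (auto simp: converges_mult qeval_mult intro: modform_G05_cong)

lemma int_modforms_scale: "A \<in> int_modforms k \<Longrightarrow> fps_const c * A \<in> int_modforms k"
  unfolding int_modforms_def using modform_G05_lincomb[of k "qeval A" "qeval A" "of_int c" 0]
  by (auto simp: converges_mult converges_const qeval_mult qeval_const intro: modform_G05_cong)

lemma int_modforms_diff: "A \<in> int_modforms k \<Longrightarrow> B \<in> int_modforms k \<Longrightarrow> A - B \<in> int_modforms k"
  unfolding int_modforms_def using modform_G05_lincomb[of k "qeval A" "qeval B" 1 "-1"]
  by (auto simp: converges_diff qeval_diff intro: modform_G05_cong)

text \<open>Used with c = 48 and c = 12: forms that are constant modulo 2 combine to multiples of c,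
  and the quotients carry the information modulo 2.\<close>

lemma int_modforms_divide:
  assumes "fps_const c * A \<in> int_modforms k" "c \<noteq> 0"
  shows "A \<in> int_modforms k"
proof -
  have "converges A"
  proof (rule convergesI)
    fix z assume "Im z > 0"
    with qeval_sums[of "fps_const c * A" z] assms
    have "summable (\<lambda>n. of_int (fps_nth (fps_const c * A) n) * nome z ^ n)"
      by (auto simp: int_modforms_def sums_iff)
    then have "summable (\<lambda>n. of_int c * (of_int (fps_nth A n) * nome z ^ n))"
      by (simp add: mult_ac)
    then show "summable (\<lambda>n. of_int (fps_nth A n) * nome z ^ n)"
      using assms(2) by (subst (asm) summable_cmult_iff) auto
  qed
  moreover have "modform_G05 k (qeval A)"
  proof (rule modform_G05_cong)
    show "modform_G05 k (\<lambda>z. (1 / of_int c) * qeval (fps_const c * A) z + 0 * qeval (fps_const c * A) z)"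
      using assms by (intro modform_G05_lincomb) (auto simp: int_modforms_def)
  qed (use assms \<open>converges A\<close> in \<open>simp add: qeval_mult converges_const qeval_const\<close>)
  ultimately show ?thesis by (simp add: int_modforms_def)
qed

lemma int_modforms_0: "0 \<in> int_modforms k"
  by (auto simp: int_modforms_def converges_0 qeval_0[abs_def] modform_G05_def intro!: exI[of _ 0])

lemma int_modforms_1: "1 \<in> int_modforms 0"
  by (auto simp: int_modforms_def converges_1 qeval_1[abs_def] modform_G05_def intro!: exI[of _ 1])

lemma int_modforms_power: "A \<in> int_modforms k \<Longrightarrow> A ^ n \<in> int_modforms (n * k)"
  by (induction n) (auto simp: int_modforms_1 intro: int_modforms_mult)

lemma int_modforms_sum: "(\<And>i. i \<in> I \<Longrightarrow> A i \<in> int_modforms k) \<Longrightarrow> (\<Sum>i\<in>I. A i) \<in> int_modforms k"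
  by (induction I rule: infinite_finite_induct) (auto simp: int_modforms_0 intro: int_modforms_add)

section \<open>Eisenstein series and the discriminant\<close>

lemma converges_sigma: "converges sigma_fps"
  using sigma_fps_conv_radius by (simp add: converges_def)

lemma qeval_sigma: "qeval sigma_fps z = sigma_series z"
  by (simp add: qeval_def sigma_series_def)

lemma E2_eq_qeval: "Im z > 0 \<Longrightarrow> qeval (1 - 24 * sigma_fps) z = E2 z"
  by (simp add: E2_def qeval_diff qeval_mult converges_1 converges_mult converges_numeral converges_sigma qeval_1 qeval_numeral qeval_sigma)

lemma E2_periodic: "E2 (z + 1) = E2 z"
  by (simp add: E2_def qeval_sigma[symmetric] qeval_periodic)

text \<open>The non-holomorphic completion, which transforms without a correction term.\<close>
definition E2_star :: "complex \<Rightarrow> complex" where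
  "E2_star z = E2 z - 3 / of_real (pi * Im z)"

lemma level1_E2_star: "level1 2 E2_star"
  unfolding level1_def
proof (intro conjI allI impI)
  fix z :: complex assume z: "Im z > 0"
  show "E2_star (z + 1) = E2_star z" by (simp add: E2_star_def E2_periodic)
  define y where "y = (of_real (Im z) :: complex)"
  have nz: "z \<noteq> 0" "y \<noteq> 0" "cnj z \<noteq> 0" using z by (auto simp: y_def)
  have "Im (- 1 / z) = Im z / (norm z)^2"
    by (simp add: Im_divide cmod_power2)
  then have "of_real (pi * Im (- 1 / z)) = of_real pi * y / of_real ((norm z)^2)"
    unfolding y_def by (simp only: of_real_mult of_real_divide times_divide_eq_right)
  then have Im: "of_real (pi * Im (- 1 / z)) = of_real pi * y / (z * cnj z)"
    by (simp only: complex_norm_square)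
  then have "E2_star (- 1 / z) = z^2 * E2 z - 6 * \<i> * z / of_real pi - 3 * z * cnj z / (of_real pi * y)"
    unfolding E2_star_def E2_inversion[OF z] Im using nz by simp
  also have "cnj z = z - 2 * \<i> * y"
    by (simp add: y_def complex_eq_iff)
  also have "z^2 * E2 z - 6 * \<i> * z / of_real pi - 3 * z * (z - 2 * \<i> * y) / (of_real pi * y) =
     z^2 * (E2 z - 3 / (of_real pi * y))"
    using nz by (simp add: field_simps power2_eq_square)
  finally show "E2_star (- 1 / z) = z^2 * E2_star z" by (simp add: E2_star_def y_def)
qed auto

lemma bounded_near_infinity_E2_star: "bounded_near_infinity E2_star"
  unfolding bounded_near_infinity_def
proof (intro allI impI)
  fix e :: real assume e: "e > 0"
  have "bounded_near_infinity (qeval (1 - 24 * sigma_fps))"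
    by (intro qeval_bounded_near_infinity converges_diff converges_mult converges_1 converges_numeral converges_sigma)
  with e obtain B where B: "\<And>z. Im z \<ge> e \<Longrightarrow> norm (qeval (1 - 24 * sigma_fps) z) \<le> B"
    unfolding bounded_near_infinity_def by blast
  have "norm (E2_star z) \<le> B + 3 / (pi * e)" if z: "Im z \<ge> e" for z
  proof -
    have "norm (E2_star z) \<le> norm (E2 z) + norm (3 / of_real (pi * Im z) :: complex)"
      unfolding E2_star_def by (rule norm_triangle_ineq4)
    also have "norm (E2 z) \<le> B" using B[OF z] E2_eq_qeval[of z] z e by simp
    also have "norm (3 / of_real (pi * Im z) :: complex) \<le> 3 / (pi * e)"
      using z e by (simp add: norm_divide norm_mult frac_le)
    finally show ?thesis by simp
  qed
  then show "\<exists>B. \<forall>z. Im z \<ge> e \<longrightarrow> norm (E2_star z) \<le> B" by blast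
qed

definition G2 :: "int fps" where
  "G2 = 1 + 6 * sigma_fps - 30 * dilate 5 sigma_fps"

lemma converges_G2: "converges G2"
  unfolding G2_def by (intro converges_diff converges_add converges_mult converges_1 converges_numeral converges_sigma converges_dilate) simp

text \<open>Because Im (5z) = 5 Im z, the non-holomorphic parts of the two terms cancel; the
  combination is holomorphic and inherits the law of \<open>E2_star\<close>.\<close>

lemma qeval_G2:
  assumes "Im z > 0"
  shows "qeval G2 z = (5 / 4) * E2_star (of_nat 5 * z) + (- 1 / 4) * E2_star (of_nat 1 * z)"
proof -
  have "qeval G2 z = 1 + 6 * sigma_series z - 30 * sigma_series (5 * z)"
    using assms qeval_dilate[of sigma_fps 5 z]
    by (simp add: G2_def qeval_diff qeval_add qeval_mult converges_diff converges_add converges_mult converges_1 converges_numeral converges_sigma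
        converges_dilate qeval_1 qeval_numeral qeval_sigma)
  also have "\<dots> = (5 / 4) * E2_star (of_nat 5 * z) + (- 1 / 4) * E2_star (of_nat 1 * z)"
    using assms by (simp add: E2_star_def E2_def field_simps)
  finally show ?thesis .
qed

lemma G2_int_modforms: "G2 \<in> int_modforms 2"
proof -
  have "gamma0_invariant 2 (\<lambda>z. (5 / 4) * E2_star (of_nat 5 * z) + (- 1 / 4) * E2_star (of_nat 1 * z))"
    by (intro gamma0_invariant_lincomb level1_gamma0_invariant level1_E2_star) auto
  moreover have "bounded_at_cusps 2 (\<lambda>z. (5 / 4) * E2_star (of_nat 5 * z) + (- 1 / 4) * E2_star (of_nat 1 * z))"
    by (intro bounded_at_cusps_lincomb level1_bounded_at_cusps level1_E2_star bounded_near_infinity_E2_star) auto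
  ultimately have "gamma0_invariant 2 (qeval G2)" "bounded_at_cusps 2 (qeval G2)"
    using qeval_G2 by (auto intro: gamma0_invariant_cong bounded_at_cusps_cong)
  then show ?thesis
    by (simp add: int_modforms_def converges_G2 modform_G05_iff qeval_holomorphic)
qed

text \<open>Ramanujan's expression for the Eisenstein series of weight 4. Taken as definition, it
  yields the transformation law by differentiating that of \<open>E2\<close>, and its coefficients
  modulo 48 are visible.\<close>

definition E4 :: "int fps" where
  "E4 = (1 - 24 * sigma_fps)^2 + 288 * euler_op sigma_fps"

lemma converges_E4: "converges E4"
  unfolding E4_def power2_eq_square
  by (intro converges_diff converges_add converges_mult converges_1 converges_numeral converges_sigma converges_euler_op)

lemma qeval_E4: "Im z > 0 \<Longrightarrow> qeval E4 z = E2 z ^ 2 + 288 * qeval (euler_op sigma_fps) z"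
  unfolding E4_def power2_eq_square
  by (simp add: qeval_add qeval_mult converges_diff converges_mult converges_1 converges_numeral converges_sigma converges_euler_op E2_eq_qeval qeval_numeral)

lemma E2_has_field_derivative:
  assumes "Im z > 0"
  shows "(E2 has_field_derivative - 48 * of_real pi * \<i> * qeval (euler_op sigma_fps) z) (at z within X)"
proof -
  have "((\<lambda>z. 1 - 24 * qeval sigma_fps z) has_field_derivative
     - 48 * of_real pi * \<i> * qeval (euler_op sigma_fps) z) (at z within X)"
    using assms by (auto intro!: derivative_eq_intros qeval_has_field_derivative converges_sigma)
  then show ?thesis by (simp add: qeval_sigma E2_def[abs_def])
qed

lemma neg_inverse_has_field_derivative:
  "z \<noteq> 0 \<Longrightarrow> ((\<lambda>z. - 1 / z) has_field_derivative 1 / z^2) (at (z::complex) within X)"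
  by (auto intro!: derivative_eq_intros simp: power2_eq_square)

text \<open>Obtained by differentiating \<open>E2_inversion\<close>. Multiplied by 288, the last two
  terms are what cancels the cross term and the square of the correction in
  \<open>E2 (- 1 / z) ^ 2\<close>.\<close>

lemma euler_op_sigma_inversion:
  assumes z: "Im z > 0"
  shows "qeval (euler_op sigma_fps) (- 1 / z) =
    z^4 * qeval (euler_op sigma_fps) z + \<i> * z^3 * E2 z / (24 * of_real pi) + z^2 / (8 * of_real pi ^ 2)"
proof -
  define T where "T = qeval (euler_op sigma_fps)"
  have z0: "z \<noteq> 0" using z by auto
  have "((\<lambda>z. E2 (- 1 / z)) has_field_derivative
      (- 48 * of_real pi * \<i> * T (- 1 / z)) * (1 / z^2)) (at z)"
    unfolding T_def
    by (rule DERIV_chain2[OF E2_has_field_derivative[OF Im_neg_inverse[OF z]]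
          neg_inverse_has_field_derivative[OF z0]])
  then have 1: "((\<lambda>z. z^2 * E2 z - 6 * \<i> * z / of_real pi) has_field_derivative
      (- 48 * of_real pi * \<i> * T (- 1 / z)) * (1 / z^2)) (at z)"
    by (rule has_field_derivative_transform_within_open[OF _ open_upper_half])
       (use z E2_inversion in auto)
  have 2: "((\<lambda>z. z^2 * E2 z - 6 * \<i> * z / of_real pi) has_field_derivative
      2 * z * E2 z + z^2 * (- 48 * of_real pi * \<i> * T z) - 6 * \<i> / of_real pi) (at z)"
    unfolding T_def using z by (auto intro!: derivative_eq_intros E2_has_field_derivative)
  have "(- 48 * of_real pi * \<i> * T (- 1 / z)) * (1 / z^2) =
      2 * z * E2 z + z^2 * (- 48 * of_real pi * \<i> * T z) - 6 * \<i> / of_real pi"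
    by (rule DERIV_unique[OF 1 2])
  then have "z^2 * \<i> / (48 * of_real pi) * ((- 48 * of_real pi * \<i> * T (- 1 / z)) * (1 / z^2)) =
     z^2 * \<i> / (48 * of_real pi) * (2 * z * E2 z + z^2 * (- 48 * of_real pi * \<i> * T z) - 6 * \<i> / of_real pi)"
    by simp
  also have "z^2 * \<i> / (48 * of_real pi) * ((- 48 * of_real pi * \<i> * T (- 1 / z)) * (1 / z^2)) = T (- 1 / z)"
    using z0 by (simp add: field_simps)
  also have "z^2 * \<i> / (48 * of_real pi) * (2 * z * E2 z + z^2 * (- 48 * of_real pi * \<i> * T z) - 6 * \<i> / of_real pi) =
      z^4 * T z + \<i> * z^3 * E2 z / (24 * of_real pi) + z^2 / (8 * of_real pi ^ 2)"
    by (simp add: field_simps power2_eq_square power3_eq_cube power4_eq_xxxx)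
  finally show ?thesis by (simp add: T_def)
qed

lemma level1_E4: "level1 4 (qeval E4)"
  unfolding level1_def
proof (intro conjI allI impI)
  fix z :: complex assume z: "Im z > 0"
  show "qeval E4 (z + 1) = qeval E4 z" by (rule qeval_periodic)
  show "qeval E4 (- 1 / z) = z ^ 4 * qeval E4 z"
    unfolding qeval_E4[OF z] qeval_E4[OF Im_neg_inverse[OF z]] euler_op_sigma_inversion[OF z] E2_inversion[OF z]
    by (simp add: field_simps power2_eq_square power3_eq_cube power4_eq_xxxx)
qed auto

lemma dilate_E4_int_modforms:
  assumes "t dvd 5" "t > 0"
  shows "dilate t E4 \<in> int_modforms 4"
proof -
  have "gamma0_invariant 4 (\<lambda>z. qeval E4 (of_nat t * z))" "bounded_at_cusps 4 (\<lambda>z. qeval E4 (of_nat t * z))"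
    using assms by (auto intro!: level1_gamma0_invariant level1_bounded_at_cusps level1_E4 qeval_bounded_near_infinity converges_E4)
  then have "gamma0_invariant 4 (qeval (dilate t E4))" "bounded_at_cusps 4 (qeval (dilate t E4))"
    using assms by (auto intro: gamma0_invariant_cong bounded_at_cusps_cong simp: qeval_dilate converges_E4)
  then show ?thesis
    using assms by (simp add: int_modforms_def converges_E4 converges_dilate modform_G05_iff qeval_holomorphic)
qed

lemma dilate_1: "dilate 1 A = A"
  by (simp add: dilate_def fps_eq_iff)

lemma E4_int_modforms: "E4 \<in> int_modforms 4"
  using dilate_E4_int_modforms[of 1] by (simp add: dilate_1 del: One_nat_def)

section \<open>The discriminant and its transformation law\<close>

text \<open>The series of - log of the product of the (1 - x^n), so that Delta below is the discriminant
  and has no zeros by construction.\<close>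
definition log_fps :: "complex fps" where
  "log_fps = Abs_fps (\<lambda>n. of_int (fps_nth sigma_fps n) / of_nat n)"

lemma fps_deriv_log_fps: "fps_X * fps_deriv log_fps = cfps sigma_fps"
proof (rule fps_ext)
  fix n show "fps_nth (fps_X * fps_deriv log_fps) n = fps_nth (cfps sigma_fps) n"
    by (cases n) (simp_all add: log_fps_def del: of_nat_Suc)
qed

lemma log_fps_conv_radius: "fps_conv_radius log_fps \<ge> 1"
proof (rule fps_conv_radius_ge_1)
  fix q :: complex assume q: "norm q < 1"
  then have "ereal (norm q) < 1" by simp
  also have "1 \<le> fps_conv_radius (cfps sigma_fps)" by (rule sigma_fps_conv_radius)
  finally have s: "summable (\<lambda>n. norm (fps_nth (cfps sigma_fps) n * q ^ n))"
    by (rule norm_summable_fps)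
  show "summable (\<lambda>n. fps_nth log_fps n * q ^ n)"
  proof (rule summable_comparison_test'[OF s])
    fix n :: nat
    show "norm (fps_nth log_fps n * q ^ n) \<le> norm (fps_nth (cfps sigma_fps) n * q ^ n)"
    proof (cases n)
      case (Suc k)
      have "\<bar>real_of_int (fps_nth sigma_fps n)\<bar> / real n \<le> \<bar>real_of_int (fps_nth sigma_fps n)\<bar> / 1"
        using Suc by (intro divide_left_mono) auto
      from mult_right_mono[OF this, of "norm (q ^ n)"] show ?thesis
        by (simp add: log_fps_def norm_mult norm_divide)
    qed (simp add: log_fps_def)
  qed
qed

definition Delta :: "complex \<Rightarrow> complex" where
  "Delta z = nome z * exp (- 24 * eval_fps log_fps (nome z))"

lemma Delta_nonzero: "Delta z \<noteq> 0"
  by (simp add: Delta_def)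

lemma Delta_periodic: "Delta (z + 1) = Delta z"
  using nome_of_nat[of 1] by (simp add: Delta_def nome_add)

lemma Delta_has_field_derivative:
  assumes "Im z > 0"
  shows "(Delta has_field_derivative 2 * of_real pi * \<i> * E2 z * Delta z) (at z within X)"
proof -
  have "ereal (norm (nome z)) < 1" using norm_nome_less_1[OF assms] by simp
  also note log_fps_conv_radius
  finally have q: "ereal (norm (nome z)) < fps_conv_radius log_fps" .
  then have d: "ereal (norm (nome z)) < fps_conv_radius (fps_deriv log_fps)"
    using fps_conv_radius_deriv[of log_fps] by (rule less_le_trans)
  have "((\<lambda>z. eval_fps log_fps (nome z)) has_field_derivative
     eval_fps (fps_deriv log_fps) (nome z) * (2 * of_real pi * \<i> * nome z)) (at z within X)"
    by (rule DERIV_chain2[OF has_field_derivative_eval_fps[OF q] nome_has_field_derivative])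
  also have "eval_fps (fps_deriv log_fps) (nome z) * (2 * of_real pi * \<i> * nome z) =
     2 * of_real pi * \<i> * eval_fps (fps_X * fps_deriv log_fps) (nome z)"
    using d by (simp add: eval_fps_mult)
  also have "eval_fps (fps_X * fps_deriv log_fps) (nome z) = sigma_series z"
    by (simp add: fps_deriv_log_fps sigma_series_def)
  finally have l: "((\<lambda>z. eval_fps log_fps (nome z)) has_field_derivative
     2 * of_real pi * \<i> * sigma_series z) (at z within X)" .
  have "((\<lambda>z. nome z * exp (- 24 * eval_fps log_fps (nome z))) has_field_derivative
     2 * of_real pi * \<i> * nome z * exp (- 24 * eval_fps log_fps (nome z)) +
     (exp (- 24 * eval_fps log_fps (nome z)) * (- 24 * (2 * of_real pi * \<i> * sigma_series z))) * nome z) (at z within X)"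
    by (rule DERIV_mult[OF nome_has_field_derivative DERIV_chain2[OF DERIV_exp DERIV_cmult[OF l]]])
  also have "2 * of_real pi * \<i> * nome z * exp (- 24 * eval_fps log_fps (nome z)) +
     (exp (- 24 * eval_fps log_fps (nome z)) * (- 24 * (2 * of_real pi * \<i> * sigma_series z))) * nome z =
     2 * of_real pi * \<i> * E2 z * Delta z"
    by (simp add: Delta_def E2_def algebra_simps)
  finally have "((\<lambda>z. nome z * exp (- 24 * eval_fps log_fps (nome z))) has_field_derivative
     2 * of_real pi * \<i> * E2 z * Delta z) (at z within X)" .
  then show ?thesis by (simp add: Delta_def[abs_def])
qed

text \<open>The logarithmic derivative of \<open>Delta\<close> is 2 pi i \<open>E2\<close>, so by
  \<open>E2_inversion\<close> the quotient of the two sides has derivative 0 and is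
  constant.\<close>

lemma Delta_inversion:
  assumes z: "Im z > 0"
  shows "Delta (- 1 / z) = z ^ 12 * Delta z"
proof -
  define h where "h z = Delta (- 1 / z) / (z ^ 12 * Delta z)" for z
  have "(h has_field_derivative 0) (at z within upper_half)" if "z \<in> upper_half" for z
  proof -
    have z: "Im z > 0" and z0: "z \<noteq> 0" using that by auto
    have 1: "((\<lambda>z. Delta (- 1 / z)) has_field_derivative
        (2 * of_real pi * \<i> * E2 (- 1 / z) * Delta (- 1 / z)) * (1 / z^2)) (at z within upper_half)"
      by (rule DERIV_chain2[OF Delta_has_field_derivative[OF Im_neg_inverse[OF z]]
          neg_inverse_has_field_derivative[OF z0]])
    have 2: "((\<lambda>z. z ^ 12 * Delta z) has_field_derivative
        12 * z ^ 11 * Delta z + z ^ 12 * (2 * of_real pi * \<i> * E2 z * Delta z)) (at z within upper_half)"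
      by (auto intro!: derivative_eq_intros Delta_has_field_derivative z)
    have "z ^ 12 * Delta z \<noteq> 0" using z0 Delta_nonzero by simp
    from DERIV_divide[OF 1 2 this]
    have "(h has_field_derivative
       ((2 * of_real pi * \<i> * E2 (- 1 / z) * Delta (- 1 / z)) * (1 / z^2) * (z ^ 12 * Delta z) -
        Delta (- 1 / z) * (12 * z ^ 11 * Delta z + z ^ 12 * (2 * of_real pi * \<i> * E2 z * Delta z))) /
       (z ^ 12 * Delta z * (z ^ 12 * Delta z))) (at z within upper_half)"
      unfolding h_def .
    note h' = this
    \<comment> \<open>The correction term of \<open>E2_inversion\<close> becomes 12 / z, the
      logarithmic derivative of z^12.\<close>
    have eq: "2 * of_real pi * \<i> * E2 (- 1 / z) * (1 / z^2) = 2 * of_real pi * \<i> * E2 z + 12 / z"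
      unfolding E2_inversion[OF z] using z0 by (simp add: field_simps power2_eq_square)
    have perm: "X * Y * W = (X * W) * Y" for X Y W :: complex by simp
    have "(2 * of_real pi * \<i> * E2 (- 1 / z) * Delta (- 1 / z)) * (1 / z^2) =
       (2 * of_real pi * \<i> * E2 z + 12 / z) * Delta (- 1 / z)"
      unfolding eq[symmetric] by (rule perm)
    then have "(2 * of_real pi * \<i> * E2 (- 1 / z) * Delta (- 1 / z)) * (1 / z^2) * (z ^ 12 * Delta z) -
        Delta (- 1 / z) * (12 * z ^ 11 * Delta z + z ^ 12 * (2 * of_real pi * \<i> * E2 z * Delta z)) = 0"
      using z0 by (simp add: field_simps eval_nat_numeral)
    with h' show ?thesis by simp
  qed
  then obtain c where c: "\<And>z. z \<in> upper_half \<Longrightarrow> h z = c"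
    using has_field_derivative_zero_constant[of upper_half h] convex_halfspace_Im_gt[of 0]
    by (auto simp: upper_half_def)
  \<comment> \<open>The fixed point i of the inversion determines the constant, since i^12 =
    1.\<close>
  have "- 1 / \<i> = \<i>" by (simp add: complex_eq_iff)
  then have "h \<i> = 1" using Delta_nonzero[of \<i>] by (simp add: h_def eval_nat_numeral)
  then have "h z = 1" using c[of \<i>] c[of z] z by simp
  moreover have "z ^ 12 * Delta z \<noteq> 0" using z Delta_nonzero by auto
  ultimately show ?thesis by (simp add: h_def field_simps)
qed

text \<open>For Im z \<ge> 1 the nome stays in a compact disc inside the unit disc. There the
  logarithm of \<open>Delta\<close> / \<open>nome\<close> is bounded, so division by
  \<open>Delta\<close> costs no more than division by the nome.\<close>

lemma nome_le_Delta: "\<exists>B. \<forall>z. Im z \<ge> 1 \<longrightarrow> norm (nome z) \<le> B * norm (Delta z)"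
proof -
  define \<rho> where "\<rho> = exp (- 2 * pi)"
  have \<rho>: "\<rho> < 1" by (simp add: \<rho>_def)
  have sub: "cball (0::complex) \<rho> \<subseteq> eball 0 (fps_conv_radius log_fps)"
  proof
    fix q :: complex assume "q \<in> cball 0 \<rho>"
    then have "norm q < 1" using \<rho> by simp
    then have "ereal (norm q) < 1" by simp
    also note log_fps_conv_radius
    finally show "q \<in> eball 0 (fps_conv_radius log_fps)" by simp
  qed
  have "compact (eval_fps log_fps ` cball 0 \<rho>)"
    by (intro compact_continuous_image continuous_on_subset[OF continuous_on_eval_fps sub]) auto
  then obtain B where B: "\<And>q. q \<in> cball 0 \<rho> \<Longrightarrow> norm (eval_fps log_fps q) \<le> B"
    by (meson compact_imp_bounded bounded_iff imageI)
  have "norm (nome z) \<le> exp (24 * B) * norm (Delta z)" if "Im z \<ge> 1" for z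
  proof -
    define l where "l = eval_fps log_fps (nome z)"
    have "norm l \<le> B" unfolding l_def using that by (intro B) (simp add: norm_nome \<rho>_def)
    then have "0 \<le> 24 * B + Re (- 24 * l)" using complex_Re_le_cmod[of l] by simp
    then have "1 \<le> exp (24 * B) * norm (exp (- 24 * l))"
      by (simp add: norm_exp_eq_Re exp_add[symmetric])
    then have "norm (nome z) * 1 \<le> norm (nome z) * (exp (24 * B) * norm (exp (- 24 * l)))"
      by (intro mult_left_mono) auto
    then show ?thesis by (simp add: Delta_def l_def norm_mult mult_ac)
  qed
  then show ?thesis by blast
qed

section \<open>Vanishing of forms of high order at infinity\<close>

text \<open>A coarse fundamental domain suffices. While |Re w| and Im w are both at most 1/2, one
  has |w|^2 \<le> 1/2, so the inversion at least doubles the imaginary part; hence the induction on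
  n with Im z \<ge> (1/2)^n.\<close>

lemma level1_reduce:
  fixes f :: "complex \<Rightarrow> complex"
  assumes T: "\<And>z. Im z > 0 \<Longrightarrow> f (z + 1) = f z"
    and S: "\<And>z. Im z > 0 \<Longrightarrow> f (- 1 / z) = f z"
    and z: "Im z > 0"
  shows "\<exists>w. Im w \<ge> 1/2 \<and> \<bar>Re w\<bar> \<le> 1/2 \<and> f w = f z"
proof -
  have tr: "\<exists>w. Im w = Im z \<and> \<bar>Re w\<bar> \<le> 1/2 \<and> f w = f z" if "Im z > 0" for z
  proof (intro exI conjI)
    define n where "n = - \<lfloor>Re z + 1/2\<rfloor>"
    show "Im (z + of_int n) = Im z" by simp
    show "\<bar>Re (z + of_int n)\<bar> \<le> 1/2"
    proof -
      have "Re (z + of_int n) = Re z - of_int \<lfloor>Re z + 1/2\<rfloor>" by (simp add: n_def)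
      then show ?thesis unfolding abs_le_iff using floor_correct[of "Re z + 1/2"] by linarith
    qed
    show "f (z + of_int n) = f z" using periodic_of_int[of f 1 z n] T that by auto
  qed
  have "\<exists>w. Im w \<ge> 1/2 \<and> \<bar>Re w\<bar> \<le> 1/2 \<and> f w = f z" if "Im z > 0" "Im z \<ge> (1/2) ^ n" for n z
    using that
  proof (induction n arbitrary: z)
    case 0
    obtain w where w: "Im w = Im z" "\<bar>Re w\<bar> \<le> 1/2" "f w = f z" using tr 0 by blast
    moreover have "Im w \<ge> 1/2" using 0 w by simp
    ultimately show ?case by blast
  next
    case (Suc n)
    obtain w where w: "Im w = Im z" "\<bar>Re w\<bar> \<le> 1/2" "f w = f z" using tr Suc.prems by blast
    show ?case
    proof (cases "Im w \<ge> 1/2")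
      case True
      then show ?thesis using w by blast
    next
      case False
      have "(Re w)^2 \<le> (1/2)^2" using w(2) abs_le_square_iff[of "Re w" "1/2"] by simp
      moreover have "(Im w)^2 \<le> (1/2)^2" using False w Suc.prems by (intro power_mono) auto
      ultimately have n: "(norm w)^2 \<le> 1/2"
        unfolding cmod_power2 by (simp add: power_divide)
      have w0: "Im w > 0" "w \<noteq> 0" using w Suc.prems by auto
      have "2 * Im w \<le> Im w / (norm w)^2"
        using n w0 by (simp add: field_simps)
      also have "\<dots> = Im (- 1 / w)" by (simp add: Im_divide cmod_power2)
      finally have "Im (- 1 / w) \<ge> (1/2) ^ n" using Suc.prems w by simp
      from Suc.IH[OF Im_neg_inverse[OF w0(1)] this] show ?thesis
        using S[OF w0(1)] w by auto
    qed
  qed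
  moreover obtain n where "(1/2) ^ n < Im z"
    using real_arch_pow_inv[OF z, of "1/2"] by auto
  ultimately show ?thesis using z by (metis less_imp_le)
qed

text \<open>If f were nonzero somewhere, its decay at infinity and the reduction to a compact
  rectangle would make |f| attain its maximum on the half plane. Then f would be constant,
  contradicting the decay.\<close>

lemma level1_vanish:
  fixes f :: "complex \<Rightarrow> complex"
  assumes hol: "f holomorphic_on upper_half"
    and T: "\<And>z. Im z > 0 \<Longrightarrow> f (z + 1) = f z"
    and S: "\<And>z. Im z > 0 \<Longrightarrow> f (- 1 / z) = f z"
    and bd: "\<And>z. Im z \<ge> 1 \<Longrightarrow> norm (f z) \<le> C * norm (nome z)"
    and z: "Im z > 0"
  shows "f z = 0"
proof (rule ccontr)
  assume nz: "f z \<noteq> 0"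
  have "((\<lambda>y. C * exp (- 2 * pi * y)) \<longlongrightarrow> 0) at_top" by real_asymp
  then have "eventually (\<lambda>y. C * exp (- 2 * pi * y) < norm (f z)) at_top"
    using nz by (intro order_tendstoD) auto
  then obtain Y0 where Y0: "\<And>y. y \<ge> Y0 \<Longrightarrow> C * exp (- 2 * pi * y) < norm (f z)"
    by (auto simp: eventually_at_top_linorder)
  define Y where "Y = max 1 Y0"
  have small: "norm (f w) < norm (f z)" if "Im w \<ge> Y" for w
    using bd[of w] Y0[of "Im w"] that by (auto simp: Y_def norm_nome)
  define K where "K = cbox (Complex (-1/2) (1/2)) (Complex (1/2) Y)"
  have K: "w \<in> K \<longleftrightarrow> \<bar>Re w\<bar> \<le> 1/2 \<and> 1/2 \<le> Im w \<and> Im w \<le> Y" for w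
    by (auto simp: K_def in_cbox_complex_iff abs_le_iff)
  have reduce: "\<exists>v. f v = f w \<and> (v \<in> K \<or> Im v \<ge> Y)" if "Im w > 0" for w
    using level1_reduce[of f, OF T S that] unfolding K by (meson linear)
  obtain z1 where z1: "z1 \<in> K" "f z1 = f z" using reduce[OF z] small by fastforce
  have "continuous_on K (\<lambda>w. norm (f w))"
    using holomorphic_on_imp_continuous_on[OF hol]
    by (intro continuous_intros) (auto simp: K elim: continuous_on_subset)
  then obtain z0 where z0: "z0 \<in> K" "\<And>w. w \<in> K \<Longrightarrow> norm (f w) \<le> norm (f z0)"
    using continuous_attains_sup[of K "\<lambda>w. norm (f w)"] z1 by (auto simp: K_def)
  have max: "norm (f w) \<le> norm (f z0)" if "w \<in> upper_half" for w
  proof -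
    have "norm (f z) \<le> norm (f z0)" using z0(2)[OF z1(1)] z1 by simp
    moreover have "Im w > 0" using that by simp
    then obtain v where "f v = f w" "v \<in> K \<or> Im v \<ge> Y" using reduce by blast
    ultimately show ?thesis using z0(2)[of v] small[of v] by auto
  qed
  have "f constant_on upper_half"
    using maximum_modulus_principle[OF hol open_upper_half connected_upper_half open_upper_half
        order_refl _ max] z0(1) by (auto simp: K)
  then have "f (Complex 0 Y) = f z"
    using z by (auto simp: constant_on_def Y_def)
  with small[of "Complex 0 Y"] show False by simp
qed

text \<open>If g is nonzero at one point, it is nonzero on an open set; f vanishes there and hence
  everywhere by analytic continuation.\<close>

lemma holomorphic_product_vanish:
  assumes f: "f holomorphic_on upper_half" and g: "g holomorphic_on upper_half"
    and fg: "\<And>z. Im z > 0 \<Longrightarrow> f z * g z = 0"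
  shows "(\<forall>z. Im z > 0 \<longrightarrow> f z = 0) \<or> (\<forall>z. Im z > 0 \<longrightarrow> g z = 0)"
proof (rule disjCI, intro allI impI)
  fix w :: complex assume w: "Im w > 0" and "\<not> (\<forall>z. Im z > 0 \<longrightarrow> g z = 0)"
  then obtain z0 where z0: "Im z0 > 0" "g z0 \<noteq> 0" by auto
  define U where "U = upper_half \<inter> g -` (- {0})"
  have "open U" unfolding U_def
    by (rule continuous_open_preimage[OF holomorphic_on_imp_continuous_on[OF g] open_upper_half]) auto
  then show "f w = 0"
  proof (rule analytic_continuation_open[where f = f and g = "\<lambda>_. 0"])
    show "U \<noteq> {}" using z0 by (auto simp: U_def)
    show "f z = 0" if "z \<in> U" for z using fg[of z] that by (auto simp: U_def)
  qed (use f w in \<open>auto simp: U_def open_upper_half connected_upper_half\<close>)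
qed

section \<open>The coset translates of a form and their permutation\<close>

definition inv_slash :: "nat \<Rightarrow> (complex \<Rightarrow> complex) \<Rightarrow> complex \<Rightarrow> complex" where
  "inv_slash k f z = f (- 1 / z) / z ^ k"

lemma inv_slash_holomorphic:
  assumes "f holomorphic_on upper_half"
  shows "inv_slash k f holomorphic_on upper_half"
proof -
  have "f \<circ> (\<lambda>z. - 1 / z) holomorphic_on upper_half"
    using Im_neg_inverse
    by (intro holomorphic_on_compose_gen[OF _ assms] holomorphic_intros) auto
  then show ?thesis
    unfolding inv_slash_def[abs_def] by (auto simp: o_def intro!: holomorphic_intros)
qed

text \<open>The cusp 0 has width 5: inversion conjugates the translation by 5 into (1, 0; -5, 1), an
  element of Gamma0(5).\<close>

lemma inv_slash_periodic:
  assumes "gamma0_invariant k f" and z: "Im z > 0"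
  shows "inv_slash k f (z + 5) = inv_slash k f z"
proof -
  have nz: "z \<noteq> 0" "z + 5 \<noteq> 0" using z by (auto simp: complex_eq_iff)
  have "f ((of_int 1 * (- 1 / z) + of_int 0) / (of_int (- 5) * (- 1 / z) + of_int 1)) =
     (of_int (- 5) * (- 1 / z) + of_int 1) ^ k * f (- 1 / z)"
    by (rule gamma0_invariantD[OF assms(1)]) (use Im_neg_inverse[OF z] in auto)
  moreover have "of_int (- 5) * (- 1 / z) + of_int 1 = (z + 5) / z"
    using nz by (simp add: field_simps)
  ultimately have "f ((- 1 / z) / ((z + 5) / z)) = ((z + 5) / z) ^ k * f (- 1 / z)"
    using nz by simp
  moreover have "(- 1 / z) / ((z + 5) / z) = - 1 / (z + 5)" using nz by simp
  ultimately show ?thesis using nz by (simp add: inv_slash_def power_divide)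
qed

text \<open>Inversion acts on the translates as j -> -1/j modulo 5, hence the condition that jl is
  -1 modulo 5. It exchanges the translate with j = 0 and f itself, which is
  \<open>inv_slash_invert\<close>.\<close>

lemma inv_slash_invert_shift:
  fixes j l :: int
  assumes f: "gamma0_invariant k f" and k: "even k" and z: "Im z > 0" and jl: "5 dvd j * l + 1"
  shows "inv_slash k f (- 1 / z + of_int j) = z ^ k * inv_slash k f (z + of_int l)"
proof -
  define v u where "v = z + of_int l" and "u = - 1 / v"
  have v: "Im v > 0" using z by (simp add: v_def)
  then have nz: "v \<noteq> 0" "z \<noteq> 0" using z by auto
  have d0: "of_int j * z - 1 \<noteq> 0"
    using z by (cases "j = 0") (auto simp: complex_eq_iff)
  have w: "- 1 / z + of_int j = (of_int j * z - 1) / z"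
    using nz by (simp add: field_simps)
  \<comment> \<open>This element of Gamma0(5) maps u = -1 / (z + l) to -1 / (-1 / z + j).\<close>
  have tr: "f ((of_int l * u + of_int 1) / (of_int (- (j * l + 1)) * u + of_int (- j))) =
     (of_int (- (j * l + 1)) * u + of_int (- j)) ^ k * f u"
  proof (rule gamma0_invariantD[OF f])
    show "l * - j - 1 * - (j * l + 1) = 1" by (simp add: algebra_simps)
    show "5 dvd - (j * l + 1)" using jl by (metis dvd_minus_iff)
    show "Im u > 0" unfolding u_def by (rule Im_neg_inverse[OF v])
  qed
  have n: "of_int l * u + of_int 1 = z / v"
    using nz(1) by (simp add: u_def v_def field_simps)
  have d: "of_int (- (j * l + 1)) * u + of_int (- j) = - (of_int j * z - 1) / v"
    using nz(1) by (simp add: u_def v_def field_simps)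
  have "(z / v) / (- (of_int j * z - 1) / v) = - 1 / ((of_int j * z - 1) / z)"
    using nz d0 by (simp add: divide_simps) (simp add: algebra_simps)
  then have "f (- 1 / ((of_int j * z - 1) / z)) = (- (of_int j * z - 1) / v) ^ k * f u"
    using tr unfolding n d by simp
  then have "inv_slash k f ((of_int j * z - 1) / z) =
     (- (of_int j * z - 1) / v) ^ k * f u / ((of_int j * z - 1) / z) ^ k"
    by (simp only: inv_slash_def)
  also have "\<dots> = z ^ k * (f u / v ^ k)"
  proof -
    have "(- X / v) ^ k * Y / (X / z) ^ k = z ^ k * (Y / v ^ k)" if "X \<noteq> 0" for X Y
      using that k nz by (simp add: power_divide)
    then show ?thesis using d0 by blast
  qed
  finally show ?thesis unfolding w by (simp add: inv_slash_def u_def v_def)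
qed

lemma inv_slash_invert:
  assumes k: "even k" and z: "Im z > 0"
  shows "inv_slash k f (- 1 / z) = z ^ k * f z"
  using assms by (auto simp: inv_slash_def power_divide)

theorem sturm:
  assumes A: "A \<in> int_modforms (4 * m)" and van: "\<And>n. n \<le> 2 * m \<Longrightarrow> fps_nth A n = 0"
  shows "A = 0"
proof -
  define k F h where "k = 4 * m" and "F = qeval A" and "h = inv_slash k F"
  have cvA: "converges A" and mf: "modform_G05 k F" using A by (auto simp: int_modforms_def k_def F_def)
  have Fhol: "F holomorphic_on upper_half" and tr: "gamma0_invariant k F" and mb: "bounded_at_cusps k F"
    using mf by (auto simp: modform_G05_iff)
  have k: "even k" by (simp add: k_def)
  have hhol: "h holomorphic_on upper_half" unfolding h_def by (rule inv_slash_holomorphic[OF Fhol])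
  have hshift: "(\<lambda>z. h (z + of_nat j)) holomorphic_on upper_half" for j
  proof -
    have "h \<circ> (\<lambda>z. z + of_nat j) holomorphic_on upper_half"
      by (intro holomorphic_on_compose_gen[OF _ hhol] holomorphic_intros) auto
    then show ?thesis by (simp add: o_def)
  qed
  \<comment> \<open>The product of the translates of F by the six cosets of Gamma0(5) in SL2(Z).\<close>
  define \<Phi> where "\<Phi> z = F z * (h (z + of_nat 0) * (h (z + of_nat 1) * (h (z + of_nat 2) *
      (h (z + of_nat 3) * h (z + of_nat 4)))))" for z
  have \<Phi>T: "\<Phi> (z + 1) = \<Phi> z" if "Im z > 0" for z
  proof -
    have "h (z + 5) = h z" unfolding h_def by (rule inv_slash_periodic[OF tr that])
    then show ?thesis by (simp add: \<Phi>_def F_def qeval_periodic add.assoc)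
  qed
  have \<Phi>S: "\<Phi> (- 1 / z) = (z ^ 12) ^ (2 * m) * \<Phi> z" if z: "Im z > 0" for z
  proof -
    have nz: "z \<noteq> 0" using z by auto
    \<comment> \<open>The pairs (1, 4), (2, 2), (3, 3), (4, 1) are the solutions of jl = -1 modulo
      5.\<close>
    have "h (- 1 / z + of_nat 1) = z ^ k * h (z + of_nat 4)"
      "h (- 1 / z + of_nat 2) = z ^ k * h (z + of_nat 2)"
      "h (- 1 / z + of_nat 3) = z ^ k * h (z + of_nat 3)"
      "h (- 1 / z + of_nat 4) = z ^ k * h (z + of_nat 1)"
      using inv_slash_invert_shift[OF tr k z, of 1 4] inv_slash_invert_shift[OF tr k z, of 2 2]
        inv_slash_invert_shift[OF tr k z, of 3 3] inv_slash_invert_shift[OF tr k z, of 4 1]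
      by (simp_all add: h_def)
    moreover have "h (- 1 / z + of_nat 0) = z ^ k * F z"
      using inv_slash_invert[OF k z] by (simp add: h_def)
    moreover have "F (- 1 / z) = z ^ k * h (z + of_nat 0)"
      using nz by (simp add: h_def inv_slash_def)
    ultimately have "\<Phi> (- 1 / z) = (z ^ k * z ^ k * z ^ k * z ^ k * z ^ k * z ^ k) * \<Phi> z"
      unfolding \<Phi>_def by (simp only: mult_ac)
    also have "z ^ k * z ^ k * z ^ k * z ^ k * z ^ k * z ^ k = (z ^ 12) ^ (2 * m)"
      by (simp add: k_def power_add[symmetric] power_mult[symmetric])
    finally show ?thesis .
  qed
  have \<Phi>hol: "\<Phi> holomorphic_on upper_half"
    unfolding \<Phi>_def[abs_def] by (intro holomorphic_intros Fhol hshift)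
  define \<Psi> where "\<Psi> z = \<Phi> z / Delta z ^ (2 * m)" for z
  have "Delta holomorphic_on upper_half"
    unfolding holomorphic_on_def field_differentiable_def
    by (intro ballI exI) (rule Delta_has_field_derivative, auto)
  then have \<Psi>hol: "\<Psi> holomorphic_on upper_half"
    unfolding \<Psi>_def[abs_def] using Delta_nonzero by (intro holomorphic_intros \<Phi>hol) auto
  \<comment> \<open>One order more than \<open>Delta ^ (2 * m)\<close> has at infinity, so that a
    factor \<open>nome z\<close> survives the division. The other five factors of \<Phi> are only
    bounded.\<close>
  define n where "n = 2 * m + 1"
  define A' where "A' = fps_shift n A"
  have cA: "cfps A = fps_X ^ n * cfps A'"
  proof (rule fps_ext)
    fix i show "fps_nth (cfps A) i = fps_nth (fps_X ^ n * cfps A') i"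
    proof (cases "i < n")
      case True
      then show ?thesis
        unfolding fps_X_power_mult_nth cfps_nth using van[of i] by (simp add: n_def)
    next
      case False
      then have "i - n + n = i" by simp
      then show ?thesis using False by (simp add: A'_def fps_X_power_mult_nth)
    qed
  qed
  have "cfps A' = fps_shift n (cfps A)" by (simp add: fps_eq_iff A'_def)
  then have cvA': "converges A'" using cvA by (simp add: converges_def)
  have Fq: "F z = nome z ^ n * qeval A' z" if "Im z > 0" for z
    using nome_in_conv_radius[OF cvA' that]
    by (simp add: F_def qeval_def cA eval_fps_mult)
  obtain B0 where B0: "\<And>z. Im z \<ge> 1 \<Longrightarrow> norm (qeval A' z) \<le> B0"
    using qeval_bounded_near_infinity[OF cvA'] unfolding bounded_near_infinity_def by (meson zero_less_one)
  obtain B1 where B1': "\<forall>z. Im z \<ge> 1 \<longrightarrow>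
      norm (F ((of_int 0 * z + of_int (- 1)) / (of_int 1 * z + of_int 0))) \<le> B1 * norm (of_int 1 * z + of_int 0) ^ k"
    using mb[unfolded bounded_at_cusps_def, rule_format, of 0 0 "-1" 1] by auto
  then have B1: "norm (h z) \<le> B1" if "Im z \<ge> 1" for z
  proof -
    have "z \<noteq> 0" using that by auto
    then show ?thesis
      using B1'[rule_format, OF that]
      by (simp add: h_def inv_slash_def norm_divide norm_power divide_le_eq)
  qed
  obtain B2 where B2: "\<And>z. Im z \<ge> 1 \<Longrightarrow> norm (nome z) \<le> B2 * norm (Delta z)"
    using nome_le_Delta by blast
  define C where "C = B0 * (B1 * (B1 * (B1 * (B1 * B1)))) * B2 ^ (2 * m)"
  have bd: "norm (\<Psi> z) \<le> C * norm (nome z)" if z: "Im z \<ge> 1" for z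
  proof -
    have hj: "norm (h (z + of_nat j)) \<le> B1" for j using z by (intro B1) simp
    have B10: "0 \<le> B1" using hj[of 0] norm_ge_zero order_trans by blast
    have B00: "0 \<le> B0" using B0[OF z] norm_ge_zero order_trans by blast
    have z': "Im z > 0" using z by simp
    define d where "d = norm (Delta z)"
    have d: "d > 0" using Delta_nonzero by (simp add: d_def)
    have "norm (nome z) / d \<le> B2" using B2[OF z] d by (simp add: d_def divide_le_eq)
    then have 1: "(norm (nome z) / d) ^ (2 * m) \<le> B2 ^ (2 * m)"
      using d by (intro power_mono) auto
    have "norm (\<Phi> z) \<le> (norm (nome z) ^ n * B0) * (B1 * (B1 * (B1 * (B1 * B1))))"
      unfolding \<Phi>_def norm_mult Fq[OF z'] norm_power using B0[OF z] B10 B00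
      by (intro mult_mono mult_left_mono hj mult_nonneg_nonneg) auto
    then have "norm (\<Psi> z) \<le> (norm (nome z) ^ n * B0) * (B1 * (B1 * (B1 * (B1 * B1)))) / d ^ (2 * m)"
      using d unfolding \<Psi>_def norm_divide norm_power d_def[symmetric]
      by (intro divide_right_mono) auto
    also have "\<dots> = (norm (nome z) / d) ^ (2 * m) * (norm (nome z) * (B0 * (B1 * (B1 * (B1 * (B1 * B1))))))"
      by (simp add: n_def power_divide)
    also have "\<dots> \<le> B2 ^ (2 * m) * (norm (nome z) * (B0 * (B1 * (B1 * (B1 * (B1 * B1))))))"
      using B10 B00 by (intro mult_right_mono 1) auto
    finally show ?thesis by (simp add: C_def mult_ac)
  qed
  have "\<Psi> z = 0" if "Im z > 0" for z
  proof (rule level1_vanish[OF \<Psi>hol _ _ bd that])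
    fix z :: complex assume z: "Im z > 0"
    then have "z \<noteq> 0" by auto
    show "\<Psi> (z + 1) = \<Psi> z" by (simp add: \<Psi>_def \<Phi>T[OF z] Delta_periodic)
    show "\<Psi> (- 1 / z) = \<Psi> z"
      unfolding \<Psi>_def \<Phi>S[OF z] Delta_inversion[OF z] power_mult_distrib
      using \<open>z \<noteq> 0\<close> by simp
  qed
  then have \<Phi>0: "\<Phi> z = 0" if "Im z > 0" for z
    using that Delta_nonzero[of z] by (force simp: \<Psi>_def)
  \<comment> \<open>Undoing the translation and the inversion recovers F from any translate of
    h.\<close>
  have h0: "\<forall>z. Im z > 0 \<longrightarrow> F z = 0" if "\<forall>z. Im z > 0 \<longrightarrow> h (z + of_nat j) = 0" for j
  proof (intro allI impI)
    fix z :: complex assume z: "Im z > 0"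
    have "Im (- 1 / z - of_nat j) > 0" using Im_neg_inverse[OF z] by simp
    with that have "h (- 1 / z - of_nat j + of_nat j) = 0" by blast
    then have "z ^ k * F z = 0"
      using inv_slash_invert[OF k z] by (simp add: h_def)
    then show "F z = 0" using z by auto
  qed
  have step: "(\<forall>z. Im z > 0 \<longrightarrow> F z = 0) \<or> (\<forall>z. Im z > 0 \<longrightarrow> g z = 0)"
    if "\<forall>z. Im z > 0 \<longrightarrow> h (z + of_nat j) * g z = 0" "g holomorphic_on upper_half" for j g
    using holomorphic_product_vanish[OF hshift that(2), of j] h0[of j] that(1) by blast
  have "(\<forall>z. Im z > 0 \<longrightarrow> F z = 0) \<or>
     (\<forall>z. Im z > 0 \<longrightarrow> h (z + of_nat 0) * (h (z + of_nat 1) * (h (z + of_nat 2) *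
      (h (z + of_nat 3) * h (z + of_nat 4)))) = 0)"
    by (rule holomorphic_product_vanish[OF Fhol])
       (use \<Phi>0 in \<open>auto simp only: \<Phi>_def intro!: holomorphic_intros hshift\<close>)
  moreover note step[OF _ holomorphic_on_mult[OF hshift[of 1] holomorphic_on_mult[OF hshift[of 2]
        holomorphic_on_mult[OF hshift[of 3] hshift[of 4]]]], of 0]
    step[OF _ holomorphic_on_mult[OF hshift[of 2] holomorphic_on_mult[OF hshift[of 3] hshift[of 4]]], of 1]
    step[OF _ holomorphic_on_mult[OF hshift[of 3] hshift[of 4]], of 2]
    step[OF _ hshift[of 4], of 3] h0[of 4]
  ultimately have "\<forall>z. Im z > 0 \<longrightarrow> F z = 0" by argo
  then show "A = 0" using qeval_eq_0_imp[OF cvA] by (simp add: F_def)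
qed

section \<open>Hecke operators\<close>

text \<open>The form as a function of degree -k on pairs of periods, on which integer matrices act
  linearly.\<close>

definition homog :: "nat \<Rightarrow> (complex \<Rightarrow> complex) \<Rightarrow> complex \<Rightarrow> complex \<Rightarrow> complex" where
  "homog k f u v = f (u / v) / v ^ k"

lemma homog_integer_matrix_cong:
  fixes p1 q1 r1 s1 p2 q2 r2 s2 N :: int
  assumes f: "gamma0_invariant k f" and N: "N > 0" "coprime 5 N"
    and d1: "p1 * s1 - q1 * r1 = N" and d2: "p2 * s2 - q2 * r2 = N"
    and r: "5 dvd r1" "5 dvd r2"
    and dv: "N dvd p2 * s1 - q2 * r1" "N dvd q2 * p1 - p2 * q1"
      "N dvd r2 * s1 - s2 * r1" "N dvd s2 * p1 - r2 * q1"
    and z: "Im z > 0"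
  shows "homog k f (of_int p2 * z + of_int q2) (of_int r2 * z + of_int s2) =
         homog k f (of_int p1 * z + of_int q1) (of_int r1 * z + of_int s1)"
proof -
  obtain a b c d where abcd: "p2 * s1 - q2 * r1 = N * a" "q2 * p1 - p2 * q1 = N * b"
    "r2 * s1 - s2 * r1 = N * c" "s2 * p1 - r2 * q1 = N * d"
    using dv by (meson dvd_def)
  have "N * (a * p1 + b * r1) = (N * a) * p1 + (N * b) * r1" by (simp add: algebra_simps)
  also have "\<dots> = (p1 * s1 - q1 * r1) * p2"
    unfolding abcd[symmetric] by (simp add: algebra_simps)
  finally have p2: "p2 = a * p1 + b * r1" using N d1 by simp
  have "N * (a * q1 + b * s1) = (N * a) * q1 + (N * b) * s1" by (simp add: algebra_simps)
  also have "\<dots> = (p1 * s1 - q1 * r1) * q2"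
    unfolding abcd[symmetric] by (simp add: algebra_simps)
  finally have q2: "q2 = a * q1 + b * s1" using N d1 by simp
  have "N * (c * p1 + d * r1) = (N * c) * p1 + (N * d) * r1" by (simp add: algebra_simps)
  also have "\<dots> = (p1 * s1 - q1 * r1) * r2"
    unfolding abcd[symmetric] by (simp add: algebra_simps)
  finally have r2: "r2 = c * p1 + d * r1" using N d1 by simp
  have "N * (c * q1 + d * s1) = (N * c) * q1 + (N * d) * s1" by (simp add: algebra_simps)
  also have "\<dots> = (p1 * s1 - q1 * r1) * s2"
    unfolding abcd[symmetric] by (simp add: algebra_simps)
  finally have s2: "s2 = c * q1 + d * s1" using N d1 by simp
  have "N * (a * d - b * c) = (a * d - b * c) * (p1 * s1 - q1 * r1)" by (simp add: d1)
  also have "\<dots> = p2 * s2 - q2 * r2" by (simp add: p2 q2 r2 s2 algebra_simps)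
  also have "\<dots> = N * 1" using d2 by simp
  finally have det: "a * d - b * c = 1" using N by simp
  have "5 dvd N * c" unfolding abcd(3)[symmetric] using r by (intro dvd_diff dvd_mult dvd_mult2)
  then have c5: "5 dvd c" using N(2) by (simp add: coprime_dvd_mult_right_iff)
  define J w where "J = of_int r1 * z + of_int s1" and "w = (of_int p1 * z + of_int q1) / J"
  have J: "J \<noteq> 0" unfolding J_def by (rule moebius_denominator_nonzero[OF d1 N(1) z])
  have w: "Im w > 0" unfolding w_def J_def by (rule Im_moebius_pos[OF d1 N(1) z])
  have wJ: "w * J = of_int p1 * z + of_int q1" using J by (simp add: w_def)
  have num: "of_int p2 * z + of_int q2 = (of_int a * w + of_int b) * J"
    unfolding distrib_right mult.assoc wJ by (simp add: p2 q2 J_def algebra_simps)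
  have den: "of_int r2 * z + of_int s2 = (of_int c * w + of_int d) * J"
    unfolding distrib_right mult.assoc wJ by (simp add: r2 s2 J_def algebra_simps)
  have nz: "of_int c * w + of_int d \<noteq> 0"
    using moebius_denominator_nonzero[OF det _ w] by simp
  have "homog k f (of_int p2 * z + of_int q2) (of_int r2 * z + of_int s2) =
     f ((of_int a * w + of_int b) / (of_int c * w + of_int d)) / ((of_int c * w + of_int d) * J) ^ k"
    unfolding num den homog_def using J by simp
  also have "\<dots> = f w / J ^ k"
    using gamma0_invariantD[OF f det c5 w] nz J by (simp add: power_mult_distrib)
  finally show ?thesis by (simp add: homog_def w_def J_def)
qed

lemma bounded_at_cusps_upper_triangular:
  fixes \<alpha> \<beta> \<delta> :: int
  assumes f: "modform_G05 k f" and pos: "\<alpha> > 0" "\<delta> > 0"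
  shows "bounded_at_cusps k (\<lambda>z. f ((of_int \<alpha> * z + of_int \<beta>) / of_int \<delta>))"
  unfolding bounded_at_cusps_def
proof (intro allI impI)
  fix a b c d :: int assume 1: "a * d - b * c = 1"
  have "(\<alpha> * a + \<beta> * c) * (\<delta> * d) - (\<alpha> * b + \<beta> * d) * (\<delta> * c) = \<alpha> * \<delta> * (a * d - b * c)"
    by (simp add: algebra_simps)
  then have det: "(\<alpha> * a + \<beta> * c) * (\<delta> * d) - (\<alpha> * b + \<beta> * d) * (\<delta> * c) = \<alpha> * \<delta>" using 1 by simp
  obtain B where B: "\<And>z. Im z \<ge> 1 \<Longrightarrow>
     norm (f ((of_int (\<alpha> * a + \<beta> * c) * z + of_int (\<alpha> * b + \<beta> * d)) / (of_int (\<delta> * c) * z + of_int (\<delta> * d))))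
       \<le> B * norm (of_int (\<delta> * c) * z + of_int (\<delta> * d) :: complex) ^ k"
    using bounded_at_integer_matrix[OF modform_bounded_ge[OF f] det] pos by auto
  show "\<exists>B. \<forall>z. 1 \<le> Im z \<longrightarrow>
     norm (f ((of_int \<alpha> * ((of_int a * z + of_int b) / (of_int c * z + of_int d)) + of_int \<beta>) / of_int \<delta>))
       \<le> B * norm (of_int c * z + of_int d) ^ k"
  proof (intro exI allI impI)
    fix z :: complex assume z: "1 \<le> Im z"
    define J where "J = of_int c * z + of_int d"
    have J: "J \<noteq> 0" unfolding J_def using moebius_denominator_nonzero[OF 1] z by simp
    have dJ: "of_int (\<delta> * c) * z + of_int (\<delta> * d) = of_int \<delta> * J" by (simp add: J_def algebra_simps)
    have "(of_int \<alpha> * ((of_int a * z + of_int b) / J) + of_int \<beta>) / of_int \<delta> =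
       (of_int (\<alpha> * a + \<beta> * c) * z + of_int (\<alpha> * b + \<beta> * d)) / (of_int \<delta> * J)"
    proof -
      have "of_int \<alpha> * ((of_int a * z + of_int b) / J) + of_int \<beta> =
        (of_int \<alpha> * (of_int a * z + of_int b) + of_int \<beta> * J) / J"
        using J by (simp add: field_simps)
      then show ?thesis by (simp add: J_def algebra_simps)
    qed
    then show "norm (f ((of_int \<alpha> * ((of_int a * z + of_int b) / (of_int c * z + of_int d)) + of_int \<beta>) / of_int \<delta>))
       \<le> B * of_int \<delta> ^ k * norm (of_int c * z + of_int d) ^ k"
      using B[OF z] pos unfolding dJ J_def[symmetric]
      by (simp add: norm_mult power_mult_distrib mult_ac)
  qed
qed

lemma bounded_at_cusps_sum:
  assumes "finite I" "\<And>i. i \<in> I \<Longrightarrow> bounded_at_cusps k (g i)"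
  shows "bounded_at_cusps k (\<lambda>z. \<Sum>i\<in>I. g i z)"
  using assms
proof (induction I rule: finite_induct)
  case empty
  then show ?case by (auto simp: bounded_at_cusps_def intro!: exI[of _ 0])
next
  case (insert i I)
  then show ?case using bounded_at_cusps_lincomb[of k "g i" "\<lambda>z. \<Sum>i\<in>I. g i z" 1 1] by simp
qed

text \<open>This is p times the usual Hecke operator. Dropping the factor 1/p keeps the coefficients
  integral in weight 0 and does not matter modulo 2 for odd p.\<close>

definition hecke :: "nat \<Rightarrow> nat \<Rightarrow> (complex \<Rightarrow> complex) \<Rightarrow> complex \<Rightarrow> complex" where
  "hecke p k f z = (\<Sum>j<p. f ((z + of_nat j) / of_nat p)) + of_nat p ^ k * f (of_nat p * z)"

lemma hecke_bounded_at_cusps: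
  assumes "modform_G05 k f" "p > 0"
  shows "bounded_at_cusps k (hecke p k f)"
proof -
  have 1: "bounded_at_cusps k (\<lambda>z. \<Sum>j<p. f ((of_int 1 * z + of_int (int j)) / of_int (int p)))"
    using assms by (intro bounded_at_cusps_sum bounded_at_cusps_upper_triangular) auto
  have 2: "bounded_at_cusps k (\<lambda>z. f ((of_int (int p) * z + of_int 0) / of_int 1))"
    using assms by (intro bounded_at_cusps_upper_triangular) auto
  from bounded_at_cusps_lincomb[OF 1 2, of 1 "of_nat p ^ k"] show ?thesis
    by (simp add: hecke_def[abs_def])
qed

text \<open>The triple stands for the matrix (\<alpha>, \<beta>; 0, \<delta>) of determinant p.
  Index p is the remaining representative diag(p, 1).\<close>

definition hecke_rep :: "nat \<Rightarrow> nat \<Rightarrow> int \<times> int \<times> int" where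
  "hecke_rep p j = (if j < p then (1, int j, int p) else (int p, 0, 1))"

lemma hecke_eq_sum_homog:
  assumes "p > 0"
  shows "hecke p k f z = of_nat p ^ k *
    (\<Sum>j\<le>p. case hecke_rep p j of (\<alpha>, \<beta>, \<delta>) \<Rightarrow> homog k f (of_int \<alpha> * z + of_int \<beta>) (of_int \<delta>))"
proof -
  have "{..p} = insert p {..<p}" by auto
  then show ?thesis using assms
    by (simp add: hecke_def hecke_rep_def homog_def distrib_left sum_distrib_left add.commute)
qed

lemma homog_scale: "v \<noteq> 0 \<Longrightarrow> homog k f (u / v) w / v ^ k = homog k f u (w * v)"
  by (simp add: homog_def power_mult_distrib mult.commute)

text \<open>Homogeneity absorbs the automorphy factor, so substituting a Moebius map becomes
  multiplying integer matrices.\<close>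

lemma homog_of_moebius:
  assumes "J \<noteq> 0"
  shows "homog k f (\<alpha> * (N / J) + \<beta>) \<delta> / J ^ k = homog k f (\<alpha> * N + \<beta> * J) (\<delta> * J)"
proof -
  have "\<alpha> * (N / J) + \<beta> = (\<alpha> * N + \<beta> * J) / J" using assms by (simp add: add_divide_distrib)
  then show ?thesis using homog_scale[OF assms] by simp
qed

text \<open>
  The rows of the representative with index j span a line in F_p^2, generated by (1, j), or by (0, 1)
  for j = p. Its image under (a b; c d) is generated by (line_coord p a c j, line_coord p b d j).
\<close>
definition line_coord :: "nat \<Rightarrow> int \<Rightarrow> int \<Rightarrow> nat \<Rightarrow> int" where
  "line_coord p x y j = (if j < p then x + int j * y else y)"

definition same_line :: "nat \<Rightarrow> int \<Rightarrow> int \<Rightarrow> int \<Rightarrow> int \<Rightarrow> nat \<Rightarrow> nat \<Rightarrow> bool" where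
  "same_line p a b c d j l \<longleftrightarrow>
     (if l < p then int p dvd line_coord p b d j - line_coord p a c j * int l
      else int p dvd line_coord p a c j)"

text \<open>If the first coordinate of the image is invertible modulo p, then l is the quotient of
  the coordinates; otherwise the image is the line with index p.\<close>

lemma same_line_exists:
  assumes p: "prime p"
  shows "\<exists>l\<le>p. same_line p a b c d j l"
proof (cases "int p dvd (line_coord p a c j)")
  case True
  then show ?thesis by (intro exI[of _ p]) (simp add: same_line_def)
next
  case False
  then have "coprime ((line_coord p a c j)) (int p)"
    using p by (simp add: coprime_commute prime_imp_coprime)
  then obtain x where x: "[(line_coord p a c j) * x = 1] (mod int p)" using cong_solve_coprime_int by blast
  define l where "l = nat (((line_coord p b d j) * x) mod int p)"
  have pp: "int p > 0" using p by (simp add: prime_gt_0_nat)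
  have l: "int l = ((line_coord p b d j) * x) mod int p" using pp by (simp add: l_def)
  have "int l < int p" using pp by (simp add: l)
  moreover have "[(line_coord p a c j) * int l = (line_coord p a c j) * ((line_coord p b d j) * x)] (mod int p)"
    unfolding l by (simp add: cong_def mod_simps)
  then have "[(line_coord p a c j) * int l = (line_coord p b d j) * ((line_coord p a c j) * x)] (mod int p)" by (simp add: mult_ac)
  then have "[(line_coord p a c j) * int l = (line_coord p b d j) * 1] (mod int p)"
    using x by (meson cong_scalar_left cong_trans)
  then have "[(line_coord p b d j) = (line_coord p a c j) * int l] (mod int p)" by (simp add: cong_sym)
  then have "int p dvd (line_coord p b d j) - (line_coord p a c j) * int l" by (simp add: cong_iff_dvd_diff)
  ultimately show ?thesis by (intro exI[of _ l]) (simp add: same_line_def)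
qed

text \<open>Vectors on a common line have determinant 0 modulo p. As ad - bc = 1, that determinant
  equals the one of the original generators, which is i - j or, if just one index is p, a
  unit.\<close>

lemma same_line_inj:
  assumes p: "prime p" and det: "a * d - b * c = 1"
  assumes same: "same_line p a b c d i l" "same_line p a b c d j l" "i \<le> p" "j \<le> p"
  shows "i = j"
proof -
  have p1: "int p > 1" using prime_gt_1_nat[OF p] by simp
  have cross: "int p dvd (line_coord p a c j) * (line_coord p b d i) - (line_coord p a c i) * (line_coord p b d j)"
  proof (cases "l < p")
    case True
    have "(line_coord p a c j) * (line_coord p b d i) - (line_coord p a c i) * (line_coord p b d j) =
       (line_coord p a c j) * ((line_coord p b d i) - (line_coord p a c i) * int l) - (line_coord p a c i) * ((line_coord p b d j) - (line_coord p a c j) * int l)"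
      by (simp add: algebra_simps)
    then show ?thesis using same True by (simp add: same_line_def)
  next
    case False
    then show ?thesis using same by (simp add: same_line_def)
  qed
  consider "i < p" "j < p" | "i < p" "j = p" | "i = p" "j < p" | "i = p" "j = p"
    using same by linarith
  then show ?thesis
  proof cases
    case 1
    have "(line_coord p a c j) * (line_coord p b d i) - (line_coord p a c i) * (line_coord p b d j) = (a * d - b * c) * (int i - int j)"
      using 1 by (simp add: line_coord_def algebra_simps)
    then have "int p dvd int i - int j" using cross det by simp
    moreover have "\<bar>int i - int j\<bar> < int p" using 1 by auto
    ultimately have "int i - int j = 0" using zdvd_not_zless[of "\<bar>int i - int j\<bar>" "int p"] by auto
    then show ?thesis by simp
  next
    case 2
    have "(line_coord p a c j) * (line_coord p b d i) - (line_coord p a c i) * (line_coord p b d j) = - (a * d - b * c)"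
      using 2 by (simp add: line_coord_def algebra_simps)
    then show ?thesis using cross det p1 by (simp add: zdvd1_eq)
  next
    case 3
    have "(line_coord p a c j) * (line_coord p b d i) - (line_coord p a c i) * (line_coord p b d j) = a * d - b * c"
      using 3 by (simp add: line_coord_def algebra_simps)
    then show ?thesis using cross det p1 by (simp add: zdvd1_eq)
  qed simp
qed

text \<open>Representative j times (a, b; c, d) and representative l have rows spanning the same
  line modulo p, so they differ on the left by an element of Gamma0(5), which \<open>homog\<close>
  does not see.\<close>

lemma hecke_term:
  fixes a b c d :: int
  assumes p: "prime p" and p5: "p \<noteq> 5" and det: "a * d - b * c = 1" and c5: "5 dvd c"
  assumes f: "gamma0_invariant k f" and z: "Im z > 0" and jl: "j \<le> p" "l \<le> p" "same_line p a b c d j l"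
  shows "(case hecke_rep p j of (\<alpha>, \<beta>, \<delta>) \<Rightarrow>
       homog k f (of_int \<alpha> * ((of_int a * z + of_int b) / (of_int c * z + of_int d)) + of_int \<beta>) (of_int \<delta>)
         / (of_int c * z + of_int d) ^ k) =
     (case hecke_rep p l of (\<alpha>, \<beta>, \<delta>) \<Rightarrow> homog k f (of_int \<alpha> * z + of_int \<beta>) (of_int \<delta>))"
proof -
  obtain \<alpha> \<beta> \<delta> where j: "hecke_rep p j = (\<alpha>, \<beta>, \<delta>)" by (metis prod_cases3)
  obtain \<alpha>' \<beta>' \<delta>' where l: "hecke_rep p l = (\<alpha>', \<beta>', \<delta>')" by (metis prod_cases3)
  define J where "J = of_int c * z + of_int d"
  have J: "J \<noteq> 0" unfolding J_def using moebius_denominator_nonzero[OF det _ z] by simp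
  have \<alpha>\<delta>: "\<alpha> * \<delta> = int p" "\<alpha>' * \<delta>' = int p"
    using j l by (auto simp: hecke_rep_def split: if_splits)
  have pp: "int p > 0" using p by (simp add: prime_gt_0_nat)
  have "coprime 5 p" using p p5 by (intro primes_coprime) auto
  then have cop: "coprime 5 (int p)" by (metis coprime_int_iff of_nat_numeral)
  have "homog k f (of_int \<alpha> * ((of_int a * z + of_int b) / J) + of_int \<beta>) (of_int \<delta>) / J ^ k =
     homog k f (of_int (\<alpha> * a + \<beta> * c) * z + of_int (\<alpha> * b + \<beta> * d)) (of_int (\<delta> * c) * z + of_int (\<delta> * d))"
    unfolding homog_of_moebius[OF J] by (simp add: J_def algebra_simps)
  also have "\<dots> = homog k f (of_int \<alpha>' * z + of_int \<beta>') (of_int 0 * z + of_int \<delta>')"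
  proof (rule homog_integer_matrix_cong[OF f pp cop _ _ _ _ _ _ _ _ z])
    have "(\<alpha> * a + \<beta> * c) * (\<delta> * d) - (\<alpha> * b + \<beta> * d) * (\<delta> * c) = \<alpha> * \<delta> * (a * d - b * c)"
      by (simp add: algebra_simps)
    then show "(\<alpha> * a + \<beta> * c) * (\<delta> * d) - (\<alpha> * b + \<beta> * d) * (\<delta> * c) = int p"
      using det \<alpha>\<delta> by simp
    show "5 dvd \<delta> * c" using c5 by simp
    show "int p dvd (\<alpha> * a + \<beta> * c) * \<delta>' - (\<alpha> * b + \<beta> * d) * 0"
      "int p dvd (\<alpha> * b + \<beta> * d) * \<alpha>' - (\<alpha> * a + \<beta> * c) * \<beta>'"
      "int p dvd \<delta> * c * \<delta>' - \<delta> * d * 0"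
      "int p dvd \<delta> * d * \<alpha>' - \<delta> * c * \<beta>'"
      using j l jl by (auto simp: hecke_rep_def same_line_def line_coord_def algebra_simps
          split: if_splits intro!: dvd_diff dvd_add)
  qed (use \<alpha>\<delta> in simp_all)
  finally show ?thesis unfolding j l J_def by simp
qed

lemma hecke_transform:
  fixes a b c d :: int
  assumes p: "prime p" and p5: "p \<noteq> 5" and det: "a * d - b * c = 1" and c5: "5 dvd c"
  assumes f: "gamma0_invariant k f" and z: "Im z > 0"
  shows "hecke p k f ((of_int a * z + of_int b) / (of_int c * z + of_int d)) =
    (of_int c * z + of_int d) ^ k * hecke p k f z"
proof -
  define J where "J = of_int c * z + of_int d"
  have J: "J \<noteq> 0" unfolding J_def using moebius_denominator_nonzero[OF det _ z] by simp
  have pp: "p > 0" using p by (simp add: prime_gt_0_nat)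
  obtain \<sigma> where \<sigma>: "\<And>j. \<sigma> j \<le> p" "\<And>j. same_line p a b c d j (\<sigma> j)" using same_line_exists[OF p] by metis
  have inj: "inj_on \<sigma> {..p}" by (rule inj_onI) (metis \<sigma>(2) same_line_inj[OF p det] atMost_iff)
  have "\<sigma> ` {..p} \<subseteq> {..p}" using \<sigma>(1) by auto
  then have im: "\<sigma> ` {..p} = {..p}" using inj by (intro endo_inj_surj) auto
  define T where "T j w = (case hecke_rep p j of (\<alpha>, \<beta>, \<delta>) \<Rightarrow>
      homog k f (of_int \<alpha> * w + of_int \<beta>) (of_int \<delta>))" for j w
  have "T j ((of_int a * z + of_int b) / J) / J ^ k = T (\<sigma> j) z" if "j \<le> p" for j
    using hecke_term[OF p p5 det c5 f z that \<sigma>(1) \<sigma>(2)] unfolding J_def T_def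
    by (simp add: case_prod_unfold)
  then have "(\<Sum>j\<le>p. T j ((of_int a * z + of_int b) / J)) / J ^ k = (\<Sum>j\<le>p. T (\<sigma> j) z)"
    by (simp add: sum_divide_distrib)
  also have "\<dots> = (\<Sum>j\<in>\<sigma> ` {..p}. T j z)" by (simp add: sum.reindex[OF inj])
  also have "\<dots> = (\<Sum>j\<le>p. T j z)" unfolding im ..
  finally have "(\<Sum>j\<le>p. T j ((of_int a * z + of_int b) / J)) = J ^ k * (\<Sum>j\<le>p. T j z)"
    using J by (simp add: field_simps)
  then show ?thesis unfolding hecke_eq_sum_homog[OF pp] J_def T_def by simp
qed

lemma hecke_gamma0_invariant:
  assumes "gamma0_invariant k f" "prime p" "p \<noteq> 5"
  shows "gamma0_invariant k (hecke p k f)"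
  unfolding gamma0_invariant_def using hecke_transform[OF assms(2,3) _ _ assms(1)] by auto

section \<open>The q-expansion of the Hecke image\<close>

lemma nome_eq_1_iff: "nome (of_nat n / of_nat p) = 1 \<longleftrightarrow> p dvd n" if "p > 0"
proof
  assume "p dvd n"
  then obtain m where "n = p * m" by blast
  then show "nome (of_nat n / of_nat p) = 1" using that by simp
next
  assume "nome (of_nat n / of_nat p) = 1"
  then have "exp (2 * of_real pi * \<i> * (of_nat n / of_nat p)) = 1" by (simp add: nome_def)
  then obtain m :: int where "Im (2 * of_real pi * \<i> * (of_nat n / of_nat p)) = of_int (2 * m) * pi"
    unfolding exp_eq_1 by blast
  then have "2 * pi * (real n / real p) = 2 * pi * of_int m"
    using that by (simp add: Im_divide power2_eq_square)
  then have "real n / real p = of_int m" unfolding mult_cancel_left by simp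
  then have "real n = of_int (m * int p)" using that by (simp add: field_simps)
  then have "int n = m * int p" by linarith
  then show "p dvd n" by (metis dvd_triv_right int_dvd_int_iff)
qed

lemma sum_roots_of_unity:
  assumes "p > 0"
  shows "(\<Sum>j<p. nome (of_nat j / of_nat p) ^ n) = (if p dvd n then of_nat p else 0)"
proof -
  define \<zeta> where "\<zeta> = nome (of_nat n / of_nat p)"
  have 1: "nome (of_nat j / of_nat p) ^ n = \<zeta> ^ j" for j
    unfolding \<zeta>_def nome_of_nat_mult[symmetric] by (simp add: mult_ac)
  have "\<zeta> ^ p = 1"
    using assms unfolding \<zeta>_def nome_of_nat_mult[symmetric] by simp
  then have "(\<Sum>j<p. \<zeta> ^ j) = (if \<zeta> = 1 then of_nat p else 0)"
    by (simp add: sum_gp_strict)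
  then show ?thesis unfolding 1 using nome_eq_1_iff[OF assms, of n] by (simp add: \<zeta>_def)
qed

definition hecke_fps :: "nat \<Rightarrow> nat \<Rightarrow> int fps \<Rightarrow> int fps" where
  "hecke_fps p k A = Abs_fps (\<lambda>n. int p * fps_nth A (p * n) +
      (if p dvd n then int p ^ k * fps_nth A (n div p) else 0))"

text \<open>Summing over the shifts j is a root of unity filter: exponents not divisible by p drop
  out and the others are multiplied by p.\<close>

lemma hecke_sums:
  assumes A: "converges A" and p: "p > 0" and z: "Im z > 0"
  shows "(\<lambda>n. of_int (fps_nth (hecke_fps p k A) n) * nome z ^ n) sums hecke p k (qeval A) z"
proof -
  have zj: "Im ((z + of_nat j) / of_nat p) > 0" for j using z p by (simp add: Im_divide power2_eq_square)
  have qj: "nome ((z + of_nat j) / of_nat p) ^ n = nome (z / of_nat p) ^ n * nome (of_nat j / of_nat p) ^ n" for j n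
    by (simp add: add_divide_distrib nome_add power_mult_distrib)
  have "(\<lambda>n. \<Sum>j<p. of_int (fps_nth A n) * nome ((z + of_nat j) / of_nat p) ^ n)
      sums (\<Sum>j<p. qeval A ((z + of_nat j) / of_nat p))"
    by (intro sums_sum qeval_sums A zj)
  also have "(\<lambda>n. \<Sum>j<p. of_int (fps_nth A n) * nome ((z + of_nat j) / of_nat p) ^ n) =
     (\<lambda>n. of_int (fps_nth A n) * nome (z / of_nat p) ^ n * (if p dvd n then of_nat p else 0))"
    unfolding qj sum_roots_of_unity[OF p, symmetric] sum_distrib_left by (simp only: mult.assoc)
  finally have *: "(\<lambda>n. of_int (fps_nth A n) * nome (z / of_nat p) ^ n * (if p dvd n then of_nat p else 0))
     sums (\<Sum>j<p. qeval A ((z + of_nat j) / of_nat p))" (is "?f sums _") .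
  have "(\<lambda>n. ?f (p * n)) sums (\<Sum>j<p. qeval A ((z + of_nat j) / of_nat p)) \<longleftrightarrow>
     ?f sums (\<Sum>j<p. qeval A ((z + of_nat j) / of_nat p))"
    by (rule sums_mono_reindex) (use p in \<open>auto intro!: strict_monoI elim!: dvdE\<close>)
  with * have 1: "(\<lambda>n. ?f (p * n)) sums (\<Sum>j<p. qeval A ((z + of_nat j) / of_nat p))" by simp
  have "nome (z / of_nat p) ^ (p * n) = nome z ^ n" for n
  proof -
    have "nome (z / of_nat p) ^ p = nome z"
      using p unfolding nome_of_nat_mult[symmetric] by simp
    then show ?thesis by (simp add: power_mult)
  qed
  with 1 have 1: "(\<lambda>n. of_int (fps_nth A (p * n)) * nome z ^ n * of_nat p)
       sums (\<Sum>j<p. qeval A ((z + of_nat j) / of_nat p))"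
    by simp
  have 2: "(\<lambda>n. of_nat p ^ k * (of_int (fps_nth (dilate p A) n) * nome z ^ n)) sums (of_nat p ^ k * qeval A (of_nat p * z))"
    by (intro sums_mult dilate_sums A p z)
  have "of_int (fps_nth (hecke_fps p k A) n) * nome z ^ n = of_int (fps_nth A (p * n)) * nome z ^ n * of_nat p +
      of_nat p ^ k * (of_int (fps_nth (dilate p A) n) * nome z ^ n)" for n
    by (simp add: hecke_fps_def dilate_def algebra_simps)
  with sums_add[OF 1 2] show ?thesis by (simp only: hecke_def)
qed

theorem hecke_int_modforms:
  assumes A: "A \<in> int_modforms k" and p: "prime p" "p \<noteq> 5"
  shows "hecke_fps p k A \<in> int_modforms k"
proof -
  have cvA: "converges A" and mf: "modform_G05 k (qeval A)" using A by (auto simp: int_modforms_def)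
  have pp: "p > 0" using p by (simp add: prime_gt_0_nat)
  have converges: "converges (hecke_fps p k A)"
    using hecke_sums[OF cvA pp] by (intro convergesI) (auto simp: sums_iff)
  have qeval: "hecke p k (qeval A) z = qeval (hecke_fps p k A) z" if "Im z > 0" for z
    using hecke_sums[OF cvA pp that] qeval_sums[OF converges that] by (rule sums_unique2)
  have "gamma0_invariant k (qeval (hecke_fps p k A))"
    using mf p by (intro gamma0_invariant_cong[OF hecke_gamma0_invariant qeval]) (auto simp: modform_G05_iff)
  moreover have "bounded_at_cusps k (qeval (hecke_fps p k A))"
    by (rule bounded_at_cusps_cong[OF hecke_bounded_at_cusps[OF mf pp] qeval])
  ultimately show ?thesis by (simp add: int_modforms_def modform_G05_iff converges qeval_holomorphic)
qed

section \<open>Reduction modulo 2\<close>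

text \<open>The involution d -> k/d pairs the divisors below the square root of k with those above
  it, leaving only the root itself.\<close>

lemma card_divisors_parity:
  fixes k :: nat
  assumes "k > 0"
  shows "odd (card {d. d dvd k}) \<longleftrightarrow> (\<exists>n. n^2 = k)"
proof -
  define lo hi mid where "lo = {d. d dvd k \<and> d * d < k}" and "hi = {d. d dvd k \<and> k < d * d}"
    and "mid = {d. d dvd k \<and> d * d = k}"
  have fin: "finite {d. d dvd k}" using assms by simp
  then have f: "finite lo" "finite hi" "finite mid"
    unfolding lo_def hi_def mid_def by (auto elim: finite_subset[rotated])
  have "bij_betw (\<lambda>d. k div d) lo hi"
  proof (rule bij_betw_byWitness[where f' = "\<lambda>d. k div d"])
    have "k div (k div d) = d" if "d dvd k" for d
      using that assms by (auto elim!: dvdE)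
    then show "\<forall>d\<in>lo. k div (k div d) = d" "\<forall>d\<in>hi. k div (k div d) = d"
      by (auto simp: lo_def hi_def)
    have "e * d dvd d * e \<and> (d * d < d * e \<longleftrightarrow> d * e < e * e)" if "d * e > 0" for d e :: nat
      using that by auto
    then show "(\<lambda>d. k div d) ` lo \<subseteq> hi" "(\<lambda>d. k div d) ` hi \<subseteq> lo"
      using assms by (auto simp: lo_def hi_def elim!: dvdE)
  qed
  then have c: "card lo = card hi" by (rule bij_betw_same_card)
  have "{d. d dvd k} = (lo \<union> hi) \<union> mid" by (auto simp: lo_def hi_def mid_def)
  moreover have "lo \<inter> hi = {}" "(lo \<union> hi) \<inter> mid = {}" by (auto simp: lo_def hi_def mid_def)
  ultimately have "card {d. d dvd k} = card lo + card hi + card mid"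
    using f by (simp add: card_Un_disjoint)
  with c have odd: "odd (card {d. d dvd k}) \<longleftrightarrow> odd (card mid)" by simp
  show ?thesis
  proof (cases "\<exists>n. n^2 = k")
    case True
    then obtain n where n: "n^2 = k" by blast
    have "mid = {n}"
      using power2_eq_iff_nonneg[of _ n] by (auto simp: mid_def power2_eq_square[symmetric] n[symmetric])
    then show ?thesis using odd True by simp
  next
    case False
    then have "mid = {}" by (auto simp: mid_def power2_eq_square)
    then show ?thesis using odd False by simp
  qed
qed

text \<open>Coefficient of x^k in the sum of the x^(t n^2) over n > 0. For t > 0 the exponent
  determines n, so existence replaces counting.\<close>

definition square_ind :: "nat \<Rightarrow> nat \<Rightarrow> bit" where
  "square_ind t k = of_bool (\<exists>n>0. t * n^2 = k)"

lemma square_ind_0: "t > 0 \<Longrightarrow> square_ind t 0 = 0"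
  by (auto simp: square_ind_def)

lemma square_ind_double_double: "square_ind (2 * t) (2 * k) = square_ind t k"
  by (simp add: square_ind_def)

lemma square_ind_odd_double:
  assumes "odd t" shows "square_ind t (2 * k) = square_ind (2 * t) k"
proof -
  have "(\<exists>n>0. t * n^2 = 2 * k) \<longleftrightarrow> (\<exists>n>0. 2 * t * n^2 = k)"
  proof
    assume "\<exists>n>0. t * n^2 = 2 * k"
    then obtain n where n: "n > 0" "t * n^2 = 2 * k" by blast
    then have "even (t * n^2)" by simp
    then have "even n" using assms by simp
    then obtain m where "n = 2 * m" by blast
    then show "\<exists>n>0. 2 * t * n^2 = k" using n by (intro exI[of _ m]) (auto simp: power2_eq_square)
  next
    assume "\<exists>n>0. 2 * t * n^2 = k"
    then obtain n where "n > 0" "2 * t * n^2 = k" by blast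
    then show "\<exists>n>0. t * n^2 = 2 * k" by (intro exI[of _ "2 * n"]) (auto simp: power2_eq_square)
  qed
  then show ?thesis by (simp add: square_ind_def)
qed

lemma of_nat_bit: "(of_nat n :: bit) = of_bool (odd n)"
  by (auto elim!: evenE oddE)

text \<open>Removing a factor 2 from k leaves the odd divisors unchanged and swaps the two
  indicators. For odd k all divisors are odd, and their number is odd just for squares.\<close>

lemma sigma_parity:
  assumes "k > 0"
  shows "of_nat (card {d. d dvd k \<and> odd d}) = square_ind 1 k + square_ind 2 k"
  using assms
proof (induction k rule: less_induct)
  case (less k)
  show ?case
  proof (cases "even k")
    case True
    then obtain j where j: "k = 2 * j" by blast
    have "{d. d dvd k \<and> odd d} = {d. d dvd j \<and> odd d}"
      by (auto simp: j coprime_dvd_mult_right_iff)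
    then have "of_nat (card {d. d dvd k \<and> odd d}) = square_ind 1 j + square_ind 2 j"
      using less j by simp
    also have "\<dots> = square_ind 1 k + square_ind 2 k"
      unfolding j square_ind_odd_double[OF odd_one] square_ind_double_double[of 1 j, unfolded mult_1_right]
      by (simp only: mult_1_right add.commute)
    finally show ?thesis .
  next
    case False
    then have "{d. d dvd k \<and> odd d} = {d. d dvd k}" by auto
    moreover have "(of_nat (card {d. d dvd k}) :: bit) = of_bool (\<exists>n. n^2 = k)"
      using card_divisors_parity[OF less.prems] by (simp only: of_nat_bit)
    moreover have "(\<exists>n. n^2 = k) \<longleftrightarrow> (\<exists>n>0. n^2 = k)"
      using less.prems by (metis gr0I power_zero_numeral less_irrefl)
    moreover have "square_ind 2 k = 0" using False by (auto simp: square_ind_def)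
    ultimately show ?thesis by (simp add: square_ind_def)
  qed
qed

lemma sigma_mod_2: "(of_int (fps_nth sigma_fps k) :: bit) = square_ind 1 k + square_ind 2 k"
proof (cases "k = 0")
  case True
  then show ?thesis by (simp add: square_ind_0)
next
  case False
  then have fin: "finite {d. d dvd k}" by simp
  have "(of_int (fps_nth sigma_fps k) :: bit) = (\<Sum>d | d dvd k. of_bool (odd d))"
    by (simp add: sigma_fps_def of_nat_bit)
  also have "\<dots> = of_nat (card ({d. d dvd k} \<inter> {d. odd d}))"
    using fin by (simp add: sum_of_bool_eq)
  also have "{d. d dvd k} \<inter> {d. odd d} = {d. d dvd k \<and> odd d}" by auto
  finally show ?thesis using sigma_parity[of k] False by simp
qed

lemma r_nth: "fps_nth r k = square_ind 1 k + square_ind 2 k + square_ind 5 k + square_ind 10 k"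
proof -
  define X where "X t = {n::nat. n > 0 \<and> t * n^2 = k}" for t
  have X: "X t = {} \<or> (\<exists>n. X t = {n})" if "t > 0" for t
  proof (cases "X t = {}")
    case False
    then obtain n where n: "n > 0" "t * n^2 = k" by (auto simp: X_def)
    have "m = n" if "t * m^2 = k" for m
      using that n \<open>t > 0\<close> power2_eq_iff_nonneg[of m n] by auto
    then have "X t = {n}" using n unfolding X_def by blast
    then show ?thesis by blast
  qed simp
  have fin: "finite (X t)" if "t > 0" for t using X[OF that] by auto
  have "square_ind t k = of_bool (X t \<noteq> {})" for t
    by (simp add: square_ind_def X_def)
  then have card: "of_nat (card (X t)) = square_ind t k" if "t > 0" for t
    using X[OF that] by (elim disjE exE) simp_all
  have "{(n, t). n > 0 \<and> t \<in> {1, 2, 5, 10} \<and> t * n^2 = k} =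
      (\<lambda>(t, n). (n, t)) ` (SIGMA t:{1, 2, 5, 10}. X t)"
    by (auto simp: X_def image_iff)
  moreover have "inj_on (\<lambda>(t, n). (n, t)) (SIGMA t:{1, 2, 5, 10}. X t)"
    by (auto simp: inj_on_def)
  ultimately have "card {(n, t). n > 0 \<and> t \<in> {1, 2, 5, 10} \<and> t * n^2 = k} =
      card (SIGMA t:{1, 2, 5, 10}. X t)"
    by (simp add: card_image)
  also have "\<dots> = card (X 1) + card (X 2) + card (X 5) + card (X 10)"
    by (subst card_SigmaI) (auto intro!: fin)
  finally show ?thesis by (simp add: r_def card)
qed

text \<open>In the convolution the terms i and n - i cancel in characteristic 2; only the middle
  term of an even n remains.\<close>

lemma fps_bit_square_nth:
  fixes f :: "bit fps"
  shows "fps_nth (f^2) n = (if even n then fps_nth f (n div 2) else 0)"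
proof -
  define g where "g i = fps_nth f i * fps_nth f (n - i)" for i
  define lo hi mid where "lo = {i. i \<le> n \<and> i < n - i}" and "hi = {i. i \<le> n \<and> n - i < i}"
    and "mid = {i. i \<le> n \<and> i = n - i}"
  have f: "finite lo" "finite hi" "finite mid" unfolding lo_def hi_def mid_def by auto
  have "{0..n} = (lo \<union> hi) \<union> mid" by (auto simp: lo_def hi_def mid_def)
  moreover have "lo \<inter> hi = {}" "(lo \<union> hi) \<inter> mid = {}" by (auto simp: lo_def hi_def mid_def)
  ultimately have "(\<Sum>i=0..n. g i) = sum g lo + sum g hi + sum g mid"
    using f by (simp add: sum.union_disjoint)
  also have "sum g hi = sum g lo"
    by (rule sum.reindex_bij_witness[of _ "\<lambda>i. n - i" "\<lambda>i. n - i"])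
       (auto simp: lo_def hi_def g_def mult.commute)
  also have "sum g lo + sum g lo + sum g mid = sum g mid" by simp
  also have "mid = (if even n then {n div 2} else {})"
    by (auto simp: mid_def) presburger+
  also have "sum g (if even n then {n div 2} else {}) = (if even n then fps_nth f (n div 2) else 0)"
  proof -
    have "x * x = x" for x :: bit by (cases x) auto
    then have "g b = fps_nth f b" if "n = 2 * b" for b
      using that unfolding g_def by (metis add_diff_cancel_left' mult_2)
    then show ?thesis by (auto elim!: evenE)
  qed
  finally show ?thesis by (simp add: power2_eq_square fps_mult_nth g_def)
qed

section \<open>Parity of exponents and the odd span\<close>

definition even_supp :: "bit fps \<Rightarrow> bool" where
  "even_supp f \<longleftrightarrow> (\<forall>n. odd n \<longrightarrow> fps_nth f n = 0)"

definition odd_supp :: "bit fps \<Rightarrow> bool" where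
  "odd_supp f \<longleftrightarrow> (\<forall>n. even n \<longrightarrow> fps_nth f n = 0)"

lemma even_supp_r_power: "even_supp (r ^ (2 * i))"
  unfolding power_even_eq by (simp add: even_supp_def fps_bit_square_nth)

text \<open>Doubling the exponent swaps the indicators for t = 1, 2 and those for t = 5, 10, so r
  has equal coefficients at j and 2j. The former is the coefficient of r^2 at 2j, and the two
  cancel.\<close>

lemma odd_supp_r: "odd_supp (r^2 + r)"
  unfolding odd_supp_def
proof (intro allI impI)
  fix n :: nat assume "even n"
  then obtain j where "n = 2 * j" by blast
  moreover have "square_ind 1 (2 * j) = square_ind 2 j" "square_ind 2 (2 * j) = square_ind 1 j"
      "square_ind 5 (2 * j) = square_ind 10 j" "square_ind 10 (2 * j) = square_ind 5 j"
    using square_ind_odd_double[of 1 j] square_ind_double_double[of 1 j] square_ind_odd_double[of 5 j] square_ind_double_double[of 5 j]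
    by simp_all
  then have "fps_nth r (2 * j) = fps_nth r j"
    unfolding r_nth by (simp only: ac_simps)
  ultimately show "fps_nth (r^2 + r) n = 0"
    by (simp add: fps_bit_square_nth)
qed

lemma odd_supp_mult: "even_supp f \<Longrightarrow> odd_supp g \<Longrightarrow> odd_supp (f * g)"
  unfolding odd_supp_def fps_mult_nth
proof (intro allI impI sum.neutral ballI)
  fix n i :: nat assume *: "even_supp f" "\<forall>n. even n \<longrightarrow> fps_nth g n = 0" "even n" "i \<in> {0..n}"
  then show "fps_nth f i * fps_nth g (n - i) = 0" by (cases "even i") (auto simp: even_supp_def)
qed

lemma odd_supp_sum: "(\<And>i. i \<in> I \<Longrightarrow> odd_supp (f i)) \<Longrightarrow> odd_supp (\<Sum>i\<in>I. f i)"
  by (simp add: odd_supp_def fps_sum_nth)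

lemma even_supp_sum: "(\<And>i. i \<in> I \<Longrightarrow> even_supp (f i)) \<Longrightarrow> even_supp (\<Sum>i\<in>I. f i)"
  by (simp add: even_supp_def fps_sum_nth)

lemma span_r_odd_supp:
  assumes "f \<in> span_r_odd m" shows "odd_supp f"
proof -
  have "odd_supp (fps_const c * (r ^ (2 * i) * (r^2 + r)))" for c i
    using odd_supp_mult[OF even_supp_r_power odd_supp_r, of i] by (simp add: odd_supp_def)
  with assms show ?thesis by (auto simp: span_r_odd_def intro!: odd_supp_sum)
qed

lemma rearrange_consecutive:
  fixes a b u v :: "'a::comm_ring_1"
  shows "a * u + b * v = (b - a) * v + a * (v + u)"
  by (simp add: algebra_simps)

text \<open>Each odd power is traded through r^(2i-1) = r^(2i-2) (r^2 + r) - r^(2i), which lowers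
  the coefficient of r^(2i) by \<open>c (2 * i - 1)\<close>. The case i = 0 is separate because the
  index would be truncated to 0.\<close>

lemma span_r_split:
  fixes c :: "nat \<Rightarrow> bit"
  defines "e \<equiv> (\<lambda>i. c (2 * i) - (if i = 0 then 0 else c (2 * i - 1)))"
  shows "(\<Sum>i\<le>2*m. fps_const (c i) * r ^ i) =
     (\<Sum>i\<le>m. fps_const (e i) * r ^ (2 * i)) +
     (\<Sum>i<m. fps_const (c (2 * i + 1)) * (r ^ (2 * i) * (r^2 + r)))"
proof (induction m)
  case 0
  then show ?case by (simp add: e_def)
next
  case (Suc m)
  have "(\<Sum>i\<le>2 * Suc m. fps_const (c i) * r ^ i) = (\<Sum>i\<le>2 * m. fps_const (c i) * r ^ i) +
     fps_const (c (2 * m + 1)) * r ^ (2 * m + 1) + fps_const (c (2 * m + 2)) * r ^ (2 * m + 2)"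
    by (simp add: numeral_2_eq_2)
  also have "fps_const (c (2 * m + 1)) * r ^ (2 * m + 1) + fps_const (c (2 * m + 2)) * r ^ (2 * m + 2) =
     fps_const (e (Suc m)) * r ^ (2 * Suc m) + fps_const (c (2 * m + 1)) * (r ^ (2 * m) * (r^2 + r))"
  proof -
    have 1: "r ^ (2 * m) * (r^2 + r) = r ^ (2 * m + 2) + r ^ (2 * m + 1)"
      by (simp only: distrib_left power_add power_one_right)
    have 2: "fps_const (e (Suc m)) = fps_const (c (2 * m + 2)) - fps_const (c (2 * m + 1))"
      by (simp add: e_def)
    have 3: "2 * Suc m = 2 * m + 2" by simp
    show ?thesis unfolding 1 2 3 by (rule rearrange_consecutive)
  qed
  ultimately show ?case unfolding Suc by simp
qed

text \<open>In the splitting above, the even powers of r have even exponents and the remaining sum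
  odd ones; for odd f the first part must vanish.\<close>

lemma odd_part_span_r:
  assumes f: "f \<in> span_r m" and o: "odd_supp f"
  shows "f \<in> span_r_odd m"
proof -
  obtain c where c: "f = (\<Sum>i\<le>2*m. fps_const (c i) * r ^ i)" using f by (auto simp: span_r_def)
  define e where "e i = c (2 * i) - (if i = 0 then 0 else c (2 * i - 1))" for i
  define g h where "g = (\<Sum>i\<le>m. fps_const (e i) * r ^ (2 * i))"
    and "h = (\<Sum>i<m. fps_const (c (2 * i + 1)) * (r ^ (2 * i) * (r^2 + r)))"
  have fgh: "f = g + h" unfolding c g_def h_def e_def by (rule span_r_split)
  have "even_supp g"
    unfolding g_def using even_supp_r_power by (intro even_supp_sum) (simp add: even_supp_def)
  moreover have h: "h \<in> span_r_odd m"
    unfolding span_r_odd_def h_def by (intro CollectI exI[of _ "\<lambda>i. c (2 * i + 1)"]) simp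
  then have "odd_supp h" by (rule span_r_odd_supp)
  ultimately have "fps_nth g n = 0" for n
    using o fgh by (cases "even n") (auto simp: even_supp_def odd_supp_def)
  then have "g = 0" by (simp add: fps_eq_iff)
  then show ?thesis using fgh h by simp
qed

section \<open>Integral forms that reduce to the powers of r\<close>

lemma mod2_add: "mod2 (A + B) = mod2 A + mod2 B"
  and mod2_diff: "mod2 (A - B) = mod2 A - mod2 B"
  and mod2_mult: "mod2 (A * B) = mod2 A * mod2 B"
  and mod2_const: "mod2 (fps_const c) = fps_const (of_int c)"
  and mod2_0: "mod2 0 = 0"
  and mod2_1: "mod2 1 = 1"
  and mod2_numeral: "mod2 (numeral n) = numeral n"
  by (simp_all add: mod2_def fps_eq_iff fps_mult_nth fps_numeral_nth)

lemma mod2_power: "mod2 (A ^ n) = mod2 A ^ n"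
  by (induction n) (simp_all add: mod2_1 mod2_mult)

lemma mod2_sum: "mod2 (\<Sum>i\<in>I. A i) = (\<Sum>i\<in>I. mod2 (A i))"
  by (induction I rule: infinite_finite_induct) (simp_all add: mod2_0 mod2_add)

lemma mod2_nth: "fps_nth (mod2 A) n = of_int (fps_nth A n)"
  by (simp add: mod2_def)

lemma fps_bit_numeral: "numeral (Num.Bit0 n) = (0 :: bit fps)" "numeral (Num.Bit1 n) = (1 :: bit fps)"
  by (simp_all add: fps_eq_iff fps_numeral_nth)

text \<open>The quotient (E4 - 1) / 48 written as an integral polynomial in S and its derivative,
  where only the term -S has an odd coefficient.\<close>

definition E4_quot :: "int fps" where
  "E4_quot = 12 * sigma_fps^2 + 6 * euler_op sigma_fps - sigma_fps"

lemma E4_E4_quot: "E4 = 1 + 48 * E4_quot"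
  by (simp add: E4_def E4_quot_def power2_eq_square algebra_simps)

lemma mod2_E4_quot: "mod2 E4_quot = mod2 sigma_fps"
  by (simp add: E4_quot_def mod2_add mod2_diff mod2_mult mod2_numeral fps_bit_numeral fps_eq_iff)

lemma mod2_dilate_cong: "mod2 A = mod2 B \<Longrightarrow> mod2 (dilate t A) = mod2 (dilate t B)"
  by (auto simp: dilate_def mod2_def fps_eq_iff)

text \<open>Dilation by 5 turns the indicators for t = 1, 2 into those for t = 5, 10.\<close>

lemma mod2_sigma: "mod2 sigma_fps + mod2 (dilate 5 sigma_fps) = r"
proof (rule fps_ext)
  fix n
  have 5: "square_ind (5 * t) n = (if 5 dvd n then square_ind t (n div 5) else 0)" for t
  proof (cases "5 dvd n")
    case True
    then obtain m where "n = 5 * m" by blast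
    then show ?thesis by (simp add: square_ind_def)
  qed (auto simp: square_ind_def)
  show "fps_nth (mod2 sigma_fps + mod2 (dilate 5 sigma_fps)) n = fps_nth r n"
  proof -
    have "(of_int (fps_nth (dilate 5 sigma_fps) n) :: bit) = square_ind 5 n + square_ind 10 n"
      using 5[of 1] 5[of 2] sigma_mod_2[of "n div 5"] by (cases "5 dvd n") (simp_all add: dilate_def)
    then show ?thesis
      by (simp only: r_nth mod2_nth fps_add_nth sigma_mod_2 add.assoc)
  qed
qed

text \<open>formA is (E4 - E4(5z)) / 48 and formB is (G2^2 - E4) / 12, with the divisions carried out.\<close>
definition formA :: "int fps" where "formA = E4_quot - dilate 5 E4_quot"

lemma formA_int_modforms: "formA \<in> int_modforms 4"
proof (rule int_modforms_divide)
  have "fps_const 48 * formA = E4 - dilate 5 E4"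
    by (auto simp: formA_def E4_E4_quot dilate_def fps_eq_iff numeral_fps_const algebra_simps)
  then show "fps_const 48 * formA \<in> int_modforms 4"
    using E4_int_modforms dilate_E4_int_modforms[of 5] by (simp add: int_modforms_diff)
qed simp

lemma mod2_formA: "mod2 formA = r"
  using mod2_dilate_cong[OF mod2_E4_quot, of 5] mod2_sigma
  by (simp add: formA_def mod2_diff mod2_E4_quot fps_eq_iff)

definition formB :: "int fps" where
  "formB = (sigma_fps - 5 * dilate 5 sigma_fps) + 3 * (sigma_fps - 5 * dilate 5 sigma_fps)^2 - 4 * E4_quot"

lemma formB_int_modforms: "formB \<in> int_modforms 4"
proof (rule int_modforms_divide)
  \<comment> \<open>With D = S - 5 S(x^5) one has G2 = 1 + 6D, whose square is 1 + 12D +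
    36D^2.\<close>
  have "fps_const 12 * formB = G2 * G2 - E4"
    by (simp add: formB_def G2_def E4_E4_quot numeral_fps_const[symmetric] power2_eq_square algebra_simps)
  then show "fps_const 12 * formB \<in> int_modforms 4"
    using int_modforms_diff[OF int_modforms_mult[OF G2_int_modforms G2_int_modforms]] E4_int_modforms by simp
qed simp

lemma mod2_formB: "mod2 formB = r^2 + r"
proof -
  have "mod2 (sigma_fps - 5 * dilate 5 sigma_fps) = r"
    using mod2_sigma by (simp add: mod2_diff mod2_mult mod2_numeral fps_bit_numeral fps_eq_iff)
  then show ?thesis
    by (simp add: formB_def mod2_add mod2_diff mod2_mult mod2_power mod2_numeral fps_bit_numeral add.commute)
qed

lemma square_ind_1: "square_ind 1 (Suc 0) = 1" "t > 1 \<Longrightarrow> square_ind t (Suc 0) = 0"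
  by (auto simp: square_ind_def)

lemma r_nth_0: "fps_nth r 0 = 0" and r_nth_1: "fps_nth r (Suc 0) = 1"
  by (simp_all add: r_nth square_ind_0 square_ind_1 del: One_nat_def)

lemma formA_0: "fps_nth formA 0 = 0"
  by (simp add: formA_def dilate_def)

lemma formB_0: "fps_nth formB 0 = 0"
  by (simp add: formB_def E4_quot_def dilate_def euler_op_def power2_eq_square)

text \<open>Odd multiples of the two forms, combined to cancel the coefficient of x.\<close>
definition formC :: "int fps" where
  "formC = fps_const (fps_nth formA (Suc 0)) * formB - fps_const (fps_nth formB (Suc 0)) * formA"

lemma formC_int_modforms: "formC \<in> int_modforms 4"
  unfolding formC_def by (intro int_modforms_diff int_modforms_scale formA_int_modforms formB_int_modforms)

lemma mod2_formC: "mod2 formC = r^2"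
proof -
  have "(of_int (fps_nth formA (Suc 0)) :: bit) = 1"
    using mod2_formA r_nth_1 by (metis mod2_nth)
  moreover have "(of_int (fps_nth formB (Suc 0)) :: bit) = 1"
    unfolding mod2_nth[symmetric] mod2_formB using r_nth_1 by (simp add: fps_bit_square_nth)
  ultimately show ?thesis
    by (simp add: formC_def mod2_diff mod2_mult mod2_const mod2_formA mod2_formB)
qed

lemma formA_factor: "\<exists>U. formA = fps_X * U"
proof
  show "formA = fps_X * fps_shift 1 formA"
    by (rule fps_ext) (auto simp: fps_X_mult_nth formA_0)
qed

lemma formC_factor: "\<exists>U. formC = fps_X^2 * U"
proof
  have "fps_nth formC n = 0" if "n < 2" for n
    using that by (auto simp: less_2_cases_iff formC_def formA_0 formB_0)
  then have "fps_nth formC n = fps_nth (fps_X^2 * fps_shift 2 formC) n" for n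
    by (cases "n < 2") (simp_all add: fps_X_power_mult_nth del: add_2_eq_Suc')
  then show "formC = fps_X^2 * fps_shift 2 formC" by (rule fps_ext)
qed

text \<open>Powers of \<open>formA\<close> alone would have weight 4j. \<open>formC\<close> gains
  two orders for each weight 4, which suffices up to j = 2m; one \<open>formA\<close> supplies an
  odd order, and \<open>E4\<close>, being 1 modulo 2, fills up the weight.\<close>

definition basis :: "nat \<Rightarrow> nat \<Rightarrow> int fps" where
  "basis m j = formC ^ (j div 2) * (if even j then E4 ^ (m - j div 2) else formA * E4 ^ (m - 1 - j div 2))"

lemma mod2_E4: "mod2 E4 = 1"
  by (simp add: E4_E4_quot mod2_add mod2_1 mod2_mult mod2_numeral fps_bit_numeral)

lemma mod2_basis: "mod2 (basis m j) = r ^ j"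
proof (cases "even j")
  case True
  then show ?thesis
    by (auto simp: basis_def mod2_mult mod2_power mod2_formC mod2_E4 power_mult[symmetric])
next
  case False
  then obtain i where "j = 2 * i + 1" by (elim oddE)
  then show ?thesis
    by (simp add: basis_def mod2_mult mod2_power mod2_formC mod2_formA mod2_E4 power_mult[symmetric])
qed

lemma basis_int_modforms:
  assumes "j \<le> 2 * m" shows "basis m j \<in> int_modforms (4 * m)"
proof (cases "even j")
  case True
  then have "j div 2 * 4 + (m - j div 2) * 4 = 4 * m" using assms by auto
  then show ?thesis
    using int_modforms_mult[OF int_modforms_power[OF formC_int_modforms, of "j div 2"] int_modforms_power[OF E4_int_modforms, of "m - j div 2"]] True
    by (simp add: basis_def)
next
  case False
  then obtain l where "j = 2 * l + 1" by (elim oddE)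
  then have "j div 2 * 4 + (4 + (m - 1 - j div 2) * 4) = 4 * m" using assms by simp
  then show ?thesis
    using int_modforms_mult[OF int_modforms_power[OF formC_int_modforms, of "j div 2"] int_modforms_mult[OF formA_int_modforms int_modforms_power[OF E4_int_modforms, of "m - 1 - j div 2"]]] False
    by (simp add: basis_def)
qed

lemma basis_low:
  assumes "i < j" shows "fps_nth (basis m j) i = 0"
proof -
  obtain U V where UV: "formA = fps_X * U" "formC = fps_X^2 * V"
    using formA_factor formC_factor by blast
  have "\<exists>W. basis m j = fps_X ^ j * W"
  proof (cases "even j")
    case True
    then show ?thesis
      by (auto simp: basis_def UV power_mult_distrib power_mult[symmetric] mult.assoc)
  next
    case False
    then obtain l where "j = 2 * l + 1" by (elim oddE)
    then have "basis m j = fps_X ^ j * (V ^ l * (U * E4 ^ (m - 1 - l)))"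
      by (simp add: basis_def UV power_mult_distrib power_mult[symmetric] algebra_simps)
    then show ?thesis by blast
  qed
  then show ?thesis using assms by (auto simp: fps_X_power_mult_nth)
qed

lemma r_power_lead: "fps_nth (r ^ n) n = 1"
proof -
  have r: "r = fps_X * fps_shift 1 r"
    by (rule fps_ext) (auto simp: fps_X_mult_nth r_nth_0)
  have *: "r ^ n = fps_X ^ n * fps_shift 1 r ^ n"
    by (subst r) (simp add: power_mult_distrib)
  have "fps_nth (fps_shift 1 r ^ n) 0 = 1" by (simp add: fps_nth_power_0 r_nth_1)
  then show ?thesis
    unfolding * by (simp add: fps_X_power_mult_nth)
qed

text \<open>The parity of the leading coefficient is read off the reduction r^j = x^j + ...,
  whatever its integral value is.\<close>

lemma basis_lead: "odd (fps_nth (basis m j) j)"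
proof -
  have "(of_int (fps_nth (basis m j) j) :: bit) = 1"
    unfolding mod2_nth[symmetric] mod2_basis by (rule r_power_lead)
  then show ?thesis by (cases "even (fps_nth (basis m j) j)") auto
qed

text \<open>Triangular elimination without division: instead of dividing by the leading
  coefficients, F is multiplied by them. They are odd, hence so is N.\<close>

lemma basis_approx:
  "\<exists>N c. odd N \<and> (\<forall>i<n. fps_nth (fps_const N * F - (\<Sum>j<n. fps_const (c j) * basis m j)) i = 0)"
proof (induction n)
  case 0
  then show ?case by (intro exI[of _ 1]) auto
next
  case (Suc n)
  then obtain N c where N: "odd N"
    and c: "\<And>i. i < n \<Longrightarrow> fps_nth (fps_const N * F - (\<Sum>j<n. fps_const (c j) * basis m j)) i = 0"
    by blast
  define Q where "Q = fps_const N * F - (\<Sum>j<n. fps_const (c j) * basis m j)"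
  define b where "b = fps_nth (basis m n) n"
  \<comment> \<open>With remainder Q and leading coefficient b, the series b Q minus Q_n times the
    next basis form vanishes at n as well. So the old coefficients are scaled by b and the new one
    is Q_n.\<close>
  define c' where "c' j = (if j < n then b * c j else fps_nth Q n)" for j
  have "fps_const (b * N) * F - (\<Sum>j<Suc n. fps_const (c' j) * basis m j) =
     fps_const b * Q - fps_const (fps_nth Q n) * basis m n"
    by (simp add: c'_def Q_def fps_const_mult[symmetric] right_diff_distrib sum_distrib_left
        mult.assoc del: fps_const_mult)
  moreover have "fps_nth (fps_const b * Q - fps_const (fps_nth Q n) * basis m n) i = 0" if "i < Suc n" for i
    using that c[of i] basis_low[of i n m] by (cases "i = n") (auto simp: Q_def[symmetric] b_def)
  ultimately show ?case
    using N basis_lead[of m n] by (intro exI[of _ "b * N"] exI[of _ c']) (auto simp: b_def)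
qed

theorem Mk_eq_span_r: "Mk (4 * m) = span_r m"
proof (intro equalityI subsetI)
  fix f assume "f \<in> Mk (4 * m)"
  then obtain F where F: "F \<in> int_modforms (4 * m)" "f = mod2 F" by (auto simp: Mk_eq)
  obtain N c where N: "odd N" and
    c: "\<And>i. i < Suc (2 * m) \<Longrightarrow> fps_nth (fps_const N * F - (\<Sum>j<Suc (2 * m). fps_const (c j) * basis m j)) i = 0"
    using basis_approx[of "Suc (2 * m)" F m] by blast
  have "fps_const N * F - (\<Sum>j<Suc (2 * m). fps_const (c j) * basis m j) = 0"
  proof (rule sturm)
    show "fps_const N * F - (\<Sum>j<Suc (2 * m). fps_const (c j) * basis m j) \<in> int_modforms (4 * m)"
      by (intro int_modforms_diff int_modforms_scale F int_modforms_sum basis_int_modforms) auto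
    show "fps_nth (fps_const N * F - (\<Sum>j<Suc (2 * m). fps_const (c j) * basis m j)) n = 0"
      if "n \<le> 2 * m" for n using that by (intro c) simp
  qed
  then have "mod2 (fps_const N * F) = mod2 (\<Sum>j<Suc (2 * m). fps_const (c j) * basis m j)" by simp
  \<comment> \<open>The odd multiplier N disappears modulo 2.\<close>
  moreover have "(of_int N :: bit) = 1" using N by (auto elim!: oddE)
  ultimately have "f = (\<Sum>j\<le>2 * m. fps_const (of_int (c j)) * r ^ j)"
    by (simp add: mod2_mult mod2_const mod2_sum mod2_basis F(2) lessThan_Suc_atMost del: sum.lessThan_Suc)
  then show "f \<in> span_r m" unfolding span_r_def by (intro CollectI exI[of _ "\<lambda>j. of_int (c j)"]) simp
next
  fix f assume "f \<in> span_r m"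
  then obtain c where c: "f = (\<Sum>i\<le>2*m. fps_const (c i) * r ^ i)" by (auto simp: span_r_def)
  define c' :: "nat \<Rightarrow> int" where "c' i = of_bool (c i = 1)" for i
  have "of_int (c' i) = c i" for i by (cases "c i") (auto simp: c'_def)
  then have "f = mod2 (\<Sum>i\<le>2*m. fps_const (c' i) * basis m i)"
    by (simp add: c mod2_sum mod2_mult mod2_const mod2_basis)
  moreover have "(\<Sum>i\<le>2*m. fps_const (c' i) * basis m i) \<in> int_modforms (4 * m)"
    by (intro int_modforms_sum int_modforms_scale basis_int_modforms) simp
  ultimately show "f \<in> Mk (4 * m)" by (auto simp: Mk_eq)
qed

text \<open>The generator r^(2i) (r^2 + r) is the reduction of the sum of the basis forms for 2i + 1
  and 2i + 2; closure under linear combinations is that of the integral forms.\<close>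

lemma span_r_odd_subset: "span_r_odd m \<subseteq> span_r m"
proof
  fix f assume "f \<in> span_r_odd m"
  then obtain c where c: "f = (\<Sum>i<m. fps_const (c i) * (r ^ (2*i) * (r^2 + r)))"
    by (auto simp: span_r_odd_def)
  define c' :: "nat \<Rightarrow> int" where "c' i = of_bool (c i = 1)" for i
  have "of_int (c' i) = c i" for i by (cases "c i") (auto simp: c'_def)
  then have "f = mod2 (\<Sum>i<m. fps_const (c' i) * (basis m (2 * i + 2) + basis m (2 * i + 1)))"
    by (simp add: c mod2_sum mod2_mult mod2_const mod2_add mod2_basis power_add power2_eq_square algebra_simps)
  moreover have "(\<Sum>i<m. fps_const (c' i) * (basis m (2 * i + 2) + basis m (2 * i + 1))) \<in> int_modforms (4 * m)"
    by (intro int_modforms_sum int_modforms_scale int_modforms_add basis_int_modforms) auto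
  ultimately show "f \<in> span_r m" by (auto simp: Mk_eq_span_r[symmetric] Mk_eq)
qed

section \<open>Hecke operators modulo 2\<close>

lemma Tp_mod2:
  assumes "odd p" shows "Tp p (mod2 A) = mod2 (hecke_fps p k A)"
proof -
  \<comment> \<open>Both factors p and p^k in the integral operator become 1, which leaves T_p for
    every k.\<close>
  have "(of_nat p :: bit) = 1" using assms by (auto elim!: oddE)
  then show ?thesis by (auto simp: Tp_def mod2_def hecke_fps_def fps_eq_iff)
qed

lemma Tp_Mk:
  assumes p: "prime p" "p \<noteq> 2" "p \<noteq> 5" and f: "f \<in> Mk k"
  shows "Tp p f \<in> Mk k"
proof -
  have "odd p" using p prime_ge_2_nat[of p] by (intro prime_odd_nat) auto
  moreover obtain A where "A \<in> int_modforms k" "f = mod2 A" using f by (auto simp: Mk_eq)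
  ultimately show ?thesis using Tp_mod2[of p A k] hecke_int_modforms[of A k p] p by (auto simp: Mk_eq)
qed

text \<open>Multiplying or dividing an exponent by an odd p keeps its parity.\<close>

lemma Tp_odd_supp:
  assumes "odd p" "odd_supp f"
  shows "odd_supp (Tp p f)"
proof -
  have "even (n div p)" if "p dvd n" "even n" for n
    using that \<open>odd p\<close> by (metis dvd_mult_div_cancel even_mult_iff)
  then show ?thesis using assms by (simp add: odd_supp_def Tp_def)
qed

theorem theorem1p14:
  fixes p :: nat
  assumes "prime p" and "p \<noteq> 2" and "p \<noteq> 5"
  shows "Tp p ` M \<subseteq> M \<and> Tp p ` M_odd \<subseteq> M_odd \<and>
         (\<forall>m. Tp p ` span_r m \<subseteq> span_r m \<and> Tp p ` span_r_odd m \<subseteq> span_r_odd m)"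
proof -
  have podd: "odd p" using assms prime_ge_2_nat[of p] by (intro prime_odd_nat) auto
  have M: "Tp p f \<in> M" if "f \<in> M" for f
    using that Tp_Mk[OF assms] by (auto simp: M_def)
  have M_odd: "Tp p f \<in> M_odd" if "f \<in> M_odd" for f
    using that M Tp_odd_supp[OF podd, of f] by (auto simp: M_odd_def odd_supp_def)
  have span: "Tp p f \<in> span_r m" if "f \<in> span_r m" for f m
    using that Tp_Mk[OF assms] by (simp add: Mk_eq_span_r[symmetric])
  have "Tp p f \<in> span_r_odd m" if "f \<in> span_r_odd m" for f m
    using that span span_r_odd_subset Tp_odd_supp[OF podd span_r_odd_supp]
    by (intro odd_part_span_r) auto
  then show ?thesis using M M_odd span by auto
qed

end
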